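(* Let $p$ be a prime integer and $k$ a positive integer, and let $\Delta\subset\mathbb{R}^d$ be a Gorenstein simplex of dimension $d$ whose $\delta$-polynomial is $1+t^{k}+t^{2k}+\cdots+t^{(p^2-1)k}$. Suppose that $\Delta$ is not a lattice pyramid over any lower-dimensional lattice simplex. Then one of the following holds: (1) $d=p^2k-1$; (2) $d=p^2k+(p-1)k-1$; (3) $d=p^2k+pk-1$. Moreover, in each case, a system of generators of the finite abelian group $\Lambda_\Delta$ is the set of row vectors of the following matrix, up to permutation of the columns: (1) $(1/p^2\ \cdots\ 1/p^2)\in(\mathbb{R}/\mathbb{Z})^{1\times p^2k}$; (2) $\big(\underbrace{1/p\ \cdots\ 1/p}_{(p^2-1)k}\ \underbrace{1/p^2\ \cdots\ 1/p^2}_{pk}\big)\in(\mathbb{R}/\mathbb{Z})^{1\times(p^2+p-1)k}$; (3) the matrix in $(\mathbb{R}/\mathbb{Z})^{2\times p(p+1)k}$ with rows $(\underbrace{1/p,\ldots,1/p}_{pk},\underbrace{0,\ldots,0}_{p^2k})$ and $(\underbrace{0,\ldots,0}_{pk},\underbrace{1/p,\ldots,1/p}_{p^2k})$. In particular, $\Delta$ is unimodularly equivalent to one of $\Delta(A_1)$, $\Delta(A_2)$, $\Delta(B,C)$, where $$A_1=(\underbrace{1,\ldots,1}_{p^2k-2},p^2),\qquad A_2=(\underbrace{1,\ldots,1}_{pk-1},\underbrace{p,\ldots,p}_{(p^2-1)k-1},p^2),$$ $$B=(\underbrace{1,\ldots,1}_{pk-1},p),\qquad C=(\underbrace{p,\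ldots,p}_{pk},\underbrace{1,\ldots,1}_{p^2k-2},p).$$
   Context: A lattice polytope is a convex polytope in $\mathbb{R}^d$ all of whose vertices lie in $\mathbb{Z}^d$; a lattice simplex is a lattice polytope that is a simplex. For a $d$-dimensional lattice polytope $\mathcal{P}\subset\mathbb{R}^d$, its $\delta$-polynomial ($h^*$-polynomial) $\delta(\mathcal{P},t)$ is defined by $(1-t)^{d+1}\left(1+\sum_{n\ge1}|n\mathcal{P}\cap\mathbb{Z}^d|\,t^n\right)=\delta(\mathcal{P},t)$. Two $d$-dimensional lattice polytopes $\mathcal{P},\mathcal{Q}\subset\mathbb{R}^d$ are unimodularly equivalent if $\mathcal{Q}=f_U(\mathcal{P})+\mathbf{w}$ for some $\mathbf{w}\in\mathbb{Z}^d$ and some $U\in\mathbb{Z}^{d\times d}$ with $\det U=\pm1$, where $f_U(\mathbf{v})=\mathbf{v}U$. A $d$-dimensional lattice polytope is reflexive if the origin is in its interior and its dual polytope is again a lattice polytope; $\mathcal{P}$ is Gorenstein if for some positive integer $r$ the polytope $r\mathcal{P}$ is unimodularly equivalent to a reflexive polytope (equivalently, $\delta(\mathcal{P},t)=\delta_0+\cdots+\delta_st^s$ with $\delta_s\ne0$ is palindromic). For a $d$-dimensional lattice simplex $\Delta\subset\mathbb{R}^d$ with vertices $\mathbf{v}_0,\ldots,\mathbf{v}_d$, set $\Lambda_\Delta=\{(\lambda_0,\ldots,\lambda_d)\in(\mathbb{R}/\mathbb{Z})^{d+1}:\sum_{i=0}^d\lambda_i(\mathbf{v}_i,1)\in\mathbb{Z}^{d+1}\}$,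 a finite abelian group under componentwise addition; permuting coordinates corresponds to reordering the vertices. The lattice pyramid over a $d$-dimensional lattice polytope $\mathcal{P}$ is $\mathrm{Pyr}(\mathcal{P})=\mathrm{conv}(\mathcal{P}\times\{0\},(0,\ldots,0,1))\subset\mathbb{R}^{d+1}$. A lattice simplex is called a lattice pyramid (over a lower-dimensional lattice simplex) if it is, up to unimodular equivalence, obtained by successively taking lattice pyramids; equivalently, there is $i\in\{0,\ldots,d\}$ with $\lambda_i=0$ for all $(\lambda_0,\ldots,\lambda_d)\in\Lambda_\Delta$. Write $\mathbf{e}_1,\ldots,\mathbf{e}_d$ for the standard basis of $\mathbb{R}^d$. For a sequence $A=(a_1,\ldots,a_d)$ of integers, $\Delta(A)\subset\mathbb{R}^d$ is the convex hull of the origin, $\mathbf{e}_1,\ldots,\mathbf{e}_{d-1}$ and $(a_d-a_1,\ldots,a_d-a_{d-1},a_d)$. For sequences $B=(b_1,\ldots,b_s)$ and $C=(c_1,\ldots,c_d)$ of integers with $1\le s<d$, $\Delta(B,C)\subset\mathbb{R}^d$ is the convex hull of the origin, the vectors $\mathbf{e}_i$ for $i\in\{1,\ldots,d-1\}\setminus\{s\}$, the vector $(b_s-b_1,\ldots,b_s-b_{s-1},b_s,0,\ldots,0)$, and the vector $(c_d-c_1,\ldots,c_d-c_{d-1},c_d)$. *)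

theory Defs
  imports
    "HOL-Analysis.Analysis"
    "HOL-Algebra.Generated_Groups"
    "HOL-Computational_Algebra.Polynomial_FPS"
    "HOL-Computational_Algebra.Primes"
    "HOL-Combinatorics.Permutations"
begin

section \<open>Lattice polytopes\<close>

definition lattice_points :: "(real ^ 'n) set" where
  "lattice_points = {x. \<forall>i. x $ i \<in> \<int>}"

definition lattice_polytope :: "(real ^ 'n::finite) set \<Rightarrow> bool" where
  "lattice_polytope P \<longleftrightarrow> polytope P \<and> {v. v extreme_point_of P} \<subseteq> lattice_points"

definition lattice_simplex :: "nat \<Rightarrow> (real ^ 'n::finite) set \<Rightarrow> bool" where
  "lattice_simplex m P \<longleftrightarrow> int m simplex P \<and> lattice_polytope P"

definition dilate :: "nat \<Rightarrow> (real ^ 'n) set \<Rightarrow> (real ^ 'n) set" where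
  "dilate n P = (\<lambda>x. real n *\<^sub>R x) ` P"

definition ehrhart_series :: "(real ^ 'n::finite) set \<Rightarrow> int fps" where
  "ehrhart_series P =
     Abs_fps (\<lambda>n. if n = 0 then 1 else int (card (dilate n P \<inter> lattice_points)))"

text \<open>For full-dimensional \<open>P\<close>, so that \<open>d = CARD('n)\<close>.\<close>

definition has_delta_polynomial :: "(real ^ 'n::finite) set \<Rightarrow> int poly \<Rightarrow> bool" where
  "has_delta_polynomial P q \<longleftrightarrow>
     (1 - fps_X) ^ (CARD('n) + 1) * ehrhart_series P = fps_of_poly q"

text \<open>Matrices act on row vectors from the right.\<close>

definition unimodularly_equivalent ::
    "(real ^ 'n::finite) set \<Rightarrow> (real ^ 'n) set \<Rightarrow> bool" where
  "unimodularly_equivalent P Q \<longleftrightarrow>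
     (\<exists>(U :: int ^ 'n ^ 'n) w. det U \<in> {1, -1} \<and> w \<in> lattice_points \<and>
        Q = (\<lambda>v. v v* (\<chi> i j. real_of_int (U $ i $ j)) + w) ` P)"

definition dual_polytope :: "(real ^ 'n::finite) set \<Rightarrow> (real ^ 'n) set" where
  "dual_polytope P = {x. \<forall>y\<in>P. x \<bullet> y \<le> 1}"

definition reflexive :: "(real ^ 'n::finite) set \<Rightarrow> bool" where
  "reflexive P \<longleftrightarrow>
     lattice_polytope P \<and> 0 \<in> interior P \<and> lattice_polytope (dual_polytope P)"

definition gorenstein :: "(real ^ 'n::finite) set \<Rightarrow> bool" where
  "gorenstein P \<longleftrightarrow>
     (\<exists>r>0. \<exists>Q. reflexive Q \<and> unimodularly_equivalent (dilate r P) Q)"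


section \<open>Coordinates and lattice pyramids\<close>

text \<open>
  The index type carries a linear order, which numbers the coordinates \<open>1, \<dots>, d\<close>,
  where \<open>d = CARD('n)\<close>; \<open>std_basis i\<close> is \<open>e\<^sub>i\<close> and is only used for
  \<open>1 \<le> i \<le> d\<close>. For \<open>m \<le> d\<close>, \<open>\<real>\<^sup>m\<close> is the subspace of \<open>\<real>\<^sup>d\<close> on which all
  coordinates after the first \<open>m\<close> vanish, so that \<open>P \<times> {0}\<close> is \<open>P\<close> itself.
\<close>

definition coord :: "nat \<Rightarrow> 'n::{finite, linorder}" where
  "coord i = sorted_list_of_set UNIV ! (i - 1)"

definition std_basis :: "nat \<Rightarrow> real ^ 'n::{finite, linorder}" where
  "std_basis i = axis (coord i) 1"

definition coord_subspace :: "nat \<Rightarrow> (real ^ 'n::{finite, linorder}) set" where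
  "coord_subspace m = {x. \<forall>i. m < i \<and> i \<le> CARD('n) \<longrightarrow> x $ coord i = 0}"

text \<open>\<open>pyramid m P\<close> is the pyramid in \<open>\<real>\<^sup>m\<^sup>+\<^sup>1\<close> over \<open>P \<subseteq> \<real>\<^sup>m\<close>.\<close>

definition pyramid ::
    "nat \<Rightarrow> (real ^ 'n::{finite, linorder}) set \<Rightarrow> (real ^ 'n::{finite, linorder}) set" where
  "pyramid m P = convex hull (insert (std_basis (m + 1)) P)"

primrec iterated_pyramid ::
    "nat \<Rightarrow> nat \<Rightarrow> (real ^ 'n::{finite, linorder}) set \<Rightarrow> (real ^ 'n::{finite, linorder}) set" where
  "iterated_pyramid m 0 P = P"
| "iterated_pyramid m (Suc j) P = pyramid (m + j) (iterated_pyramid m j P)"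

definition lattice_pyramid_over ::
    "nat \<Rightarrow> (real ^ 'n::{finite, linorder}) set \<Rightarrow> (real ^ 'n::{finite, linorder}) set \<Rightarrow> bool" where
  "lattice_pyramid_over m P Q \<longleftrightarrow>
     P \<subseteq> coord_subspace m \<and> lattice_simplex m P \<and>
     unimodularly_equivalent Q (iterated_pyramid m (CARD('n) - m) P)"


section \<open>The simplices \<open>\<Delta>(A)\<close> and \<open>\<Delta>(B, C)\<close>\<close>

text \<open>
  The entry \<open>a\<^sub>i\<close> of a sequence is \<open>A ! (i - 1)\<close>. The sets are meaningful when
  \<open>length A = CARD('n)\<close>, and when \<open>1 \<le> length B < length C = CARD('n)\<close>.
\<close>

definition last_vertex :: "int list \<Rightarrow> real ^ 'n::{finite, linorder}" where
  "last_vertex A =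
     (let l = length A; a = (\<lambda>i. real_of_int (A ! (i - 1)))
      in (\<Sum>i = 1..<l. (a l - a i) *\<^sub>R std_basis i) + a l *\<^sub>R std_basis l)"

definition Delta_A :: "int list \<Rightarrow> (real ^ 'n::{finite, linorder}) set" where
  "Delta_A A = convex hull ({0} \<union> std_basis ` {1..<length A} \<union> {last_vertex A})"

definition Delta_BC :: "int list \<Rightarrow> int list \<Rightarrow> (real ^ 'n::{finite, linorder}) set" where
  "Delta_BC B C =
     convex hull ({0} \<union> std_basis ` ({1..<length C} - {length B})
                      \<union> {last_vertex B, last_vertex C})"


section \<open>The group \<open>\<Lambda>\<^sub>\<Delta>\<close>\<close>

quotient_type real_mod_int = real / "\<lambda>x y. x - y \<in> \<int>"
  morphisms rep_real_mod_int real_mod_int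
proof (intro equivpI reflpI sympI transpI)
  fix x y z :: real
  show "x - x \<in> \<int>" by simp
  show "y - x \<in> \<int>" if "x - y \<in> \<int>" using Ints_minus[OF that] by simp
  show "x - z \<in> \<int>" if "x - y \<in> \<int>" "y - z \<in> \<int>" using Ints_add[OF that] by simp
qed

instantiation real_mod_int :: ab_group_add
begin

lift_definition zero_real_mod_int :: real_mod_int is 0 .

lift_definition plus_real_mod_int :: "real_mod_int \<Rightarrow> real_mod_int \<Rightarrow> real_mod_int" is "(+)"
  by (metis Ints_add add_diff_add)

lift_definition uminus_real_mod_int :: "real_mod_int \<Rightarrow> real_mod_int" is uminus
  by (metis Ints_minus minus_diff_minus)

definition minus_real_mod_int :: "real_mod_int \<Rightarrow> real_mod_int \<Rightarrow> real_mod_int" where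
  "minus_real_mod_int x y = x + - y"

instance
  by standard (simp add: minus_real_mod_int_def | transfer, simp)+

end

text \<open>\<open>torus m\<close> is the additive group \<open>(\<real>/\<int>)\<^sup>m\<close>, with elements written as lists.\<close>

definition torus :: "nat \<Rightarrow> real_mod_int list monoid" where
  "torus m = \<lparr>carrier = {l. length l = m}, mult = map2 (+), one = replicate m 0\<rparr>"

lemma group_torus: "group (torus m)"
proof (rule groupI)
  fix x assume "x \<in> carrier (torus m)"
  then show "\<exists>y\<in>carrier (torus m). y \<otimes>\<^bsub>torus m\<^esub> x = \<one>\<^bsub>torus m\<^esub>"
    by (intro bexI[of _ "map uminus x"]) (auto simp: torus_def intro!: nth_equalityI)
qed (auto simp: torus_def add.assoc intro!: nth_equalityI)

text \<open>
  The list \<open>vs\<close> enumerates the vertices \<open>v\<^sub>0, \<dots>, v\<^sub>d\<close>; the lattice of \<open>\<real>\<^sup>d\<^sup>+\<^sup>1\<close> is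
  \<open>lattice_points \<times> \<int>\<close>. Membership does not depend on the representatives \<open>rs\<close>,
  since the \<open>v\<^sub>i\<close> are lattice points.
\<close>

definition Lambda :: "(real ^ 'n::finite) list \<Rightarrow> real_mod_int list set" where
  "Lambda vs = {map real_mod_int rs | rs. length rs = length vs \<and>
     (\<Sum>i<length vs. (rs ! i) *\<^sub>R (vs ! i, 1 :: real)) \<in> lattice_points \<times> \<int>}"

text \<open>A matrix over \<open>\<real>/\<int>\<close> is the list of its rows.\<close>

definition Lambda_generated_by_rows ::
    "(real ^ 'n::finite) list \<Rightarrow> real_mod_int list list \<Rightarrow> bool" where
  "Lambda_generated_by_rows vs M \<longleftrightarrow>
     (\<forall>row\<in>set M. length row = length vs) \<and>
     (\<exists>\<sigma>. \<sigma> permutes {..<length vs} \<and>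
        generate (torus (length vs)) (permute_list \<sigma> ` set M) = Lambda vs)"

end

theory Submission
  imports Defs
begin

text \<open>
Let \<open>v 0, \<dots>, v d\<close> be the vertices of the simplex, \<open>N = d + 1\<close>, and let \<open>L\<close> be the set of real vectors
\<open>r\<close> such that the combination of the points \<open>(v i, 1)\<close> with coefficients \<open>r i\<close> is integral
(\<open>integral_relations\<close>). It contains all integral vectors, and the group of the statement is
\<open>L\<close> modulo \<open>\<int>\<^sup>N\<close>. The height of a class is the sum of the fractional parts of its coordinates.

The lattice points of the \<open>n\<close>-th dilate correspond to the nonnegative vectors of \<open>L\<close> with
coordinate sum \<open>n\<close>. Splitting each of them into fractional and integral parts shows that the
\<open>\<delta>\<close>-polynomial is the sum of \<open>t\<close> to the height over all classes (\<open>ehrhart_series_simplex\<close>). The given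
\<open>\<delta>\<close>-polynomial thus says that the height is a bijection from the classes onto
\<open>0, k, 2k, \<dots>, (p\<^sup>2 - 1)k\<close>; in particular there are \<open>p\<^sup>2\<close> classes.

The classification rests on the subadditivity of the height (\<open>tight_sequence\<close>): if the \<open>m\<close>-th
vector of a sequence of nonnegative, pairwise incongruent vectors of \<open>L\<close> has coordinate sum
\<open>m k\<close>, then the heights are distinct multiples of \<open>k\<close>, the \<open>m\<close>-th at most \<open>m k\<close>, which
leaves only equality; and equality means that all coordinates are below 1. Let \<open>h\<close> be the class of
height \<open>k\<close>. If its order is \<open>p\<^sup>2\<close>, then its multiples form such a sequence, so that
\<open>(p\<^sup>2 - 1) h i < 1\<close>, and every coordinate of \<open>h\<close> is \<open>1/p\<^sup>2\<close>. If its order is \<open>p\<close>, then the entries of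
\<open>h\<close> are \<open>0\<close> and \<open>1/p\<close>, and together with the class \<open>g\<close> of height \<open>p k\<close> it yields the sequence
\<open>a g + b h\<close>, ordered by \<open>a p + b\<close>; the bound \<open>(p - 1)(g i + h i) < 1\<close> at its end leaves two
possibilities for \<open>g\<close>, according to whether \<open>p g\<close> is congruent to \<open>0\<close> or to \<open>h\<close>. No coordinate vanishes
on all classes, since the simplex would be a lattice pyramid otherwise
(\<open>lattice_pyramid_if_integral_coordinate\<close>).

Finally, \<open>L\<close> determines which barycentric coordinates belong to lattice points, hence the simplex up
to unimodular equivalence (\<open>unimodularly_equivalent_if_same_relations\<close>). It remains to compute the
relations of \<open>\<Delta>(A)\<close> and \<open>\<Delta>(B, C)\<close> and to match the vertices.
\<close>

section \<open>Integral relations between the vertices of a lattice simplex\<close>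

text \<open>
Real representatives of the classes in \<open>Lambda\<close>, as functions on indices, so that fractional parts and
sums of coordinates make sense. Only the values below \<open>N\<close> matter.
\<close>

definition integral_relations :: "nat \<Rightarrow> (nat \<Rightarrow> real ^ 'n::finite) \<Rightarrow> (nat \<Rightarrow> real) set" where
  "integral_relations N v =
     {r. (\<Sum>i<N. r i *\<^sub>R (v i, 1 :: real)) \<in> lattice_points \<times> \<int>}"

lemma lattice_points_0: "0 \<in> lattice_points"
  by (simp add: lattice_points_def)

lemma lattice_points_add: "x \<in> lattice_points \<Longrightarrow> y \<in> lattice_points \<Longrightarrow> x + y \<in> lattice_points"
  by (simp add: lattice_points_def)

lemma lattice_points_diff: "x \<in> lattice_points \<Longrightarrow> y \<in> lattice_points \<Longrightarrow> x - y \<in> lattice_points"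
  by (simp add: lattice_points_def)

lemma lattice_points_scale: "c \<in> \<int> \<Longrightarrow> x \<in> lattice_points \<Longrightarrow> c *\<^sub>R x \<in> lattice_points"
  by (simp add: lattice_points_def)

lemma lattice_points_sum:
  "(\<And>i. i \<in> I \<Longrightarrow> f i \<in> lattice_points) \<Longrightarrow> sum f I \<in> lattice_points"
  by (induction I rule: infinite_finite_induct) (auto intro: lattice_points_0 lattice_points_add)

lemma integral_relations_iff:
  "r \<in> integral_relations N v \<longleftrightarrow> (\<Sum>i<N. r i *\<^sub>R v i) \<in> lattice_points \<and> (\<Sum>i<N. r i) \<in> \<int>"
  by (simp add: integral_relations_def sum_prod scaleR_prod_def)

lemma finite_bounded_lattice_points:
  assumes "bounded (S :: (real ^ 'n::finite) set)"
  shows "finite (S \<inter> lattice_points)"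
proof -
  from assms obtain b where b: "\<And>x. x \<in> S \<Longrightarrow> norm x \<le> b" by (auto simp: bounded_iff)
  have "S \<inter> lattice_points \<subseteq> (\<lambda>f. \<chi> i. real_of_int (f i)) ` (UNIV \<rightarrow>\<^sub>E {- \<lceil>b\<rceil>..\<lceil>b\<rceil>})"
  proof
    fix x assume x: "x \<in> S \<inter> lattice_points"
    define f where "f = (\<lambda>i. \<lfloor>x $ i\<rfloor>)"
    have f: "x $ i = real_of_int (f i)" for i
      using x by (auto simp: f_def lattice_points_def elim: Ints_cases)
    have "f i \<in> {- \<lceil>b\<rceil>..\<lceil>b\<rceil>}" for i
    proof -
      have "\<bar>x $ i\<bar> \<le> b" using component_le_norm_cart[of x i] b[of x] x by auto
      then have "\<bar>real_of_int (f i)\<bar> \<le> of_int \<lceil>b\<rceil>" unfolding f by linarith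
      then show ?thesis by simp linarith
    qed
    then have "f \<in> UNIV \<rightarrow>\<^sub>E {- \<lceil>b\<rceil>..\<lceil>b\<rceil>}" by auto
    moreover have "x = (\<chi> i. real_of_int (f i))" by (simp add: vec_eq_iff f)
    ultimately show "x \<in> (\<lambda>f. \<chi> i. real_of_int (f i)) ` (UNIV \<rightarrow>\<^sub>E {- \<lceil>b\<rceil>..\<lceil>b\<rceil>})" by blast
  qed
  then show ?thesis by (rule finite_subset) (intro finite_imageI finite_PiE; simp)
qed

lemma sum_select_scaleR:
  "i < (N::nat) \<Longrightarrow> (\<Sum>l<N. of_bool (l = i) *\<^sub>R (w l :: 'a::real_vector)) = w i"
  by (simp add: of_bool_def if_distrib[of "\<lambda>c. c *\<^sub>R _"] sum.delta' cong: if_cong)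

lemma sum_select_1: "i < (N::nat) \<Longrightarrow> (\<Sum>l<N. of_bool (l = i)) = (1::real)"
  by (simp add: of_bool_def sum.delta')

lemma convex_hull_family:
  fixes v :: "'i \<Rightarrow> 'a::real_vector"
  assumes "inj_on v I" "finite I"
  shows "convex hull (v ` I) =
    {(\<Sum>i\<in>I. u i *\<^sub>R v i) | u. (\<forall>i\<in>I. 0 \<le> u i) \<and> sum u I = 1}"
    (is "?l = ?r")
proof
  have *: "?l = {y. \<exists>u. (\<forall>x\<in>v ` I. 0 \<le> u x) \<and> sum u (v ` I) = 1 \<and> (\<Sum>x\<in>v ` I. u x *\<^sub>R x) = y}"
    using assms(2) by (intro convex_hull_finite) simp
  show "?l \<subseteq> ?r"
  proof
    fix y assume "y \<in> ?l"
    then obtain u where u: "\<forall>x\<in>v ` I. 0 \<le> u x" "sum u (v ` I) = 1" "(\<Sum>x\<in>v ` I. u x *\<^sub>R x) = y"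
      unfolding * by auto
    then show "y \<in> ?r"
      by (intro CollectI exI[of _ "u \<circ> v"]) (auto simp: sum.reindex[OF assms(1)] comp_def)
  qed
  show "?r \<subseteq> ?l"
  proof
    fix y assume "y \<in> ?r"
    then obtain u where u: "\<forall>i\<in>I. 0 \<le> u i" "sum u I = 1" "y = (\<Sum>i\<in>I. u i *\<^sub>R v i)" by auto
    have inv: "inv_into I v (v i) = i" if "i \<in> I" for i using assms(1) that by simp
    show "y \<in> ?l" unfolding * using u inv
      by (intro CollectI exI[of _ "u \<circ> inv_into I v"]) (auto simp: sum.reindex[OF assms(1)] comp_def)
  qed
qed

text \<open>
Affine independence of the vertices is expressed as linear independence of their lifts to height 1,
which is the form in which relations between them are used.
\<close>

locale simplex_vertices =
  fixes N :: nat and v :: "nat \<Rightarrow> real ^ 'n::finite"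
  assumes N: "N = CARD('n) + 1"
    and lattice: "\<And>i. i < N \<Longrightarrow> v i \<in> lattice_points"
    and indep: "\<And>r i. (\<Sum>i<N. r i *\<^sub>R (v i, 1 :: real)) = 0 \<Longrightarrow> i < N \<Longrightarrow> r i = 0"
begin

abbreviation L :: "(nat \<Rightarrow> real) set" where "L \<equiv> integral_relations N v"

text \<open>
Each class modulo the integral vectors has exactly one representative in this half-open cube; the
values beyond \<open>N\<close> are fixed in order to make it unique as a function.
\<close>

definition cell :: "(nat \<Rightarrow> real) set" where
  "cell = {r \<in> L. (\<forall>i<N. 0 \<le> r i \<and> r i < 1) \<and> (\<forall>i\<ge>N. r i = 0)}"

lemma relation_unique:
  assumes "(\<Sum>i<N. r i *\<^sub>R v i) = (\<Sum>i<N. s i *\<^sub>R v i)" "(\<Sum>i<N. r i) = (\<Sum>i<N. s i)" "i < N"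
  shows "r i = s i"
proof -
  have "(\<Sum>i<N. (r i - s i) *\<^sub>R (v i, 1 :: real)) = 0"
    using assms(1,2)
    by (simp add: sum_prod scaleR_prod_def scaleR_diff_left sum_subtractf zero_prod_def)
  from indep[OF this assms(3)] show ?thesis by simp
qed

lemma inj_v: "inj_on v {..<N}"
proof (rule inj_onI)
  fix i j assume ij: "i \<in> {..<N}" "j \<in> {..<N}" "v i = v j"
  have "(of_bool (i = i) :: real) = of_bool (i = j)"
    using relation_unique[of "\<lambda>l. of_bool (l = i)" "\<lambda>l. of_bool (l = j)" i] ij
    by (simp add: sum_select_scaleR sum_select_1 del: sum_of_bool_eq)
  then show "i = j" by (simp split: if_splits)
qed

lemma L_diff: "r \<in> L \<Longrightarrow> s \<in> L \<Longrightarrow> (\<lambda>i. r i - s i) \<in> L"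
  by (auto simp: integral_relations_iff scaleR_diff_left sum_subtractf intro: lattice_points_diff)

lemma L_add: "r \<in> L \<Longrightarrow> s \<in> L \<Longrightarrow> (\<lambda>i. r i + s i) \<in> L"
  by (auto simp: integral_relations_iff scaleR_add_left sum.distrib intro: lattice_points_add)

lemma L_int: "(\<And>i. i < N \<Longrightarrow> r i \<in> \<int>) \<Longrightarrow> r \<in> L"
  by (auto simp: integral_relations_iff lattice intro!: lattice_points_sum lattice_points_scale Ints_sum)

section \<open>The Ehrhart series of a lattice simplex\<close>

text \<open>
These are the coefficient vectors that express the lattice points of the \<open>n\<close>-th dilate by the vertices.
\<close>

definition dilate_coordinates :: "nat \<Rightarrow> (nat \<Rightarrow> real) set" where
  "dilate_coordinates n =
     {r \<in> L. (\<forall>i<N. 0 \<le> r i) \<and> (\<forall>i\<ge>N. r i = 0) \<and> (\<Sum>i<N. r i) = real n}"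

lemma bij_dilate_coordinates:
  assumes "n > 0"
  shows "bij_betw (\<lambda>r. \<Sum>i<N. r i *\<^sub>R v i) (dilate_coordinates n)
           (dilate n (convex hull (v ` {..<N})) \<inter> lattice_points)"
  unfolding bij_betw_def
proof
  show "inj_on (\<lambda>r. \<Sum>i<N. r i *\<^sub>R v i) (dilate_coordinates n)"
  proof (rule inj_onI)
    fix r s assume rs: "r \<in> dilate_coordinates n" "s \<in> dilate_coordinates n"
      "(\<Sum>i<N. r i *\<^sub>R v i) = (\<Sum>i<N. s i *\<^sub>R v i)"
    show "r = s"
    proof
      fix i show "r i = s i"
        using relation_unique[OF rs(3), of i] rs by (cases "i < N") (auto simp: dilate_coordinates_def)
    qed
  qed
  show "(\<lambda>r. \<Sum>i<N. r i *\<^sub>R v i) ` dilate_coordinates n =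
      dilate n (convex hull (v ` {..<N})) \<inter> lattice_points"
  proof (intro subset_antisym subsetI)
    fix y assume "y \<in> (\<lambda>r. \<Sum>i<N. r i *\<^sub>R v i) ` dilate_coordinates n"
    then obtain r where r: "r \<in> dilate_coordinates n" "y = (\<Sum>i<N. r i *\<^sub>R v i)" by auto
    have "(\<Sum>i<N. (r i / n) *\<^sub>R v i) \<in> convex hull (v ` {..<N})"
      unfolding convex_hull_family[OF inj_v finite_lessThan] using r(1) assms
      by (intro CollectI exI[of _ "\<lambda>i. r i / n"])
        (auto simp: dilate_coordinates_def sum_divide_distrib[symmetric])
    moreover have "y = real n *\<^sub>R (\<Sum>i<N. (r i / n) *\<^sub>R v i)"
      using assms by (simp add: r(2) scaleR_right.sum)
    ultimately have "y \<in> dilate n (convex hull (v ` {..<N}))" by (auto simp: dilate_def)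
    then show "y \<in> dilate n (convex hull (v ` {..<N})) \<inter> lattice_points"
      using r by (auto simp: dilate_coordinates_def integral_relations_iff)
  next
    fix y assume y: "y \<in> dilate n (convex hull (v ` {..<N})) \<inter> lattice_points"
    then obtain u where u: "\<forall>i\<in>{..<N}. 0 \<le> u i" "sum u {..<N} = 1"
      "y = real n *\<^sub>R (\<Sum>i<N. u i *\<^sub>R v i)"
      unfolding dilate_def convex_hull_family[OF inj_v finite_lessThan] by auto
    define r where "r = (\<lambda>i. if i < N then real n * u i else 0)"
    have yr: "y = (\<Sum>i<N. r i *\<^sub>R v i)" using u(3) by (simp add: r_def scaleR_right.sum)
    have "(\<Sum>i<N. r i) = real n" using u(2) by (simp add: r_def sum_distrib_left[symmetric])
    then have "r \<in> dilate_coordinates n"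
      using u(1) y yr by (auto simp: dilate_coordinates_def integral_relations_iff r_def)
    then show "y \<in> (\<lambda>r. \<Sum>i<N. r i *\<^sub>R v i) ` dilate_coordinates n" using yr by blast
  qed
qed

lemma cell_sum_nat:
  assumes "r \<in> cell" obtains j :: nat where "(\<Sum>i<N. r i) = real j" "j < N"
proof -
  have "(\<Sum>i<N. r i) \<in> \<int>" "(\<Sum>i<N. r i) \<ge> 0"
    using assms by (auto simp: cell_def integral_relations_iff intro: sum_nonneg)
  then obtain j where j: "(\<Sum>i<N. r i) = real j" by (metis Ints_cases nonneg_int_cases of_int_0_le_iff of_int_of_nat_eq)
  moreover have "(\<Sum>i<N. r i) < (\<Sum>i<N. 1)"
  proof (rule sum_strict_mono)
    show "{..<N} \<noteq> {}" by (auto simp: N)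
  qed (use assms in \<open>auto simp: cell_def\<close>)
  ultimately show ?thesis using that by simp
qed

lemma finite_cell: "finite cell"
proof -
  let ?f = "\<lambda>r. (\<Sum>i<N. r i *\<^sub>R v i, \<Sum>i<N. r i)"
  have "inj_on ?f cell"
  proof (rule inj_onI)
    fix r s assume rs: "r \<in> cell" "s \<in> cell" "?f r = ?f s"
    show "r = s"
    proof
      fix i show "r i = s i"
        using relation_unique[of r s i] rs by (cases "i < N") (auto simp: cell_def)
    qed
  qed
  moreover have "?f ` cell \<subseteq> (cball 0 (\<Sum>i<N. norm (v i)) \<inter> lattice_points) \<times> real ` {..<N}"
  proof
    fix y assume "y \<in> ?f ` cell"
    then obtain r where r: "r \<in> cell" "y = ?f r" by auto
    have "norm (\<Sum>i<N. r i *\<^sub>R v i) \<le> (\<Sum>i<N. norm (v i))"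
      using r(1) by (intro sum_norm_le) (auto simp: cell_def mult_left_le_one_le)
    moreover have "(\<Sum>i<N. r i) \<in> real ` {..<N}" using cell_sum_nat[OF r(1)] by blast
    ultimately show "y \<in> (cball 0 (\<Sum>i<N. norm (v i)) \<inter> lattice_points) \<times> real ` {..<N}"
      using r by (auto simp: cell_def integral_relations_iff)
  qed
  moreover have "finite ((cball 0 (\<Sum>i<N. norm (v i)) \<inter> lattice_points) \<times> real ` {..<N})"
    by (intro finite_cartesian_product finite_bounded_lattice_points) auto
  ultimately show ?thesis using finite_subset finite_imageD by blast
qed

definition cell_degree :: "(nat \<Rightarrow> real) \<Rightarrow> nat" where
  "cell_degree r = nat \<lfloor>\<Sum>i<N. r i\<rfloor>"

lemma cell_degree: "r \<in> cell \<Longrightarrow> (\<Sum>i<N. r i) = real (cell_degree r)"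
  by (erule cell_sum_nat) (simp add: cell_degree_def)

text \<open>
A nonnegative vector splits into its fractional parts, which lie in the cell, and its integral
parts, which form a list of natural numbers with prescribed sum. This is where the Ehrhart series
becomes a sum over the cell: the lists are counted by binomial coefficients.
\<close>

lemma bij_cell_dilate_coordinates:
  "bij_betw (\<lambda>(s, l). \<lambda>i. if i < N then s i + real (l ! i) else 0)
     (SIGMA s:cell. {l. length l = N \<and> sum_list l + cell_degree s = n})
     (dilate_coordinates n)"
proof (rule bij_betw_byWitness[where f' = "\<lambda>r. (\<lambda>i. if i < N then frac (r i) else 0, map (\<lambda>i. nat \<lfloor>r i\<rfloor>) [0..<N])"])
  let ?A = "SIGMA s:cell. {l. length l = N \<and> sum_list l + cell_degree s = n}"
  let ?f = "\<lambda>(s, l). \<lambda>i. if i < N then s i + real (l ! i) else (0::real)"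
  let ?g = "\<lambda>r :: nat \<Rightarrow> real. (\<lambda>i. if i < N then frac (r i) else 0, map (\<lambda>i. nat \<lfloor>r i\<rfloor>) [0..<N])"
  have sl: "real (sum_list l) = (\<Sum>i<N. real (l ! i))" if "length l = N" for l :: "nat list"
    using that by (simp add: sum_list_sum_nth atLeast0LessThan)
  show "\<forall>a\<in>?A. ?g (?f a) = a"
  proof
    fix a assume "a \<in> ?A"
    then obtain s l where a: "a = (s, l)" "s \<in> cell" "length l = N" by auto
    have b: "0 \<le> s i" "s i < 1" if "i < N" for i using a(2) that by (auto simp: cell_def)
    have fl: "\<lfloor>s i\<rfloor> = 0" if "i < N" for i using b[OF that] by (simp add: floor_eq_iff)
    have 1: "(\<lambda>i. if i < N then frac (?f a i) else 0) = s"
      using a b fl by (auto simp: fun_eq_iff cell_def frac_def)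
    have 2: "map (\<lambda>i. nat \<lfloor>?f a i\<rfloor>) [0..<N] = l"
      using a(3) fl by (intro nth_equalityI) (auto simp: a(1))
    show "?g (?f a) = a" using 1 2 a(1) by simp
  qed
  show "\<forall>r\<in>dilate_coordinates n. ?f (?g r) = r"
    by (auto simp: dilate_coordinates_def fun_eq_iff frac_def)
  show "?f ` ?A \<subseteq> dilate_coordinates n"
  proof
    fix r assume "r \<in> ?f ` ?A"
    then obtain s l where sl': "s \<in> cell" "length l = N" "sum_list l + cell_degree s = n" and r: "r = ?f (s, l)"
      by auto
    have "(\<Sum>i<N. r i) = (\<Sum>i<N. s i) + real (sum_list l)"
      unfolding r by (simp add: sl[OF sl'(2)] sum.distrib)
    then have "(\<Sum>i<N. r i) = real n" using cell_degree[OF sl'(1)] sl'(3) by simp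
    moreover have "r \<in> L"
    proof -
      have "(\<lambda>i. if i < N then real (l ! i) else 0) \<in> L" by (rule L_int) auto
      then have "(\<lambda>i. s i + (if i < N then real (l ! i) else 0)) \<in> L"
        using sl'(1) by (intro L_add) (auto simp: cell_def)
      moreover have "(\<lambda>i. s i + (if i < N then real (l ! i) else 0)) = r"
        unfolding r using sl'(1) by (auto simp: cell_def fun_eq_iff)
      ultimately show ?thesis by simp
    qed
    ultimately show "r \<in> dilate_coordinates n"
      using sl'(1) by (auto simp: dilate_coordinates_def cell_def r)
  qed
  show "?g ` dilate_coordinates n \<subseteq> ?A"
  proof
    fix a assume "a \<in> ?g ` dilate_coordinates n"
    then obtain r where r: "r \<in> dilate_coordinates n" and a: "a = ?g r" by auto
    define s where "s = (\<lambda>i. if i < N then frac (r i) else 0)"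
    define l where "l = map (\<lambda>i. nat \<lfloor>r i\<rfloor>) [0..<N]"
    have rL: "r \<in> L" and rpos: "\<And>i. i < N \<Longrightarrow> 0 \<le> r i" and rsum: "(\<Sum>i<N. r i) = real n"
      using r by (auto simp: dilate_coordinates_def)
    have "(\<lambda>i. if i < N then of_int \<lfloor>r i\<rfloor> else 0) \<in> L" by (rule L_int) auto
    then have "(\<lambda>i. r i - (if i < N then of_int \<lfloor>r i\<rfloor> else 0)) \<in> L" using rL by (rule L_diff[rotated])
    moreover have "(\<lambda>i. r i - (if i < N then of_int \<lfloor>r i\<rfloor> else 0)) = s"
      using r by (auto simp: s_def frac_def fun_eq_iff dilate_coordinates_def)
    ultimately have sb: "s \<in> cell" by (auto simp: cell_def s_def frac_lt_1)
    have ll: "length l = N" by (simp add: l_def)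
    have "real n = (\<Sum>i<N. s i + real (l ! i))"
      unfolding rsum[symmetric] by (intro sum.cong) (auto simp: s_def l_def frac_def rpos)
    then have "real n = real (cell_degree s) + real (sum_list l)"
      using cell_degree[OF sb] sl[OF ll] by (simp add: sum.distrib)
    then have "sum_list l + cell_degree s = n" by linarith
    then show "a \<in> ?A" using sb ll by (simp add: a s_def l_def)
  qed
qed

lemma finite_lists_sum: "finite {l :: nat list. length l = m \<and> sum_list l + c = n}"
proof -
  have "{l :: nat list. length l = m \<and> sum_list l + c = n} \<subseteq> {l. set l \<subseteq> {..n} \<and> length l = m}"
    using member_le_sum_list by fastforce
  then show ?thesis by (rule finite_subset) (simp add: finite_lists_length_eq)
qed

lemma card_lists_sum:
  "card {l :: nat list. length l = m \<and> sum_list l + c = n} =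
     (if c \<le> n then ((n - c) + m - 1) choose (n - c) else 0)"
proof (cases "c \<le> n")
  case True
  then have "{l :: nat list. length l = m \<and> sum_list l + c = n} = {l. length l = m \<and> sum_list l = n - c}"
    by auto
  then show ?thesis using True by (simp add: card_length_sum_list)
next
  case False
  then have "{l :: nat list. length l = m \<and> sum_list l + c = n} = {}" by auto
  then show ?thesis using False by simp
qed

lemma card_dilate_coordinates:
  "card (dilate_coordinates n) =
     (\<Sum>s\<in>cell. if cell_degree s \<le> n then (n - cell_degree s + N - 1) choose (n - cell_degree s) else 0)"
proof -
  have "card (dilate_coordinates n) =
      card (SIGMA s:cell. {l. length l = N \<and> sum_list l + cell_degree s = n})"
    using bij_betw_same_card[OF bij_cell_dilate_coordinates] by simp
  also have "\<dots> = (\<Sum>s\<in>cell. card {l :: nat list. length l = N \<and> sum_list l + cell_degree s = n})"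
    by (intro card_SigmaI finite_cell ballI finite_lists_sum)
  finally show ?thesis by (simp add: card_lists_sum)
qed

text \<open>
By Pascal's rule, multiplication by \<open>1 - X\<close> lowers \<open>M\<close> by one.
\<close>

lemma one_minus_X_power_inverse:
  "(1 - fps_X) ^ (M + 1) * Abs_fps (\<lambda>n. int ((n + M) choose n)) = 1"
proof (induction M)
  case 0
  show ?case by (rule fps_ext) (auto simp: algebra_simps fps_X_mult_nth)
next
  case (Suc M)
  have "(1 - fps_X) * Abs_fps (\<lambda>n. int ((n + Suc M) choose n)) = Abs_fps (\<lambda>n. int ((n + M) choose n))"
  proof (rule fps_ext)
    fix n
    show "fps_nth ((1 - fps_X) * Abs_fps (\<lambda>n. int ((n + Suc M) choose n))) n =
        fps_nth (Abs_fps (\<lambda>n. int ((n + M) choose n))) n"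
      by (cases n) (simp_all add: algebra_simps fps_X_mult_nth)
  qed
  then have "(1 - fps_X) ^ (Suc M + 1) * Abs_fps (\<lambda>n. int ((n + Suc M) choose n))
      = (1 - fps_X) ^ (M + 1) * Abs_fps (\<lambda>n. int ((n + M) choose n))"
    by (simp add: mult_ac)
  also have "\<dots> = 1" by (rule Suc)
  finally show ?case .
qed

lemma dilate_coordinates_0: "dilate_coordinates 0 = {\<lambda>i. 0}"
proof -
  have "(\<lambda>i. 0) \<in> L" by (rule L_int) auto
  moreover have "r = (\<lambda>i. 0)" if r: "r \<in> dilate_coordinates 0" for r
  proof -
    have "\<forall>i\<in>{..<N}. r i = 0"
      using r sum_nonneg_eq_0_iff[of "{..<N}" r] by (auto simp: dilate_coordinates_def)
    moreover have "\<forall>i\<ge>N. r i = 0" using r by (simp add: dilate_coordinates_def)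
    ultimately show ?thesis by (metis lessThan_iff not_less ext)
  qed
  ultimately show ?thesis by (auto simp: dilate_coordinates_def)
qed

text \<open>
An element of the cell of degree \<open>j\<close> contributes \<open>X\<^sup>j\<close> times the series that counts the lists of \<open>N\<close>
natural numbers by their sum, and that series is the inverse of \<open>(1 - X)\<^sup>N\<close>.
\<close>

theorem ehrhart_series_simplex:
  "(1 - fps_X) ^ N * ehrhart_series (convex hull (v ` {..<N})) = (\<Sum>s\<in>cell. fps_X ^ cell_degree s)"
proof -
  let ?G = "Abs_fps (\<lambda>n. int ((n + CARD('n)) choose n))"
  have "ehrhart_series (convex hull (v ` {..<N})) = (\<Sum>s\<in>cell. fps_X ^ cell_degree s * ?G)"
  proof (rule fps_ext)
    fix n
    have "fps_nth (ehrhart_series (convex hull (v ` {..<N}))) n = int (card (dilate_coordinates n))"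
    proof (cases "n = 0")
      case True
      then show ?thesis by (simp add: ehrhart_series_def dilate_coordinates_0)
    next
      case False
      then show ?thesis
        using bij_betw_same_card[OF bij_dilate_coordinates[of n]] by (simp add: ehrhart_series_def)
    qed
    also have "\<dots> = (\<Sum>s\<in>cell. fps_nth (fps_X ^ cell_degree s * ?G) n)"
      unfolding card_dilate_coordinates using N
      by (auto simp: fps_X_power_mult_nth intro!: sum.cong)
    finally show "fps_nth (ehrhart_series (convex hull (v ` {..<N}))) n
        = fps_nth (\<Sum>s\<in>cell. fps_X ^ cell_degree s * ?G) n"
      by (simp add: fps_sum_nth)
  qed
  then have "(1 - fps_X) ^ N * ehrhart_series (convex hull (v ` {..<N}))
      = (\<Sum>s\<in>cell. fps_X ^ cell_degree s) * ((1 - fps_X) ^ (CARD('n) + 1) * ?G)"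
    by (simp add: sum_distrib_right[symmetric] N mult_ac)
  then show ?thesis by (simp only: one_minus_X_power_inverse mult_1_right)
qed

corollary coeff_delta_polynomial:
  assumes "has_delta_polynomial (convex hull (v ` {..<N})) q"
  shows "coeff q m = int (card {s \<in> cell. cell_degree s = m})"
proof -
  have "coeff q m = fps_nth (fps_of_poly q) m" by simp
  also have "fps_of_poly q = (\<Sum>s\<in>cell. fps_X ^ cell_degree s)"
    using assms ehrhart_series_simplex unfolding has_delta_polynomial_def N[symmetric] by simp
  also have "fps_nth (\<Sum>s\<in>cell. fps_X ^ cell_degree s) m = (\<Sum>s\<in>cell. of_bool (cell_degree s = m))"
    by (auto simp: fps_sum_nth intro!: sum.cong)
  also have "\<dots> = int (card (cell \<inter> {s. cell_degree s = m}))"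
    using finite_cell by simp
  also have "cell \<inter> {s. cell_degree s = m} = {s \<in> cell. cell_degree s = m}" by auto
  finally show ?thesis .
qed

end

section \<open>Lattice automorphisms and unimodular equivalence\<close>

text \<open>
Linear maps rather than integral matrices, because composition and preimages are immediate for them;
\<open>unimodularly_equivalentI\<close> produces the matrices.
\<close>

definition lattice_automorphism :: "(real ^ 'n::finite \<Rightarrow> real ^ 'n) \<Rightarrow> bool" where
  "lattice_automorphism f \<longleftrightarrow> linear f \<and> f ` lattice_points = lattice_points"

lemma axis_lattice: "axis i (1::real) \<in> lattice_points"
  by (simp add: lattice_points_def axis_def)

lemma lattice_automorphism_D:
  assumes "lattice_automorphism f"
  shows "linear f" "x \<in> lattice_points \<Longrightarrow> f x \<in> lattice_points"
    "y \<in> lattice_points \<Longrightarrow> \<exists>x\<in>lattice_points. f x = y"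
  using assms by (auto simp: lattice_automorphism_def) (metis imageE)

lemma lattice_automorphism_inj:
  assumes "lattice_automorphism (f :: real ^ 'n::finite \<Rightarrow> _)"
  shows "inj f"
proof -
  have lin: "linear f" using assms by (simp add: lattice_automorphism_def)
  have "subspace (range f)" using lin by (simp add: linear_subspace_image)
  moreover have "Basis \<subseteq> range f"
  proof
    fix b :: "real ^ 'n" assume "b \<in> Basis"
    then obtain i where "b = axis i 1" by (auto simp: Basis_vec_def)
    then show "b \<in> range f" using lattice_automorphism_D(3)[OF assms axis_lattice[of i]] by (metis rangeI)
  qed
  ultimately have "range f = UNIV" using span_minimal span_Basis by blast
  then show ?thesis using linear_surjective_imp_injective[OF lin] by simp
qed

lemma lattice_automorphism_comp:
  "lattice_automorphism f \<Longrightarrow> lattice_automorphism g \<Longrightarrow> lattice_automorphism (g \<circ> f)"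
  by (metis lattice_automorphism_def linear_compose image_comp)

text \<open>
The images of the unit vectors are the rows of an integral matrix \<open>U\<close>, and their preimages are the
rows of an integral matrix \<open>V\<close> with \<open>V U = 1\<close>; hence \<open>det U\<close> is a unit of \<open>\<int>\<close>.
\<close>

lemma unimodularly_equivalentI:
  fixes f :: "real ^ 'n::finite \<Rightarrow> real ^ 'n"
  assumes f: "lattice_automorphism f" and w: "w \<in> lattice_points"
  shows "unimodularly_equivalent P ((\<lambda>x. f x + w) ` P)"
proof -
  have lin: "linear f" using f by (simp add: lattice_automorphism_def)
  define U :: "int ^ 'n ^ 'n" where "U = (\<chi> i j. \<lfloor>f (axis i 1) $ j\<rfloor>)"
  have U: "real_of_int (U $ i $ j) = f (axis i 1) $ j" for i j
    using lattice_automorphism_D(2)[OF f axis_lattice[of i]]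
    by (auto simp: U_def lattice_points_def elim: Ints_cases)
  have fU: "x v* (\<chi> i j. real_of_int (U $ i $ j)) = f x" for x
  proof -
    have "f x = f (\<Sum>i\<in>UNIV. x $ i *\<^sub>R axis i 1)"
      by (simp add: basis_expansion flip: scalar_mult_eq_scaleR)
    also have "\<dots> = (\<Sum>i\<in>UNIV. x $ i *\<^sub>R f (axis i 1))"
      using lin by (simp add: linear_sum linear_scale)
    finally show ?thesis
      by (simp add: vec_eq_iff vector_matrix_mult_def U mult.commute)
  qed
  have "\<forall>j. \<exists>y\<in>lattice_points. f y = axis j 1"
    using lattice_automorphism_D(3)[OF f axis_lattice] by blast
  then obtain y where y: "\<And>j. y j \<in> lattice_points" "\<And>j. f (y j) = axis j 1" by metis
  define V :: "int ^ 'n ^ 'n" where "V = (\<chi> i j. \<lfloor>y i $ j\<rfloor>)"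
  have V: "real_of_int (V $ i $ j) = y i $ j" for i j
    using y(1)[of i] by (auto simp: V_def lattice_points_def elim: Ints_cases)
  have "(V ** U) $ i $ j = (mat 1 :: int ^ 'n ^ 'n) $ i $ j" for i j
  proof -
    have "real_of_int ((V ** U) $ i $ j) = (y i v* (\<chi> i j. real_of_int (U $ i $ j))) $ j"
      by (simp add: matrix_matrix_mult_def vector_matrix_mult_def V mult.commute)
    also have "\<dots> = real_of_int ((mat 1 :: int ^ 'n ^ 'n) $ i $ j)"
      unfolding fU y(2) by (simp add: axis_def mat_def eq_commute)
    finally show ?thesis by simp
  qed
  then have "V ** U = mat 1" by (simp add: vec_eq_iff)
  then have "det V * det U = 1" using det_mul[of V U] by simp
  then have "det U \<in> {1, -1}" by (auto simp: zmult_eq_1_iff)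
  then show ?thesis
    unfolding unimodularly_equivalent_def
    by (intro exI[of _ U] exI[of _ w]) (simp add: w fU)
qed

text \<open>
The map multiplies \<open>\<phi>\<close> by \<open>1 + \<phi> e\<close>, which is \<open>1\<close> or \<open>-1\<close>; so \<open>\<phi> x\<close>, and then \<open>x\<close>, can be recovered from the
image. The two cases are shears and reflections.
\<close>

lemma lattice_automorphism_transvection:
  fixes \<phi> :: "real ^ 'n::finite \<Rightarrow> real"
  assumes lin: "linear \<phi>" and int: "\<And>x. x \<in> lattice_points \<Longrightarrow> \<phi> x \<in> \<int>"
    and e: "e \<in> lattice_points" "\<phi> e = 0 \<or> \<phi> e = -2"
  shows "lattice_automorphism (\<lambda>x. x + \<phi> x *\<^sub>R e)"
  unfolding lattice_automorphism_def
proof (intro conjI subset_antisym subsetI)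
  show "linear (\<lambda>x. x + \<phi> x *\<^sub>R e)"
    using lin by (intro linearI) (auto simp: linear_add linear_scale algebra_simps)
  show "y \<in> lattice_points" if "y \<in> (\<lambda>x. x + \<phi> x *\<^sub>R e) ` lattice_points" for y
    using that int e by (auto intro: lattice_points_add lattice_points_scale)
  show "y \<in> (\<lambda>x. x + \<phi> x *\<^sub>R e) ` lattice_points" if y: "y \<in> lattice_points" for y
  proof -
    \<comment> \<open>the factor by which the map multiplies \<open>\<phi>\<close>; it is its own inverse\<close>
    define s where "s = 1 + \<phi> e"
    have s: "s * s = 1" "s \<in> \<int>" using e(2) by (auto simp: s_def)
    define x where "x = y - (s * \<phi> y) *\<^sub>R e"
    have "x \<in> lattice_points"
      unfolding x_def using y e(1) s(2) int[OF y] by (intro lattice_points_diff lattice_points_scale) auto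
    moreover have "\<phi> x = s * \<phi> y"
    proof -
      have "\<phi> x = \<phi> y - s * \<phi> y * \<phi> e" unfolding x_def using lin by (simp add: linear_diff linear_scale)
      also have "\<dots> = \<phi> y - s * \<phi> y * (s - 1)" by (simp add: s_def)
      also have "\<dots> = \<phi> y - (s * s) * \<phi> y + s * \<phi> y" by (simp add: algebra_simps)
      finally show ?thesis using s(1) by simp
    qed
    ultimately have "x + \<phi> x *\<^sub>R e = y" by (simp add: x_def)
    then show ?thesis using \<open>x \<in> lattice_points\<close> by force
  qed
qed

lemma lattice_automorphism_shear:
  fixes i j :: "'n::finite"
  assumes "i \<noteq> j" "s \<in> \<int>"
  shows "lattice_automorphism (\<lambda>x. x + (s * x $ j) *\<^sub>R axis i (1::real))"
proof (rule lattice_automorphism_transvection)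
  show "linear (\<lambda>x :: real ^ 'n. s * x $ j)"
    by (intro linearI) (auto simp: algebra_simps)
qed (use assms in \<open>auto simp: lattice_points_def axis_def\<close>)

lemma lattice_automorphism_id: "lattice_automorphism (\<lambda>x. x)"
  by (simp add: lattice_automorphism_def linear_id[unfolded id_def])

text \<open>
Euclid's algorithm, phrased as a minimum. Among the images of \<open>a\<close> under lattice automorphisms, one
with the least sum of absolute values has a single nonzero coordinate \<open>t\<close>, since a shear could
subtract the smaller of two nonzero coordinates from the larger. Then \<open>a\<close> is \<open>t\<close> times a lattice point
\<open>y\<close>, and \<open>t \<psi> y = 1\<close> makes \<open>t\<close> a unit.
\<close>

lemma primitive_vector_to_axis:
  fixes a :: "real ^ 'n::finite"
  assumes a: "a \<in> lattice_points" and lin: "linear \<psi>"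
    and int: "\<And>x. x \<in> lattice_points \<Longrightarrow> \<psi> x \<in> \<int>" and one: "\<psi> a = (1::real)"
  obtains f where "lattice_automorphism f" "f a = axis d 1"
proof -
  define M where "M = (\<lambda>f :: real ^ 'n \<Rightarrow> real ^ 'n. nat \<lfloor>\<Sum>i\<in>UNIV. \<bar>f a $ i\<bar>\<rfloor>)"
  obtain f where f: "lattice_automorphism f"
    and min: "\<And>g. lattice_automorphism g \<Longrightarrow> M f \<le> M g"
    using ex_has_least_nat[of lattice_automorphism "\<lambda>x. x" M] lattice_automorphism_id by blast
  have lat: "g a \<in> lattice_points" if "lattice_automorphism g" for g
    using lattice_automorphism_D(2)[OF that a] .
  have M: "real (M g) = (\<Sum>i\<in>UNIV. \<bar>g a $ i\<bar>)" if "lattice_automorphism g" for g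
  proof -
    have "(\<Sum>i\<in>UNIV. \<bar>g a $ i\<bar>) \<in> \<int>" using lat[OF that] by (auto simp: lattice_points_def)
    then show ?thesis by (auto simp: M_def sum_nonneg elim!: Ints_cases)
  qed
  define b where "b = f a"
  have bZ: "b $ i \<in> \<int>" for i using lat[OF f] by (simp add: b_def lattice_points_def)
  have key: False if ij: "i \<noteq> j" "b $ j \<noteq> 0" "\<bar>b $ j\<bar> \<le> \<bar>b $ i\<bar>" for i j
  proof -
    \<comment> \<open>this sign makes the shear subtract \<open>\<bar>b j\<bar>\<close> from \<open>\<bar>b i\<bar>\<close>\<close>
    define s where "s = - (sgn (b $ i) * sgn (b $ j))"
    have s: "s \<in> \<int>" by (auto simp: s_def sgn_if)
    define g where "g = (\<lambda>x. x + (s * x $ j) *\<^sub>R axis i (1::real)) \<circ> f"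
    have g: "lattice_automorphism g"
      unfolding g_def by (intro lattice_automorphism_comp f lattice_automorphism_shear ij s)
    have gi: "\<bar>g a $ i\<bar> < \<bar>b $ i\<bar>"
      using ij unfolding g_def by (auto simp: s_def sgn_if abs_if b_def[symmetric] split: if_splits)
    have gl: "g a $ l = b $ l" if "l \<noteq> i" for l
      using that by (simp add: g_def b_def[symmetric] axis_def)
    have "(\<Sum>l\<in>UNIV. \<bar>g a $ l\<bar>) < (\<Sum>l\<in>UNIV. \<bar>b $ l\<bar>)"
      using gi gl by (intro sum_strict_mono_ex1) (auto, metis less_eq_real_def)
    then have "real (M g) < real (M f)" using M[OF g] M[OF f] by (simp add: b_def)
    then show False using min[OF g] by simp
  qed
  have uniq: "i = j" if "b $ i \<noteq> 0" "b $ j \<noteq> 0" for i j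
    using key[of i j] key[of j i] that by (metis linear)
  have "a \<noteq> 0" using one linear_0[OF lin] by auto
  then have "b \<noteq> 0"
    using lattice_automorphism_inj[OF f] linear_0[OF lattice_automorphism_D(1)[OF f]]
    unfolding b_def by (metis injD)
  then obtain i where i: "b $ i \<noteq> 0" by (auto simp: vec_eq_iff)
  define t where "t = b $ i"
  have bt: "b = t *\<^sub>R axis i 1"
    using uniq i by (auto simp: vec_eq_iff t_def axis_def)
  obtain y where y: "y \<in> lattice_points" "f y = axis i 1"
    using lattice_automorphism_D(3)[OF f axis_lattice] by blast
  have "f a = f (t *\<^sub>R y)"
    using bt y(2) linear_scale[OF lattice_automorphism_D(1)[OF f]] by (simp add: b_def)
  then have "a = t *\<^sub>R y" using lattice_automorphism_inj[OF f] by (simp add: inj_eq)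
  then have "t * \<psi> y = 1" using one linear_scale[OF lin] by simp
  moreover obtain m n where "t = of_int m" "\<psi> y = of_int n"
    using bZ[of i] int[OF y(1)] by (auto simp: t_def elim!: Ints_cases)
  ultimately have "of_int (m * n) = (1::real)" "t = of_int m" by auto
  then have "m * n = 1" by (simp only: of_int_eq_1_iff)
  then have t: "t = 1 \<or> t = -1" using \<open>t = of_int m\<close> by (auto simp: zmult_eq_1_iff)
  show thesis
  proof (cases "i = d")
    case False
    \<comment> \<open>with \<open>t\<^sup>2 = 1\<close>: entry \<open>t\<close> at \<open>i\<close> first creates the entry 1 at \<open>d\<close>, which then clears the entry at \<open>i\<close>\<close>
    define g where "g = (\<lambda>x. x + (- t * x $ d) *\<^sub>R axis i (1::real)) \<circ>
        (\<lambda>x. x + (t * x $ i) *\<^sub>R axis d (1::real)) \<circ> f"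
    have "lattice_automorphism g"
      unfolding g_def using False t
      by (intro lattice_automorphism_comp lattice_automorphism_shear f) auto
    moreover have "g a = axis d 1"
      using False t by (auto simp: g_def b_def[symmetric] bt vec_eq_iff axis_def)
    ultimately show thesis by (rule that)
  next
    case True
    show thesis
    proof (cases "t = 1")
      case 1: True
      then show thesis using that[OF f] bt True by (simp add: b_def)
    next
      case False
      define g where "g = (\<lambda>x :: real ^ 'n. x + (-2 * x $ d) *\<^sub>R axis d (1::real)) \<circ> f"
      have "lattice_automorphism (\<lambda>x :: real ^ 'n. x + (-2 * x $ d) *\<^sub>R axis d (1::real))"
      proof (rule lattice_automorphism_transvection)
        show "linear (\<lambda>x :: real ^ 'n. -2 * x $ d)" by (intro linearI) (auto simp: algebra_simps)
      qed (auto simp: lattice_points_def axis_def)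
      then have "lattice_automorphism g" unfolding g_def by (intro lattice_automorphism_comp f)
      moreover have "g a = axis d 1"
        using False t True by (auto simp: g_def b_def[symmetric] bt vec_eq_iff axis_def)
      ultimately show thesis by (rule that)
    qed
  qed
qed

text \<open>
Once \<open>a\<close> is the unit vector \<open>d\<close>, the functional and the coordinate \<open>d\<close> agree there, so their difference
vanishes on it. The transvection along the unit vector by this difference fixes \<open>a\<close> and turns the
coordinate into the functional.
\<close>

lemma functional_to_coordinate:
  fixes a :: "real ^ 'n::finite"
  assumes a: "a \<in> lattice_points" and lin: "linear \<psi>"
    and int: "\<And>x. x \<in> lattice_points \<Longrightarrow> \<psi> x \<in> \<int>" and one: "\<psi> a = (1::real)"
  obtains f where "lattice_automorphism f" "f a = axis d 1" "\<And>x. f x $ d = \<psi> x"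
proof -
  obtain f where f: "lattice_automorphism f" "f a = axis d 1"
    using primitive_vector_to_axis[OF assms] .
  note linf = lattice_automorphism_D(1)[OF f(1)]
  have bij: "bij f"
    using lattice_automorphism_inj[OF f(1)] linear_injective_imp_surjective[OF linf] by (simp add: bij_def)
  define \<psi>' where "\<psi>' = \<psi> \<circ> inv_into UNIV f"
  have \<psi>'f: "\<psi>' (f x) = \<psi> x" for x using bij by (simp add: \<psi>'_def bij_is_inj)
  have "linear (inv_into UNIV f)" using linf bij by (simp add: bij_is_inj bij_is_surj inj_linear_imp_inv_linear)
  then have lin': "linear \<psi>'" unfolding \<psi>'_def using lin by (rule linear_compose)
  define \<phi> where "\<phi> = (\<lambda>x. \<psi>' x - x $ d)"
  define g where "g = (\<lambda>x. x + \<phi> x *\<^sub>R axis d 1)"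
  have "lattice_automorphism g"
    unfolding g_def
  proof (rule lattice_automorphism_transvection)
    show "linear \<phi>" using lin' by (intro linearI) (auto simp: \<phi>_def linear_add linear_scale algebra_simps)
    show "\<phi> x \<in> \<int>" if x: "x \<in> lattice_points" for x
    proof -
      obtain y where "y \<in> lattice_points" "f y = x" using lattice_automorphism_D(3)[OF f(1) x] by blast
      then show ?thesis using x int[of y] \<psi>'f[of y] by (auto simp: \<phi>_def lattice_points_def)
    qed
    show "axis d 1 \<in> lattice_points" by (rule axis_lattice)
    show "\<phi> (axis d 1) = 0 \<or> \<phi> (axis d 1) = - 2" using \<psi>'f[of a] f(2) one by (simp add: \<phi>_def axis_def)
  qed
  then have "lattice_automorphism (g \<circ> f)" using f(1) lattice_automorphism_comp by blast
  moreover have "\<phi> (axis d 1) = 0" using \<psi>'f[of a] f(2) one by (simp add: \<phi>_def axis_def)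
  then have "(g \<circ> f) a = axis d 1" using f(2) by (simp add: g_def)
  moreover have "(g \<circ> f) x $ d = \<psi> x" for x
    using \<psi>'f[of x] by (simp add: g_def \<phi>_def axis_def)
  ultimately show thesis by (rule that)
qed

context simplex_vertices
begin

lemma inj_lift: "inj_on (\<lambda>i. (v i, 1 :: real)) {..<N}"
  using inj_v by (auto simp: inj_on_def)

lemma independent_lift: "independent ((\<lambda>i. (v i, 1 :: real)) ` {..<N})"
proof
  assume "dependent ((\<lambda>i. (v i, 1 :: real)) ` {..<N})"
  then obtain u where u: "\<exists>x\<in>(\<lambda>i. (v i, 1 :: real)) ` {..<N}. u x \<noteq> 0"
    "(\<Sum>x\<in>(\<lambda>i. (v i, 1 :: real)) ` {..<N}. u x *\<^sub>R x) = 0"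
    by (auto simp: dependent_finite)
  from u(2) have "(\<Sum>i<N. u (v i, 1) *\<^sub>R (v i, 1 :: real)) = 0"
    by (subst (asm) sum.reindex[OF inj_lift]) (simp add: comp_def)
  then have "u (v i, 1) = 0" if "i < N" for i using indep[of "\<lambda>i. u (v i, 1)" i] that by simp
  then show False using u(1) by auto
qed

text \<open>
The \<open>N\<close> lifted vertices are independent in a space of dimension \<open>d + 1 = N\<close>, hence span it.
\<close>

lemma barycentric:
  obtains r where "(\<Sum>i<N. r i) = 1" "x = (\<Sum>i<N. r i *\<^sub>R v i)"
proof -
  let ?B = "(\<lambda>i. (v i, 1 :: real)) ` {..<N}"
  have "card ?B = N" by (simp add: card_image[OF inj_lift])
  then have "UNIV \<subseteq> span ?B"
    using card_ge_dim_independent[OF _ independent_lift, of UNIV] N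
    by (simp add: dim_UNIV)
  then have "(x, 1) \<in> span ?B" by auto
  then obtain u where "(x, 1) = (\<Sum>y\<in>?B. u y *\<^sub>R y)" by (auto simp: span_finite)
  then have "(x, 1) = (\<Sum>i<N. u (v i, 1) *\<^sub>R (v i, 1 :: real))"
    by (subst (asm) sum.reindex[OF inj_lift]) (simp add: comp_def)
  then show ?thesis using that[of "\<lambda>i. u (v i, 1)"] by (simp add: sum_prod scaleR_prod_def)
qed

lemma affine_independent: "\<not> affine_dependent (v ` {..<N})"
proof
  assume "affine_dependent (v ` {..<N})"
  then obtain u where u: "sum u (v ` {..<N}) = 0" "\<exists>x\<in>v ` {..<N}. u x \<noteq> 0"
    "(\<Sum>x\<in>v ` {..<N}. u x *\<^sub>R x) = 0"
    by (auto simp: affine_dependent_explicit_finite)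
  have "(\<Sum>i<N. u (v i)) = 0" "(\<Sum>i<N. u (v i) *\<^sub>R v i) = 0"
    using u(1,3) by (simp_all add: sum.reindex[OF inj_v])
  then have "(\<Sum>i<N. u (v i) *\<^sub>R (v i, 1 :: real)) = 0"
    by (simp add: sum_prod scaleR_prod_def zero_prod_def)
  then have "u (v i) = 0" if "i < N" for i using indep[of "\<lambda>i. u (v i)" i] that by simp
  then show False using u(2) by auto
qed

text \<open>
Affine maps with prescribed values at the vertices, in the form of linear maps on the lifted space.
\<close>

lemma linear_lift_extend:
  obtains g :: "(real ^ 'n) \<times> real \<Rightarrow> 'a::real_vector" where "linear g"
    "\<And>r. g (\<Sum>i<N. r i *\<^sub>R v i, \<Sum>i<N. r i) = (\<Sum>i<N. r i *\<^sub>R w i)"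
proof -
  obtain g where g: "linear g"
    "\<And>x. x \<in> (\<lambda>i. (v i, 1 :: real)) ` {..<N} \<Longrightarrow> g x = (w \<circ> inv_into {..<N} (\<lambda>i. (v i, 1 :: real))) x"
    using linear_independent_extend[OF independent_lift,
        of "w \<circ> inv_into {..<N} (\<lambda>i. (v i, 1 :: real))"] by auto
  have gv: "g (v i, 1) = w i" if "i < N" for i
    using g(2)[of "(v i, 1)"] that inv_into_f_f[OF inj_lift, of i] by simp
  have "g (\<Sum>i<N. r i *\<^sub>R v i, \<Sum>i<N. r i) = (\<Sum>i<N. r i *\<^sub>R w i)" for r
  proof -
    have "(\<Sum>i<N. r i *\<^sub>R v i, \<Sum>i<N. r i) = (\<Sum>i<N. r i *\<^sub>R (v i, 1 :: real))"
      by (simp add: sum_prod scaleR_prod_def)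
    then have "g (\<Sum>i<N. r i *\<^sub>R v i, \<Sum>i<N. r i) = (\<Sum>i<N. r i *\<^sub>R g (v i, 1))"
      by (simp only: linear_sum[OF g(1)] linear_scale[OF g(1)])
    then show ?thesis using gv by simp
  qed
  with g(1) show ?thesis by (rule that)
qed

end

lemma convex_hull_affine_image:
  assumes "linear f"
  shows "convex hull ((\<lambda>x. f x + w) ` S) = (\<lambda>x. f x + w) ` (convex hull S)"
proof -
  have *: "(\<lambda>x. f x + w) ` T = (\<lambda>x. w + x) ` f ` T" for T by (auto simp: image_image add.commute)
  show ?thesis unfolding *
    by (simp only: convex_hull_translation convex_hull_linear_image[OF assms])
qed

text \<open>
A point is a lattice point iff its barycentric coordinates are an integral relation. Since the
relations of both simplices agree, the affine map that takes \<open>v i\<close> to \<open>w i\<close> maps the lattice onto itself.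
\<close>

lemma unimodularly_equivalent_if_same_relations:
  assumes v: "simplex_vertices N v" and w: "simplex_vertices N w"
    and eq: "integral_relations N v = integral_relations N w"
  shows "unimodularly_equivalent (convex hull (v ` {..<N})) (convex hull (w ` {..<N}))"
proof -
  interpret v: simplex_vertices N v by (rule v)
  interpret w: simplex_vertices N w by (rule w)
  obtain g :: "(real ^ 'a) \<times> real \<Rightarrow> real ^ 'a" where lin: "linear g"
    and g: "\<And>r. g (\<Sum>i<N. r i *\<^sub>R v i, \<Sum>i<N. r i) = (\<Sum>i<N. r i *\<^sub>R w i)"
    using v.linear_lift_extend[of w] by blast
  define F where "F = (\<lambda>x. g (x, 1))"
  define f where "f = (\<lambda>x. g (x, 0))"
  have F: "F (\<Sum>i<N. r i *\<^sub>R v i) = (\<Sum>i<N. r i *\<^sub>R w i)" if "(\<Sum>i<N. r i) = 1" for r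
    using g[of r] that by (simp add: F_def)
  have Ff: "F x = f x + F 0" for x
    using linear_add[OF lin, of "(x, 0)" "(0, 1)"] by (simp add: F_def f_def)
  have linf: "linear f"
    unfolding f_def using linear_compose[of "\<lambda>x. (x, 0::real)" g] lin
    by (simp add: comp_def linear_iff)
  have F_lattice: "F x \<in> lattice_points" if "x \<in> lattice_points" for x
  proof -
    obtain r where r: "(\<Sum>i<N. r i) = 1" "x = (\<Sum>i<N. r i *\<^sub>R v i)" by (rule v.barycentric)
    then have "r \<in> integral_relations N v" using that by (simp add: integral_relations_iff)
    then show ?thesis using F r eq by (simp add: integral_relations_iff)
  qed
  have F_surj: "\<exists>x\<in>lattice_points. F x = y" if "y \<in> lattice_points" for y
  proof -
    obtain r where r: "(\<Sum>i<N. r i) = 1" "y = (\<Sum>i<N. r i *\<^sub>R w i)" by (rule w.barycentric)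
    then have "r \<in> integral_relations N w" using that by (simp add: integral_relations_iff)
    then have "(\<Sum>i<N. r i *\<^sub>R v i) \<in> lattice_points" using eq by (auto simp: integral_relations_iff)
    then show ?thesis using F[OF r(1)] r(2) by blast
  qed
  have F0: "F 0 \<in> lattice_points" using F_lattice lattice_points_0 by blast
  have "lattice_automorphism f"
    unfolding lattice_automorphism_def
  proof (intro conjI linf subset_antisym subsetI)
    fix y assume "y \<in> f ` lattice_points"
    then obtain x where "x \<in> lattice_points" "y = f x" by auto
    then have "x \<in> lattice_points" "y = F x - F 0" using Ff[of x] by auto
    then show "y \<in> lattice_points" using F_lattice F0 lattice_points_diff by blast
  next
    fix y :: "real ^ 'a" assume "y \<in> lattice_points"
    then obtain x where "x \<in> lattice_points" "F x = y + F 0"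
      using F_surj[of "y + F 0"] F0 lattice_points_add by blast
    moreover from this have "y = f x" using Ff[of x] by (metis add_right_cancel)
    ultimately show "y \<in> f ` lattice_points" by blast
  qed
  from unimodularly_equivalentI[OF this F0, of "convex hull (v ` {..<N})"]
  have "unimodularly_equivalent (convex hull (v ` {..<N})) ((\<lambda>x. f x + F 0) ` (convex hull (v ` {..<N})))" .
  also have "(\<lambda>x. f x + F 0) ` (convex hull (v ` {..<N})) = convex hull ((\<lambda>x. f x + F 0) ` v ` {..<N})"
    by (rule convex_hull_affine_image[OF linf, symmetric])
  also have "(\<lambda>x. f x + F 0) ` v ` {..<N} = w ` {..<N}"
  proof -
    have "f (v i) + F 0 = w i" if "i < N" for i
    proof -
      have "F (v i) = w i"
        using F[OF sum_select_1[OF that]] by (simp only: sum_select_scaleR[OF that])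
      then show ?thesis using Ff[of "v i"] by simp
    qed
    then show ?thesis by (auto simp: image_image)
  qed
  finally show ?thesis .
qed

text \<open>
An affine dependence remains one after scaling by any real number, so it would give integral
relations with unbounded denominators. For explicit vertices whose relations are known, this replaces
the computation of a determinant.
\<close>

lemma simplex_vertices_if_discrete:
  assumes "N = CARD('n) + 1" and "\<And>i. i < N \<Longrightarrow> (w i :: real ^ 'n::finite) \<in> lattice_points"
    and m: "m \<noteq> 0" "\<And>r i. r \<in> integral_relations N w \<Longrightarrow> i < N \<Longrightarrow> real m * r i \<in> \<int>"
  shows "simplex_vertices N w"
proof
  fix r i assume r: "(\<Sum>i<N. r i *\<^sub>R (w i, 1 :: real)) = 0" "i < N"
  show "r i = 0"
  proof (rule ccontr)
    assume nz: "r i \<noteq> 0"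
    \<comment> \<open>chosen such that \<open>m\<close> times the scaled coefficient is one half\<close>
    define t where "t = 1 / (2 * real m * r i)"
    have "(\<Sum>i<N. (t * r i) *\<^sub>R (w i, 1 :: real)) = t *\<^sub>R (\<Sum>i<N. r i *\<^sub>R (w i, 1 :: real))"
      by (simp add: scaleR_right.sum)
    then have "(\<lambda>i. t * r i) \<in> integral_relations N w"
      using r(1) by (simp add: integral_relations_def lattice_points_0 zero_prod_def)
    from m(2)[OF this r(2)] have "1 / 2 \<in> (\<int> :: real set)"
      using nz m(1) by (simp add: t_def field_simps)
    then show False by (auto elim!: Ints_cases)
  qed
qed (use assms in auto)

lemma convex_hull_insert_vertex:
  assumes "i0 \<in> I"
  shows "convex hull (u ` I) = convex hull (insert (u i0) (convex hull (u ` (I - {i0}))))"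
proof -
  have "u ` I = insert (u i0) (u ` (I - {i0}))" using assms by auto
  then show ?thesis by (simp only: hull_insert[symmetric])
qed

lemma simplex_vertices_affine_image:
  assumes v: "simplex_vertices N v" and f: "lattice_automorphism f" and w: "w \<in> lattice_points"
  shows "simplex_vertices N (\<lambda>i. f (v i) + w)"
proof -
  interpret simplex_vertices N v by (rule v)
  note lin = lattice_automorphism_D(1)[OF f]
  show ?thesis
  proof
    fix i assume "i < N"
    then show "f (v i) + w \<in> lattice_points"
      using lattice_automorphism_D(2)[OF f lattice] w lattice_points_add by blast
  next
    fix r i assume r: "(\<Sum>i<N. r i *\<^sub>R (f (v i) + w, 1 :: real)) = 0" "i < N"
    have 1: "(\<Sum>i<N. r i) = 0" and 2: "(\<Sum>i<N. r i *\<^sub>R (f (v i) + w)) = 0"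
      using r(1) by (simp_all add: sum_prod scaleR_prod_def zero_prod_def)
    have "f (\<Sum>i<N. r i *\<^sub>R v i) = (\<Sum>i<N. r i *\<^sub>R f (v i))"
      by (simp only: linear_sum[OF lin] linear_scale[OF lin])
    also have "\<dots> = (\<Sum>i<N. r i *\<^sub>R (f (v i) + w)) - (\<Sum>i<N. r i) *\<^sub>R w"
      by (simp add: scaleR_add_right sum.distrib scaleR_left.sum)
    finally have "f (\<Sum>i<N. r i *\<^sub>R v i) = f 0" using 1 2 linear_0[OF lin] by simp
    then have "(\<Sum>i<N. r i *\<^sub>R v i) = 0" using lattice_automorphism_inj[OF f] by (simp add: inj_eq)
    then have "(\<Sum>i<N. r i *\<^sub>R (v i, 1 :: real)) = 0"
      using 1 by (simp add: sum_prod scaleR_prod_def zero_prod_def)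
    then show "r i = 0" using r(2) by (rule indep)
  qed (rule N)
qed

text \<open>
The barycentric coordinate of \<open>v i0\<close> takes integral values on the lattice, and its linear part takes the
value 1 on the difference of \<open>v i0\<close> and another vertex \<open>v j0\<close>. A lattice automorphism makes this linear
part the last coordinate and the difference the last unit vector. After translating \<open>v j0\<close> to the
origin, all vertices except \<open>v i0\<close> lie in the hyperplane where the last coordinate vanishes.
\<close>

lemma lattice_pyramid_if_integral_coordinate:
  fixes v :: "nat \<Rightarrow> real ^ 'n::{finite, linorder}"
  assumes v: "simplex_vertices N v" and i0: "i0 < N"
    and int: "\<And>r. r \<in> integral_relations N v \<Longrightarrow> r i0 \<in> \<int>"
  shows "\<exists>m<CARD('n). \<exists>P. lattice_pyramid_over m P (convex hull (v ` {..<N}))"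
proof -
  interpret simplex_vertices N v by (rule v)
  have d_pos: "CARD('n) > 0" by simp
  define d :: 'n where "d = coord (CARD('n))"
  \<comment> \<open>any vertex other than \<open>v i0\<close> will do\<close>
  define j0 :: nat where "j0 = (if i0 = 0 then 1 else 0)"
  have j0: "j0 < N" "j0 \<noteq> i0" using N d_pos by (auto simp: j0_def)
  obtain g :: "(real, 'n) vec \<times> real \<Rightarrow> real" where lin: "linear g"
    and g: "\<And>r. g (\<Sum>i<N. r i *\<^sub>R v i, \<Sum>i<N. r i) = (\<Sum>i<N. r i *\<^sub>R of_bool (i = i0))"
    using linear_lift_extend[of "\<lambda>i. of_bool (i = i0)"] by blast
  have g': "g (\<Sum>i<N. r i *\<^sub>R v i, \<Sum>i<N. r i) = r i0" for r
    unfolding g using i0 by (simp add: of_bool_def if_distrib sum.delta' cong: if_cong)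
  have gv: "g (v i, 1) = of_bool (i = i0)" if "i < N" for i
  proof -
    have "g (v i, 1) = of_bool (i0 = i)"
      using g'[of "\<lambda>l. of_bool (l = i)"] by (simp only: sum_select_scaleR[OF that] sum_select_1[OF that])
    then show ?thesis by (simp add: eq_commute)
  qed
  define \<psi> where "\<psi> = (\<lambda>x. g (x, 0))"
  have lin\<psi>: "linear \<psi>"
    unfolding \<psi>_def using linear_compose[of "\<lambda>x. (x, 0::real)" g] lin
    by (simp add: comp_def linear_iff)
  have g\<psi>: "g (x, 1) = \<psi> x + g (0, 1)" for x
    using linear_add[OF lin, of "(x, 0)" "(0, 1)"] by (simp add: \<psi>_def)
  have g_int: "g (x, 1) \<in> \<int>" if "x \<in> lattice_points" for x
  proof -
    obtain r where r: "(\<Sum>i<N. r i) = 1" "x = (\<Sum>i<N. r i *\<^sub>R v i)" by (rule barycentric)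
    then have "r \<in> integral_relations N v" using that by (simp add: integral_relations_iff)
    then show ?thesis using int g'[of r] r by simp
  qed
  have \<psi>_int: "\<psi> x \<in> \<int>" if "x \<in> lattice_points" for x
    using Ints_diff[OF g_int[OF that] g_int[OF lattice_points_0]] g\<psi>[of x] by simp
  have "\<psi> (v i0 - v j0) = 1"
    using g\<psi>[of "v i0"] g\<psi>[of "v j0"] gv[OF i0] gv[OF j0(1)] j0(2) linear_diff[OF lin\<psi>] by simp
  then obtain f where f: "lattice_automorphism f" "f (v i0 - v j0) = axis d 1" "\<And>x. f x $ d = \<psi> x"
    using functional_to_coordinate[of "v i0 - v j0" \<psi> d] lattice[OF i0] lattice[OF j0(1)]
      lin\<psi> \<psi>_int lattice_points_diff by blast
  note linf = lattice_automorphism_D(1)[OF f(1)]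
  define w where "w = - f (v j0)"
  have w: "w \<in> lattice_points"
    using lattice_points_diff[OF lattice_points_0 lattice_automorphism_D(2)[OF f(1) lattice[OF j0(1)]]]
    by (simp add: w_def)
  define u where "u = (\<lambda>i. f (v i) + w)"
  interpret u: simplex_vertices N u
    unfolding u_def by (rule simplex_vertices_affine_image[OF v f(1) w])
  have ui0: "u i0 = axis d 1" using f(2) linear_diff[OF linf] by (simp add: u_def w_def)
  have ud: "u i $ d = 0" if "i < N" "i \<noteq> i0" for i
    using that gv[OF that(1)] gv[OF j0(1)] j0(2) g\<psi>[of "v i"] g\<psi>[of "v j0"] f(3)
    by (simp add: u_def w_def)
  define C where "C = u ` ({..<N} - {i0})"
  define P where "P = convex hull C"
  have indepC: "\<not> affine_dependent C"
    unfolding C_def by (rule affine_independent_subset[OF u.affine_independent]) auto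
  have "card C = CARD('n)"
    unfolding C_def using i0 N by (subst card_image) (auto intro: inj_on_subset[OF u.inj_v])
  then have "int (CARD('n) - 1) simplex P"
    unfolding simplex_def using indepC d_pos by (intro exI[of _ C]) (auto simp: P_def)
  moreover have "{x. x extreme_point_of P} \<subseteq> lattice_points"
    unfolding P_def extreme_point_of_convex_hull_affine_independent[OF indepC]
    using u.lattice by (auto simp: C_def)
  moreover have "polytope P" unfolding P_def C_def by (intro polytope_convex_hull) simp
  ultimately have "lattice_simplex (CARD('n) - 1) P"
    by (simp add: lattice_simplex_def lattice_polytope_def)
  moreover have "P \<subseteq> coord_subspace (CARD('n) - 1)"
    unfolding P_def
  proof (rule hull_minimal)
    show "C \<subseteq> coord_subspace (CARD('n) - 1)"
    proof
      fix x assume "x \<in> C"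
      then have "x $ coord (CARD('n)) = 0" using ud by (auto simp: C_def d_def)
      moreover have "i = CARD('n)" if "CARD('n) - 1 < i" "i \<le> CARD('n)" for i using that by linarith
      ultimately show "x \<in> coord_subspace (CARD('n) - 1)" unfolding coord_subspace_def by blast
    qed
    show "convex (coord_subspace (CARD('n) - 1))"
      by (intro subspace_imp_convex) (auto simp: subspace_def coord_subspace_def)
  qed
  moreover have "unimodularly_equivalent (convex hull (v ` {..<N}))
      (iterated_pyramid (CARD('n) - 1) (CARD('n) - (CARD('n) - 1)) P)"
  proof -
    have "CARD('n) - (CARD('n) - 1) = Suc 0" "Suc (CARD('n) - 1) = CARD('n)" using d_pos by auto
    then have "iterated_pyramid (CARD('n) - 1) (CARD('n) - (CARD('n) - 1)) P = convex hull (insert (u i0) P)"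
      by (simp add: pyramid_def std_basis_def ui0 d_def)
    also have "\<dots> = convex hull (u ` {..<N})"
      unfolding P_def C_def using i0 convex_hull_insert_vertex[of i0 "{..<N}" u] by simp
    also have "\<dots> = (\<lambda>x. f x + w) ` (convex hull (v ` {..<N}))"
      unfolding convex_hull_affine_image[OF linf, symmetric] by (simp add: u_def image_image)
    finally show ?thesis using unimodularly_equivalentI[OF f(1) w] by simp
  qed
  ultimately have "lattice_pyramid_over (CARD('n) - 1) P (convex hull (v ` {..<N}))"
    by (simp add: lattice_pyramid_over_def)
  then show ?thesis using d_pos by (intro exI[of _ "CARD('n) - 1"]) auto
qed

section \<open>The vertices of Delta(A) and Delta(B, C)\<close>

lemma coord_image: "coord ` {1..CARD('n)} = (UNIV :: 'n::{finite, linorder} set)"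
proof -
  let ?l = "sorted_list_of_set (UNIV :: 'n set)"
  have len: "length ?l = CARD('n)" by simp
  show ?thesis
  proof (intro subset_antisym subsetI)
    fix x :: 'n
    have "x \<in> set ?l" by simp
    then obtain i where "i < length ?l" "?l ! i = x" unfolding in_set_conv_nth by blast
    then have "i < CARD('n)" "?l ! i = x" using len by auto
    then have "x = coord (Suc i)" "Suc i \<in> {1..CARD('n)}" by (auto simp: coord_def)
    then show "x \<in> coord ` {1..CARD('n)}" by blast
  qed simp
qed

lemma inj_on_coord: "inj_on (coord :: nat \<Rightarrow> 'n::{finite, linorder}) {1..CARD('n)}"
  by (rule eq_card_imp_inj_on) (simp_all add: coord_image[simplified])

lemma lattice_points_coord:
  "(x :: real ^ 'n::{finite, linorder}) \<in> lattice_points \<longleftrightarrow> (\<forall>j\<in>{1..CARD('n)}. x $ coord j \<in> \<int>)"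
proof -
  have "(\<forall>i. x $ i \<in> \<int>) \<longleftrightarrow> (\<forall>i\<in>coord ` {1..CARD('n)}. x $ i \<in> \<int>)"
    unfolding coord_image by simp
  then show ?thesis by (simp add: lattice_points_def)
qed

lemma std_basis_coord:
  assumes "i \<in> {1..CARD('n)}" "j \<in> {1..CARD('n)}"
  shows "(std_basis i :: real ^ 'n::{finite, linorder}) $ coord j = of_bool (i = j)"
  using inj_on_eq_iff[OF inj_on_coord assms] by (auto simp: std_basis_def axis_def)

lemma last_vertex_coord:
  assumes "length A \<ge> 1" "length A \<le> CARD('n)" "j \<in> {1..CARD('n)}"
  shows "(last_vertex A :: real ^ 'n::{finite, linorder}) $ coord j =
    (if j < length A then of_int (A ! (length A - 1)) - of_int (A ! (j - 1))
     else if j = length A then of_int (A ! (length A - 1)) else 0)"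
proof -
  define l where "l = length A"
  define a where "a = (\<lambda>i. real_of_int (A ! (i - 1)))"
  have "(last_vertex A :: (real, 'n) vec) $ coord j
      = (\<Sum>i = 1..<l. (a l - a i) * (std_basis i :: (real, 'n) vec) $ coord j)
        + a l * (std_basis l :: (real, 'n) vec) $ coord j"
    by (simp add: last_vertex_def Let_def l_def a_def)
  also have "\<dots> = (\<Sum>i = 1..<l. (a l - a i) * of_bool (i = j)) + a l * of_bool (l = j)"
    using assms by (intro arg_cong2[where f = "(+)"] sum.cong) (auto simp: std_basis_coord l_def)
  also have "(\<Sum>i = 1..<l. (a l - a i) * of_bool (i = j)) = (if j < l then a l - a j else 0)"
    using assms(3) by (simp add: of_bool_def if_distrib sum.delta' cong: if_cong)
  finally show ?thesis by (simp add: l_def a_def)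
qed

text \<open>
The numbering puts the unit vector \<open>j\<close> at index \<open>j\<close>, so that the equation in coordinate \<open>j\<close> involves only
the coefficients with index \<open>j\<close> and \<open>d\<close>.
\<close>

definition Delta_A_vertex :: "int list \<Rightarrow> nat \<Rightarrow> real ^ 'n::{finite, linorder}" where
  "Delta_A_vertex A i =
     (if i = 0 then 0 else if i < length A then std_basis i else last_vertex A)"

definition Delta_BC_vertex :: "int list \<Rightarrow> int list \<Rightarrow> nat \<Rightarrow> real ^ 'n::{finite, linorder}" where
  "Delta_BC_vertex B C i =
     (if i = 0 then 0 else if i = length B then last_vertex B
      else if i < length C then std_basis i else last_vertex C)"

lemma Delta_A_eq:
  assumes "length A \<ge> 1"
  shows "Delta_A A = convex hull ((Delta_A_vertex A :: nat \<Rightarrow> real ^ 'n::{finite, linorder}) ` {..<length A + 1})"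
proof -
  let ?w = "Delta_A_vertex A :: nat \<Rightarrow> (real, 'n) vec"
  have "{..<length A + 1} = {0} \<union> {1..<length A} \<union> {length A}" using assms by auto
  moreover have "?w ` {1..<length A} = std_basis ` {1..<length A}"
    by (intro image_cong) (auto simp: Delta_A_vertex_def)
  moreover have "?w 0 = 0" "?w (length A) = last_vertex A"
    using assms by (auto simp: Delta_A_vertex_def)
  ultimately show ?thesis
    by (simp only: Delta_A_def image_Un image_insert image_empty)
qed

lemma Delta_BC_eq:
  assumes "length B \<ge> 1" "length B < length C"
  shows "Delta_BC B C =
    convex hull ((Delta_BC_vertex B C :: nat \<Rightarrow> real ^ 'n::{finite, linorder}) ` {..<length C + 1})"
proof -
  let ?w = "Delta_BC_vertex B C :: nat \<Rightarrow> (real, 'n) vec"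
  have "{..<length C + 1} = {0} \<union> ({1..<length C} - {length B}) \<union> {length B, length C}"
    using assms by auto
  moreover have "?w ` ({1..<length C} - {length B}) = std_basis ` ({1..<length C} - {length B})"
    by (intro image_cong) (auto simp: Delta_BC_vertex_def)
  moreover have "?w 0 = 0" "?w (length B) = last_vertex B"
    "?w (length C) = last_vertex C"
    using assms by (auto simp: Delta_BC_vertex_def)
  ultimately show ?thesis
    by (simp only: Delta_BC_def image_Un image_insert image_empty)
qed

lemma sum_of_bool_mult:
  fixes f :: "nat \<Rightarrow> real"
  assumes "j < N"
  shows "(\<Sum>i<N. f i * (of_bool (i = j) * c)) = f j * c"
proof -
  have "(\<Sum>i<N. f i * (of_bool (i = j) * c)) = (\<Sum>i<N. if i = j then f i * c else 0)"
    by (intro sum.cong) auto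
  then show ?thesis using assms by simp
qed

lemma lattice_points_combination:
  fixes w :: "nat \<Rightarrow> real ^ 'n::{finite, linorder}"
  shows "(\<Sum>i<N. r i *\<^sub>R w i) \<in> lattice_points \<longleftrightarrow>
    (\<forall>j\<in>{1..CARD('n)}. (\<Sum>i<N. r i * w i $ coord j) \<in> \<int>)"
  by (simp add: lattice_points_coord)

lemma last_vertex_lattice:
  assumes "length A \<ge> 1" "length A \<le> CARD('n)"
  shows "(last_vertex A :: real ^ 'n::{finite, linorder}) \<in> lattice_points"
  using assms by (simp add: lattice_points_coord last_vertex_coord)

lemma std_basis_lattice: "(std_basis i :: real ^ 'n::{finite, linorder}) \<in> lattice_points"
  by (simp add: lattice_points_def std_basis_def axis_def)

lemma Delta_A_vertex_lattice:
  assumes "length A = CARD('n)"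
  shows "(Delta_A_vertex A i :: real ^ 'n::{finite, linorder}) \<in> lattice_points"
proof -
  have "CARD('n) \<ge> 1" by (simp add: Suc_leI)
  then show ?thesis
    using assms by (simp add: Delta_A_vertex_def lattice_points_0 std_basis_lattice last_vertex_lattice)
qed

lemma Delta_BC_vertex_lattice:
  assumes "length B \<ge> 1" "length B < length C" "length C = CARD('n)"
  shows "(Delta_BC_vertex B C i :: real ^ 'n::{finite, linorder}) \<in> lattice_points"
  using assms by (simp add: Delta_BC_vertex_def lattice_points_0 std_basis_lattice last_vertex_lattice)

text \<open>
Coordinate \<open>d\<close> says that \<open>M\<close> times the last coefficient is an integer \<open>m\<close>, coordinate \<open>j\<close> then says that
coefficient \<open>j\<close> is \<open>m c j / M\<close> modulo \<open>\<int>\<close>, and integrality of the coefficient sum does the same for the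
origin. The entry \<open>c 0\<close> is determined modulo \<open>M\<close> by the divisibility condition.
\<close>

lemma integral_relations_Delta_A:
  fixes c :: "nat \<Rightarrow> int"
  assumes d: "length A = CARD('n::{finite, linorder})" and N: "N = length A + 1"
    and M: "M = A ! (length A - 1)" "M \<noteq> 0"
    and c: "c (length A) = 1" "\<And>j. 1 \<le> j \<Longrightarrow> j < length A \<Longrightarrow> c j = A ! (j - 1)" "M dvd (\<Sum>i<N. c i)"
  shows "r \<in> integral_relations N (Delta_A_vertex A :: nat \<Rightarrow> (real, 'n) vec) \<longleftrightarrow>
    (\<exists>m::int. \<forall>i<N. r i - of_int m * of_int (c i) / of_int M \<in> \<int>)"
proof -
  let ?w = "Delta_A_vertex A :: nat \<Rightarrow> (real, 'n) vec"
  define d where "d = length A"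
  have d1: "d \<ge> 1" "d = CARD('n)" "N = d + 1" using d N by (auto simp: d_def Suc_leI)
  have comp: "(\<Sum>i<N. r i * ?w i $ coord j) =
      (if j < d then r j + r d * (of_int M - of_int (c j)) else r d * of_int M)"
    if j: "j \<in> {1..CARD('n)}" for j
  proof -
    let ?x = "(last_vertex A :: (real, 'n) vec) $ coord j"
    have "(\<Sum>i<N. r i * ?w i $ coord j) = (\<Sum>i<N. r i * (of_bool (i = j) * of_bool (j < d)) + r i * (of_bool (i = d) * ?x))"
      using j d1 d by (intro sum.cong) (auto simp: Delta_A_vertex_def std_basis_coord d_def)
    also have "\<dots> = r j * of_bool (j < d) + r d * ?x"
    proof -
      have "j < N" "d < N" using j d1 by auto
      then show ?thesis by (simp only: sum.distrib sum_of_bool_mult)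
    qed
    also have "?x = (if j < d then of_int M - of_int (c j) else of_int M)"
      using j d1 d c(2)[of j] last_vertex_coord[of A j, where 'n = 'n] by (auto simp: M(1) d_def)
    finally show ?thesis by auto
  qed
  have iff: "r \<in> integral_relations N ?w \<longleftrightarrow>
      (\<forall>j\<in>{1..<d}. r j + r d * (of_int M - of_int (c j)) \<in> \<int>) \<and> r d * of_int M \<in> \<int> \<and> (\<Sum>i<N. r i) \<in> \<int>"
  proof -
    have "(\<forall>j\<in>{1..d}. (\<Sum>i<N. r i * ?w i $ coord j) \<in> \<int>) \<longleftrightarrow>
        (\<forall>j\<in>{1..d}. (if j < d then r j + r d * (of_int M - of_int (c j)) else r d * of_int M) \<in> \<int>)"
      using comp d1 by simp
    also have "\<dots> \<longleftrightarrow> (\<forall>j\<in>{1..<d}. r j + r d * (of_int M - of_int (c j)) \<in> \<int>) \<and> r d * of_int M \<in> \<int>"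
      using d1(1) by (auto simp: Ball_def le_less)
    finally show ?thesis
      unfolding integral_relations_iff lattice_points_combination d1(2)[symmetric] by blast
  qed
  obtain q where q: "(\<Sum>i<N. c i) = M * q" using c(3) by auto
  have q': "(\<Sum>i<N. real_of_int (c i)) = of_int M * of_int q"
    using arg_cong[OF q, of real_of_int] by simp
  show ?thesis
    unfolding iff
  proof (intro iffI conjI ballI; (elim conjE exE)?)
    assume rj: "\<forall>j\<in>{1..<d}. r j + r d * (of_int M - of_int (c j)) \<in> \<int>"
      and rd: "r d * of_int M \<in> \<int>" and rs: "(\<Sum>i<N. r i) \<in> \<int>"
    obtain m where m: "r d * of_int M = of_int m" using rd Ints_cases by blast
    then have rdm: "r d = of_int m / of_int M" using M(2) by (simp add: field_simps)
    have pos: "r j - r d * of_int (c j) \<in> \<int>" if "1 \<le> j" "j < N" for j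
    proof (cases "j = d")
      case True then show ?thesis using c(1) by (simp add: d_def)
    next
      case False
      then have "(r j + r d * (of_int M - of_int (c j))) - r d * of_int M \<in> \<int>"
        using rj rd that d1 by (intro Ints_diff) auto
      then show ?thesis by (simp add: algebra_simps)
    qed
    have split: "(\<Sum>i<N. f i) = f 0 + (\<Sum>i = 1..<N. f i)" for f :: "nat \<Rightarrow> real"
      using d1 by (simp add: lessThan_atLeast0 sum.atLeast_Suc_lessThan)
    have "(\<Sum>i<N. r i) - r d * (\<Sum>i<N. of_int (c i)) = (\<Sum>i<N. r i - r d * of_int (c i))"
      by (simp add: sum_subtractf sum_distrib_left)
    also have "\<dots> = (r 0 - r d * of_int (c 0)) + (\<Sum>i = 1..<N. r i - r d * of_int (c i))"
      by (rule split)
    finally have "r 0 - r d * of_int (c 0)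
        = (\<Sum>i<N. r i) - (r d * of_int M) * of_int q - (\<Sum>i = 1..<N. r i - r d * of_int (c i))"
      by (simp add: q')
    also have "\<dots> \<in> \<int>"
      using pos by (intro Ints_diff[OF Ints_diff[OF rs Ints_mult[OF rd]]] Ints_sum) auto
    finally have "r 0 - r d * of_int (c 0) \<in> \<int>" .
    then have "\<forall>i<N. r i - r d * of_int (c i) \<in> \<int>" using pos by (metis One_nat_def Suc_leI neq0_conv)
    then show "\<exists>m::int. \<forall>i<N. r i - of_int m * of_int (c i) / of_int M \<in> \<int>"
      unfolding rdm by (intro exI[of _ m]) simp
  next
    fix m :: int
    assume m: "\<forall>i<N. r i - of_int m * of_int (c i) / of_int M \<in> \<int>"
    have rd0: "r d - of_int m / of_int M \<in> \<int>" using m[rule_format, of d] d1 c(1) by (simp add: d_def)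
    then have "(r d - of_int m / of_int M) * of_int M + of_int m \<in> \<int>" by (intro Ints_add Ints_mult) auto
    then show rd: "r d * of_int M \<in> \<int>" using M(2) by (simp add: field_simps)
    have "(\<Sum>i<N. r i - of_int m * of_int (c i) / of_int M) \<in> \<int>" using m by (intro Ints_sum) auto
    then have "(\<Sum>i<N. r i) - of_int m * (\<Sum>i<N. of_int (c i)) / of_int M \<in> \<int>"
      by (simp add: sum_subtractf sum_distrib_left sum_divide_distrib)
    then have "(\<Sum>i<N. r i) - of_int m * of_int q \<in> \<int>" using M(2) by (simp add: q')
    then have "(\<Sum>i<N. r i) - of_int m * of_int q + of_int m * of_int q \<in> \<int>" by (intro Ints_add Ints_mult) auto
    then show "(\<Sum>i<N. r i) \<in> \<int>" by simp
    fix j assume j: "j \<in> {1..<d}"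
    have "(r j - of_int m * of_int (c j) / of_int M) - (r d - of_int m / of_int M) * of_int (c j) + r d * of_int M \<in> \<int>"
      using m j d1 by (intro Ints_add[OF Ints_diff[OF _ Ints_mult[OF rd0]] rd]) auto
    then show "r j + r d * (of_int M - of_int (c j)) \<in> \<int>" by (simp add: algebra_simps)
  qed
qed

text \<open>
The entries of \<open>C\<close> up to position \<open>p k\<close> equal its last entry, so the last vertex of \<open>C\<close> vanishes in these
coordinates and the equations decouple into a block for \<open>B\<close> and a block for \<open>C\<close>, each a cyclic group of
order \<open>p\<close>. The first block has \<open>p k\<close> indices and contributes an integer to the coefficient sum; hence the
origin belongs to the second block, which it completes to \<open>p\<^sup>2 k\<close> indices.
\<close>

lemma integral_relations_Delta_BC:
  assumes p: "p > 0" and k: "k > 0" and d: "CARD('n::{finite, linorder}) = p^2 * k + p * k - 1"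
    and N: "N = p^2 * k + p * k"
    and B: "B = replicate (p * k - 1) 1 @ [int p]"
    and C: "C = replicate (p * k) (int p) @ replicate (p^2 * k - 2) 1 @ [int p]" and p2: "p \<ge> 2"
  shows "r \<in> integral_relations N (Delta_BC_vertex B C :: nat \<Rightarrow> (real, 'n) vec) \<longleftrightarrow>
    (\<exists>a b::int. \<forall>i<N. r i - (if i \<in> {1..p * k} then of_int a / real p else of_int b / real p) \<in> \<int>)"
proof -
  let ?w = "Delta_BC_vertex B C :: nat \<Rightarrow> (real, 'n) vec"
  define s where "s = p * k"
  define d where "d = p^2 * k + p * k - 1"
  have pk: "p * k \<ge> 1" using p k by simp
  have ppk: "p^2 * k \<ge> 4"
  proof -
    have "2 * 2 * 1 \<le> p * p * k" using p2 k by (intro mult_le_mono) auto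
    then show ?thesis by (simp add: power2_eq_square)
  qed
  have sd: "1 \<le> s" "s < d" "N = d + 1" "CARD('n) = d"
    using pk ppk N \<open>CARD('n) = _\<close> by (auto simp: s_def d_def)
  have lens: "length B = s" "length C = d" using pk ppk by (auto simp: B C s_def d_def)
  have Bn: "B ! (j - 1) = (if j = s then int p else 1)" if "1 \<le> j" "j \<le> s" for j
    using that by (auto simp: B nth_append s_def)
  have Cn: "C ! (j - 1) = (if j \<le> s \<or> j = d then int p else 1)" if "1 \<le> j" "j \<le> d" for j
  proof -
    have "j \<le> s \<or> s < j \<and> j < d \<or> j = d" using that by arith
    then consider "j \<le> s" | "s < j" "j < d" | "j = d" by blast
    then show ?thesis
    proof cases
      case 1 then show ?thesis using that by (simp add: C nth_append s_def)
    next
      case 2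
      then have "j - 1 - p * k < p^2 * k - 2" using ppk by (simp add: d_def s_def)
      moreover have "\<not> j - 1 < p * k" using 2 by (simp add: s_def)
      ultimately show ?thesis using 2 by (simp add: C nth_append s_def)
    next
      case 3
      then show ?thesis using ppk by (simp add: C nth_append s_def d_def)
    qed
  qed
  have lastB: "(last_vertex B :: (real, 'n) vec) $ coord j = (if j < s then real p - 1 else if j = s then real p else 0)"
    if "j \<in> {1..d}" for j
    using that sd Bn[of j] Bn[of s] last_vertex_coord[of B j, where 'n = 'n] by (auto simp: lens)
  have lastC: "(last_vertex C :: (real, 'n) vec) $ coord j = (if j \<le> s then 0 else if j < d then real p - 1 else real p)"
    if "j \<in> {1..d}" for j
    using that sd Cn[of j] Cn[of d] last_vertex_coord[of C j, where 'n = 'n] by (auto simp: lens)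
  have comp: "(\<Sum>i<N. r i * ?w i $ coord j) =
      (if j < s then r j + r s * (real p - 1) else if j = s then r s * real p
       else if j < d then r j + r d * (real p - 1) else r d * real p)"
    if j: "j \<in> {1..d}" for j
  proof -
    let ?x = "(last_vertex B :: (real, 'n) vec) $ coord j"
    let ?y = "(last_vertex C :: (real, 'n) vec) $ coord j"
    have "(\<Sum>i<N. r i * ?w i $ coord j) = (\<Sum>i<N. r i * (of_bool (i = j) * of_bool (j < d \<and> j \<noteq> s))
        + (r i * (of_bool (i = s) * ?x) + r i * (of_bool (i = d) * ?y)))"
    proof (rule sum.cong[OF refl])
      fix i assume "i \<in> {..<N}"
      then consider "i = 0" | "i = s" | "i = d" "i \<noteq> s" | "i \<in> {1..d}" "i \<noteq> s" "i < d" using sd by force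
      then show "r i * ?w i $ coord j = r i * (of_bool (i = j) * of_bool (j < d \<and> j \<noteq> s))
        + (r i * (of_bool (i = s) * ?x) + r i * (of_bool (i = d) * ?y))"
        using sd j by cases (auto simp: Delta_BC_vertex_def lens std_basis_coord)
    qed
    also have "\<dots> = r j * of_bool (j < d \<and> j \<noteq> s) + (r s * ?x + r d * ?y)"
    proof -
      have "j < N" "s < N" "d < N" using j sd by auto
      then show ?thesis by (simp only: sum.distrib sum_of_bool_mult)
    qed
    finally show ?thesis unfolding lastB[OF j] lastC[OF j] using j sd by auto
  qed
  have iff: "r \<in> integral_relations N ?w \<longleftrightarrow>
      (\<forall>j\<in>{1..<s}. r j + r s * (real p - 1) \<in> \<int>) \<and> r s * real p \<in> \<int> \<and>
      (\<forall>j\<in>{s<..<d}. r j + r d * (real p - 1) \<in> \<int>) \<and> r d * real p \<in> \<int> \<and> (\<Sum>i<N. r i) \<in> \<int>"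
  proof -
    have set: "{1..d} = {1..<s} \<union> {s} \<union> {s<..<d} \<union> {d}" using sd by auto
    have "(\<forall>j\<in>{1..d}. (\<Sum>i<N. r i * ?w i $ coord j) \<in> \<int>) \<longleftrightarrow>
        (\<forall>j\<in>{1..d}. (if j < s then r j + r s * (real p - 1) else if j = s then r s * real p
       else if j < d then r j + r d * (real p - 1) else r d * real p) \<in> \<int>)"
      using comp by simp
    also have "\<dots> \<longleftrightarrow> (\<forall>j\<in>{1..<s}. r j + r s * (real p - 1) \<in> \<int>) \<and> r s * real p \<in> \<int> \<and>
      (\<forall>j\<in>{s<..<d}. r j + r d * (real p - 1) \<in> \<int>) \<and> r d * real p \<in> \<int>"
      unfolding set ball_Un using sd by simp
    finally show ?thesis
      unfolding integral_relations_iff lattice_points_combination sd(4) by blast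
  qed
  have sum_pattern: "(\<Sum>i<N. if i \<in> {1..p * k} then x else y) = real (p * k) * x + real (p^2 * k) * y" for x y
  proof -
    have "{..<N} \<inter> {i. i \<in> {1..p * k}} = {1..p * k}" "{..<N} \<inter> - {i. i \<in> {1..p * k}} = insert 0 {p * k<..<N}"
      using sd by (auto simp: s_def)
    then have "(\<Sum>i<N. if i \<in> {1..p * k} then x else y) = real (p * k) * x + real (card (insert 0 {p * k<..<N})) * y"
      by (simp add: sum.If_cases)
    moreover have "card (insert 0 {p * k<..<N}) = p^2 * k" using N ppk by simp
    ultimately show ?thesis by simp
  qed
  show ?thesis
    unfolding iff
  proof (intro iffI conjI ballI; (elim conjE exE)?)
    assume r1: "\<forall>j\<in>{1..<s}. r j + r s * (real p - 1) \<in> \<int>" and rs: "r s * real p \<in> \<int>"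
      and r2: "\<forall>j\<in>{s<..<d}. r j + r d * (real p - 1) \<in> \<int>" and rd: "r d * real p \<in> \<int>"
      and sum: "(\<Sum>i<N. r i) \<in> \<int>"
    define t where "t = (\<lambda>i. if i \<in> {1..p * k} then r s else r d)"
    have pos: "r j - t j \<in> \<int>" if "1 \<le> j" "j < N" for j
    proof -
      have "j < s \<or> j = s \<or> s < j \<and> j < d \<or> j = d" using that sd by arith
      then consider "j < s" | "j = s" | "s < j" "j < d" | "j = d" by blast
      then show ?thesis
      proof cases
        case 1
        then have "(r j + r s * (real p - 1)) - r s * real p \<in> \<int>" using r1 rs that by (intro Ints_diff) auto
        then show ?thesis using 1 that by (simp add: t_def s_def algebra_simps)
      next
        case 3
        then have "(r j + r d * (real p - 1)) - r d * real p \<in> \<int>" using r2 rd that by (intro Ints_diff) auto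
        then show ?thesis using 3 that by (simp add: t_def s_def algebra_simps)
      qed (use sd in \<open>auto simp: t_def s_def\<close>)
    qed
    have split: "(\<Sum>i<N. f i) = f 0 + (\<Sum>i = 1..<N. f i)" for f :: "nat \<Rightarrow> real"
      using sd by (simp add: lessThan_atLeast0 sum.atLeast_Suc_lessThan)
    have "(\<Sum>i<N. t i) = (r s * real p) * real k + (r d * real p) * real (p * k)"
      unfolding t_def sum_pattern by (simp add: power2_eq_square)
    then have tZ: "(\<Sum>i<N. t i) \<in> \<int>" using rs rd by (simp del: of_nat_mult)
    have "(\<Sum>i<N. r i) - (\<Sum>i<N. t i) = (r 0 - t 0) + (\<Sum>i = 1..<N. r i - t i)"
      by (simp add: sum_subtractf[symmetric] split)
    then have "r 0 - t 0 = (\<Sum>i<N. r i) - (\<Sum>i<N. t i) - (\<Sum>i = 1..<N. r i - t i)" by simp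
    also have "\<dots> \<in> \<int>"
      using pos by (intro Ints_diff[OF Ints_diff[OF sum tZ]] Ints_sum) auto
    finally have all: "r i - t i \<in> \<int>" if "i < N" for i using pos that by (cases "i = 0") auto
    obtain a b where ab: "r s * real p = of_int a" "r d * real p = of_int b" using rs rd Ints_cases by metis
    then have "r s = of_int a / real p" "r d = of_int b / real p" using p by (auto simp: field_simps)
    then have "t = (\<lambda>i. if i \<in> {1..p * k} then of_int a / real p else of_int b / real p)"
      by (auto simp: t_def fun_eq_iff)
    then show "\<exists>a b::int. \<forall>i<N. r i - (if i \<in> {1..p * k} then of_int a / real p else of_int b / real p) \<in> \<int>"
      using all by blast
  next
    fix a b :: int
    define t where "t = (\<lambda>i. if i \<in> {1..p * k} then of_int a / real p else of_int b / real p)"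
    assume "\<forall>i<N. r i - (if i \<in> {1..p * k} then of_int a / real p else of_int b / real p) \<in> \<int>"
    then have r: "r i - t i \<in> \<int>" if "i < N" for i using that by (simp add: t_def)
    have tp: "t i * real p \<in> \<int>" for i using p by (simp add: t_def)
    have rp: "r i * real p \<in> \<int>" if "i < N" for i
    proof -
      have "(r i - t i) * real p + t i * real p \<in> \<int>"
        by (intro Ints_add[OF Ints_mult[OF r[OF that]] tp] Ints_of_nat)
      then show ?thesis by (simp add: algebra_simps)
    qed
    then show "r s * real p \<in> \<int>" "r d * real p \<in> \<int>" using sd by auto
    have gen: "r j + r l * (real p - 1) \<in> \<int>" if "j < N" "l < N" "t j = t l" for j l
    proof -
      have "(r j - t j) - (r l - t l) + r l * real p \<in> \<int>"
        by (intro Ints_add[OF Ints_diff[OF r r] rp] that)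
      then show ?thesis using that(3) by (simp add: algebra_simps)
    qed
    show "r j + r s * (real p - 1) \<in> \<int>" if "j \<in> {1..<s}" for j
      using that sd by (intro gen) (auto simp: t_def s_def)
    show "r j + r d * (real p - 1) \<in> \<int>" if "j \<in> {s<..<d}" for j
      using that sd by (intro gen) (auto simp: t_def s_def)
    have "(\<Sum>i<N. t i) = of_int a * real k + of_int b * real (p * k)"
      unfolding t_def sum_pattern using p by (simp add: power2_eq_square)
    then have tZ: "(\<Sum>i<N. t i) \<in> \<int>" by (simp del: of_nat_mult)
    have "(\<Sum>i<N. r i - t i) + (\<Sum>i<N. t i) \<in> \<int>" by (intro Ints_add[OF Ints_sum tZ] r) simp
    then show "(\<Sum>i<N. r i) \<in> \<int>" by (simp add: sum_subtractf)
  qed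
qed

section \<open>Groups whose heights are 0, k, 2k, ...\<close>

lemma frac_eq_if_diff_Ints: "(x::real) - y \<in> \<int> \<Longrightarrow> frac x = frac y"
proof -
  assume "x - y \<in> \<int>"
  then obtain n where "x = y + of_int n" using Ints_cases by (metis diff_add_cancel add.commute)
  then show ?thesis by (simp add: frac_def)
qed

lemma diff_frac_Ints: "(x::real) - frac x \<in> \<int>"
  by (simp add: frac_def)

text \<open>
All values below \<open>m\<close> are already taken by smaller arguments.
\<close>

lemma inj_le_imp_id:
  fixes f :: "nat \<Rightarrow> nat"
  assumes "inj_on f {..<n}" "\<And>m. m < n \<Longrightarrow> f m \<le> m"
  shows "m < n \<Longrightarrow> f m = m"
proof (induction m rule: less_induct)
  case (less m)
  show ?case
  proof (rule ccontr)
    assume "f m \<noteq> m"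
    then have lt: "f m < m" using assms(2)[OF less(2)] by simp
    then have "f (f m) = f m" using less by simp
    then have "f m = m" using assms(1) less(2) lt by (auto simp: inj_on_def)
    then show False using lt by simp
  qed
qed

lemma int_coprime_cancel:
  assumes "coprime a b" "of_int a * (x::real) \<in> \<int>" "of_int b * x \<in> \<int>"
  shows "x \<in> \<int>"
proof -
  from bezout_int[of a b] assms(1) obtain u w where "u * a + w * b = 1" by auto
  then have "of_int (u * a + w * b) * x = x" by simp
  then have "x = of_int u * (of_int a * x) + of_int w * (of_int b * x)"
    by (simp add: algebra_simps)
  then show ?thesis using assms by (metis Ints_add Ints_mult Ints_of_int)
qed

text \<open>
The integer \<open>q x\<close> is the sum of \<open>x < 1\<close> and \<open>(q - 1) x < 1\<close>, so it is 0 or 1.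
\<close>

lemma small_multiple_Ints:
  assumes "(x::real) \<ge> 0" "q \<ge> 2" "of_nat q * x \<in> \<int>" "(real q - 1) * x < 1"
  shows "x = 0 \<or> x = 1 / real q"
proof -
  obtain z where z: "of_nat q * x = of_int z" using assms(3) Ints_cases by blast
  have "1 * x \<le> (real q - 1) * x" using assms(1,2) by (intro mult_right_mono) auto
  then have "x < 1" using assms(4) by simp
  have "real q * x < 2" using assms(4) \<open>x < 1\<close> by (simp add: algebra_simps)
  then have "z < 2" using z by linarith
  moreover have "z \<ge> 0" using z assms(1)
    by (metis mult_nonneg_nonneg of_nat_0_le_iff of_int_0_le_iff)
  ultimately have "z = 0 \<or> z = 1" by linarith
  then show ?thesis using z assms(2) by (auto simp: field_simps)
qed

text \<open>
What remains of the simplex for the classification: a group between \<open>\<int>\<^sup>N\<close> and \<open>\<real>\<^sup>N\<close> in which the coordinate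
sum enumerates the classes by \<open>0, k, \<dots>, (p\<^sup>2 - 1)k\<close>, and no coordinate of which is integral throughout.
\<close>

locale height_graded_lattice =
  fixes N p k :: nat and L :: "(nat \<Rightarrow> real) set"
  assumes prime: "prime p" and k_pos: "k > 0"
    and L_diff: "\<And>r s. r \<in> L \<Longrightarrow> s \<in> L \<Longrightarrow> (\<lambda>i. r i - s i) \<in> L"
    and L_int: "\<And>r. (\<And>i. i < N \<Longrightarrow> r i \<in> \<int>) \<Longrightarrow> r \<in> L"
    and heights: "bij_betw (\<lambda>r. \<Sum>i<N. r i)
        {r \<in> L. (\<forall>i<N. 0 \<le> r i \<and> r i < 1) \<and> (\<forall>i\<ge>N. r i = 0)}
        ((\<lambda>j. real (j * k)) ` {..<p^2})"
    and nondegenerate: "\<And>i. i < N \<Longrightarrow> \<exists>r\<in>L. r i \<notin> \<int>"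
begin

definition cell :: "(nat \<Rightarrow> real) set" where
  "cell = {r \<in> L. (\<forall>i<N. 0 \<le> r i \<and> r i < 1) \<and> (\<forall>i\<ge>N. r i = 0)}"

definition cong_int :: "(nat \<Rightarrow> real) \<Rightarrow> (nat \<Rightarrow> real) \<Rightarrow> bool"  (infix "\<equiv>\<^sub>\<int>" 50) where
  "r \<equiv>\<^sub>\<int> s \<longleftrightarrow> (\<forall>i<N. r i - s i \<in> \<int>)"

definition height :: "(nat \<Rightarrow> real) \<Rightarrow> real" where
  "height r = (\<Sum>i<N. frac (r i))"

definition reduce :: "(nat \<Rightarrow> real) \<Rightarrow> nat \<Rightarrow> real" where
  "reduce r = (\<lambda>i. if i < N then frac (r i) else 0)"

lemma p_ge_2: "p \<ge> 2"
  using prime prime_ge_2_nat by blast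

lemma p_sq_ge_4: "p^2 \<ge> 4"
  using mult_le_mono[OF p_ge_2 p_ge_2] by (simp add: power2_eq_square)

lemma L_add: "r \<in> L \<Longrightarrow> s \<in> L \<Longrightarrow> (\<lambda>i. r i + s i) \<in> L"
proof -
  assume rs: "r \<in> L" "s \<in> L"
  have z: "(\<lambda>i. 0) \<in> L" by (rule L_int) auto
  have "(\<lambda>i. 0 - s i) \<in> L" using L_diff[OF z rs(2)] .
  from L_diff[OF rs(1) this] show ?thesis by simp
qed

lemma L_cong:
  assumes "s \<in> L" "r \<equiv>\<^sub>\<int> s"
  shows "r \<in> L"
proof -
  have "(\<lambda>i. r i - s i) \<in> L"
    by (rule L_int) (use assms in \<open>auto simp: cong_int_def\<close>)
  from L_add[OF this assms(1)] show ?thesis by simp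
qed

lemma L_nat_scale: "r \<in> L \<Longrightarrow> (\<lambda>i. of_nat m * r i) \<in> L"
proof (induction m)
  case 0 show ?case by (rule L_int) auto
next
  case (Suc m)
  from L_add[OF Suc(1)[OF Suc(2)] Suc(2)] show ?case by (simp add: algebra_simps)
qed

lemma L_int_scale: "r \<in> L \<Longrightarrow> (\<lambda>i. of_int m * r i) \<in> L"
proof (cases m rule: int_cases2)
  case (nonpos n)
  assume "r \<in> L"
  have z: "(\<lambda>i. 0) \<in> L" by (rule L_int) auto
  from L_diff[OF z L_nat_scale[OF \<open>r \<in> L\<close>, of n]] nonpos show ?thesis by simp
qed (use L_nat_scale in auto)

lemma L_comb: "r \<in> L \<Longrightarrow> s \<in> L \<Longrightarrow> (\<lambda>i. of_int a * r i + of_int b * s i) \<in> L"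
  by (intro L_add L_int_scale)

lemma cong_sym: "r \<equiv>\<^sub>\<int> s \<Longrightarrow> s \<equiv>\<^sub>\<int> r"
  unfolding cong_int_def by (metis Ints_minus minus_diff_eq)

lemma cong_trans: "r \<equiv>\<^sub>\<int> s \<Longrightarrow> s \<equiv>\<^sub>\<int> t \<Longrightarrow> r \<equiv>\<^sub>\<int> t"
  unfolding cong_int_def by (metis Ints_add add_diff_eq diff_add_cancel)

lemma cong_reduce: "r \<equiv>\<^sub>\<int> reduce r"
  by (simp add: cong_int_def reduce_def diff_frac_Ints)

lemma reduce_in_cell: "r \<in> L \<Longrightarrow> reduce r \<in> cell"
  using L_cong[OF _ cong_sym[OF cong_reduce]]
  by (auto simp: cell_def) (auto simp: reduce_def frac_lt_1)

lemma height_cong: "r \<equiv>\<^sub>\<int> s \<Longrightarrow> height r = height s"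
  unfolding height_def cong_int_def
  by (intro sum.cong refl frac_eq_if_diff_Ints) auto

lemma height_cell: "r \<in> cell \<Longrightarrow> height r = (\<Sum>i<N. r i)"
  unfolding height_def cell_def by (intro sum.cong) (auto simp: frac_eq)

lemma bij_height_cell: "bij_betw height cell ((\<lambda>j. real (j * k)) ` {..<p^2})"
proof -
  have "bij_betw (\<lambda>r. \<Sum>i<N. r i) cell ((\<lambda>j. real (j * k)) ` {..<p^2})"
    using heights by (simp add: cell_def)
  moreover have "\<And>r. r \<in> cell \<Longrightarrow> (\<Sum>i<N. r i) = height r" by (simp add: height_cell)
  ultimately show ?thesis using bij_betw_cong by force
qed

lemma height_mult:
  assumes "r \<in> L" obtains j where "j < p^2" "height r = real (j * k)"
proof -
  have "height (reduce r) \<in> (\<lambda>j. real (j * k)) ` {..<p^2}"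
    using bij_height_cell reduce_in_cell[OF assms] by (auto simp: bij_betw_def)
  then show ?thesis using that height_cong[OF cong_reduce, of r] by auto
qed

lemma height_inj:
  assumes "r \<in> L" "s \<in> L" "height r = height s"
  shows "r \<equiv>\<^sub>\<int> s"
proof -
  have "height (reduce r) = height (reduce s)"
    using assms height_cong[OF cong_reduce] by metis
  then have "reduce r = reduce s"
    using bij_height_cell reduce_in_cell assms by (auto simp: bij_betw_def inj_on_def)
  then show ?thesis using cong_reduce cong_sym cong_trans by metis
qed

lemma obtain_height:
  assumes "j < p^2" obtains r where "r \<in> cell" "height r = real (j * k)"
proof -
  have "real (j * k) \<in> height ` cell"
    using bij_height_cell assms by (auto simp: bij_betw_def simp del: of_nat_mult)
  then show ?thesis using that by auto
qed

lemma card_cell: "card cell = p^2" and finite_cell: "finite cell"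
proof -
  have "inj_on (\<lambda>j. real (j * k)) {..<p^2}"
    using k_pos by (auto simp: inj_on_def)
  then have "card ((\<lambda>j. real (j * k)) ` {..<p^2}) = p^2"
    by (simp add: card_image)
  then show "card cell = p^2" using bij_betw_same_card[OF bij_height_cell] by simp
  then show "finite cell" using p_ge_2 by (metis card.infinite power_eq_0_iff not_numeral_le_zero)
qed

text \<open>
Lagrange's theorem for the group of classes: translation by \<open>r\<close> permutes the \<open>p\<^sup>2\<close> elements of the cell
up to integral vectors, so their sum changes by \<open>p\<^sup>2 r\<close> and not at all modulo \<open>\<int>\<close>.
\<close>

lemma L_torsion:
  assumes "r \<in> L" "i < N"
  shows "of_nat (p^2) * r i \<in> \<int>"
proof -
  define t where "t = (\<lambda>s. reduce (\<lambda>i. r i + s i))"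
  have t_cell: "t s \<in> cell" if "s \<in> cell" for s
    unfolding t_def using that assms by (intro reduce_in_cell L_add) (auto simp: cell_def)
  have inj: "inj_on t cell"
  proof (rule inj_onI)
    fix s s' assume s: "s \<in> cell" "s' \<in> cell" "t s = t s'"
    have "(\<lambda>i. r i + s i) \<equiv>\<^sub>\<int> (\<lambda>i. r i + s' i)"
      using s(3) cong_reduce cong_sym cong_trans unfolding t_def by metis
    then have "s \<equiv>\<^sub>\<int> s'" by (simp add: cong_int_def)
    then have "height s = height s'" by (rule height_cong)
    then show "s = s'" using bij_height_cell s(1,2) by (auto simp: bij_betw_def inj_on_def)
  qed
  have "t ` cell = cell"
    using inj t_cell finite_cell by (metis endo_inj_surj image_subsetI)
  then have "(\<Sum>s\<in>cell. s i) = (\<Sum>s\<in>t ` cell. s i)" by simp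
  also have "\<dots> = (\<Sum>s\<in>cell. t s i)" by (subst sum.reindex[OF inj]) simp
  finally have *: "(\<Sum>s\<in>cell. s i) = (\<Sum>s\<in>cell. t s i)" .
  have "(\<Sum>s\<in>cell. (r i + s i) - t s i) \<in> \<int>"
    by (intro Ints_sum) (use assms(2) in \<open>simp add: t_def reduce_def diff_frac_Ints\<close>)
  moreover have "(\<Sum>s\<in>cell. (r i + s i) - t s i) = of_nat (p^2) * r i"
    using * by (simp add: sum_subtractf sum.distrib card_cell)
  ultimately show ?thesis by simp
qed

text \<open>
Passing to fractional parts does not increase nonnegative numbers, so the height of \<open>e m\<close> is at most
\<open>m k\<close>. As the heights are distinct multiples of \<open>k\<close>, the \<open>m\<close>-th must be equal to \<open>m k\<close>; then no coordinate
changes when its fractional part is taken.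
\<close>

lemma tight_sequence:
  assumes L: "\<And>m. m < n \<Longrightarrow> e m \<in> L" and n: "n \<le> p^2"
    and pos: "\<And>m i. m < n \<Longrightarrow> i < N \<Longrightarrow> e m i \<ge> 0"
    and sum: "\<And>m. m < n \<Longrightarrow> (\<Sum>i<N. e m i) = real (m * k)"
    and dist: "\<And>m m'. m < n \<Longrightarrow> m' < n \<Longrightarrow> e m \<equiv>\<^sub>\<int> e m' \<Longrightarrow> m = m'"
    and m: "m < n"
  shows "height (e m) = real (m * k)" and "\<And>i. i < N \<Longrightarrow> e m i < 1"
proof -
  have "\<forall>m. \<exists>j. m < n \<longrightarrow> height (e m) = real (j * k)"
    using height_mult[OF L] by metis
  then obtain f where f: "\<And>m. m < n \<Longrightarrow> height (e m) = real (f m * k)" by metis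
  have fle: "frac (e m i) \<le> e m i" if "m < n" "i < N" for m i
    using pos[OF that] by (simp add: frac_def)
  have le: "f m \<le> m" if "m < n" for m
  proof -
    have "height (e m) \<le> (\<Sum>i<N. e m i)"
      unfolding height_def by (intro sum_mono) (use fle that in auto)
    then have "real (f m * k) \<le> real (m * k)" using f[OF that] sum[OF that] by simp
    then show ?thesis using k_pos by (simp only: of_nat_le_iff) simp
  qed
  have "inj_on f {..<n}"
  proof (rule inj_onI)
    fix a b assume ab: "a \<in> {..<n}" "b \<in> {..<n}" "f a = f b"
    then have "height (e a) = height (e b)" using f by simp
    then show "a = b" using dist[of a b] height_inj[of "e a" "e b"] L ab by auto
  qed
  then have "f m = m" using inj_le_imp_id[of f n m] le m by simp
  then show h: "height (e m) = real (m * k)" using f[OF m] by simp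
  fix i assume i: "i < N"
  have "(\<Sum>i<N. e m i - frac (e m i)) = 0"
    using h sum[OF m] by (simp add: height_def sum_subtractf)
  then have "e m i - frac (e m i) = 0"
    using fle[OF m] i sum_nonneg_eq_0_iff[of "{..<N}" "\<lambda>i. e m i - frac (e m i)"] by auto
  then show "e m i < 1" using frac_lt_1[of "e m i"] by linarith
qed

lemma tight_sequence_exhausts:
  assumes "\<And>m. m < p^2 \<Longrightarrow> e m \<in> L"
    and "\<And>m. m < p^2 \<Longrightarrow> height (e m) = real (m * k)" and "r \<in> L"
  obtains m where "m < p^2" "r \<equiv>\<^sub>\<int> e m"
  using height_mult[OF assms(3)] height_inj assms by metis

lemma first_height:
  obtains h where "h \<in> cell" "(\<Sum>i<N. h i) = real k"
proof -
  have "1 < p^2" using p_sq_ge_4 by simp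
  from obtain_height[OF this] obtain h where "h \<in> cell" "height h = real (1 * k)" .
  then show ?thesis using that height_cell[of h] by simp
qed

text \<open>
The multiples of \<open>h\<close> by \<open>0, \<dots>, p\<^sup>2 - 1\<close> are pairwise incongruent and form a tight sequence that meets all
classes. The last one gives \<open>(p\<^sup>2 - 1) h i < 1\<close>, which leaves \<open>0\<close> and \<open>1/p\<^sup>2\<close> for \<open>h i\<close>; and \<open>0\<close> is impossible as
every class is a multiple of \<open>h\<close>.
\<close>

lemma least_height_of_order_p_square:
  assumes h: "h \<in> cell" "(\<Sum>i<N. h i) = real k" and i: "i0 < N" "of_nat p * h i0 \<notin> \<int>"
  shows "N = p^2 * k"
    and "r \<in> L \<longleftrightarrow> (\<exists>m::int. r \<equiv>\<^sub>\<int> (\<lambda>i. of_int m / real p ^ 2))"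
proof -
  define e where "e = (\<lambda>(m::nat) i. of_nat m * h i)"
  have hL: "h \<in> L" and hpos: "\<And>i. i < N \<Longrightarrow> h i \<ge> 0" using h by (auto simp: cell_def)
  have eL: "e m \<in> L" for m unfolding e_def by (rule L_nat_scale[OF hL])
  have esum: "(\<Sum>i<N. e m i) = real (m * k)" for m
    unfolding e_def by (simp add: sum_distrib_left[symmetric] h)
  have dist: "m = m'" if mm: "m < p^2" "m' < p^2" "e m \<equiv>\<^sub>\<int> e m'" for m m'
  proof (rule ccontr)
    assume "m \<noteq> m'"
    define j where "j = int m - int m'"
    have "j \<noteq> 0" "\<bar>j\<bar> < int (p^2)" using \<open>m \<noteq> m'\<close> mm unfolding j_def by linarith+
    have "of_int j * h i0 \<in> \<int>" using mm(3) i(1) by (auto simp: cong_int_def e_def j_def algebra_simps)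
    have t: "of_int (int p * int p) * h i0 \<in> \<int>"
      using L_torsion[OF hL i(1)] by (simp add: power2_eq_square)
    have pp: "prime (int p)" using prime by simp
    show False
    proof (cases "int p dvd j")
      case False
      then have "coprime (int p) j" using pp by (simp add: prime_imp_coprime)
      then have "coprime j (int p * int p)" by (simp add: coprime_commute)
      from int_coprime_cancel[OF this \<open>of_int j * h i0 \<in> \<int>\<close> t] have "h i0 \<in> \<int>" .
      then show False using i(2) by (simp add: Ints_mult)
    next
      case True
      then obtain l where l: "j = int p * l" by auto
      have "\<not> int p dvd l"
      proof
        assume "int p dvd l"
        then obtain l' where "j = int (p^2) * l'" using l by (auto simp: power2_eq_square mult.assoc)
        then have "int (p^2) dvd j" by simp
        then have "int (p^2) \<le> \<bar>j\<bar>" using dvd_imp_le_int[OF \<open>j \<noteq> 0\<close>] by fastforce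
        then show False using \<open>\<bar>j\<bar> < int (p^2)\<close> by simp
      qed
      then have "coprime l (int p)" using prime_imp_coprime[OF pp, of l] by (simp add: coprime_commute)
      moreover have "of_int l * (real p * h i0) \<in> \<int>"
        using \<open>of_int j * h i0 \<in> \<int>\<close> l by (simp add: mult_ac)
      moreover have "of_int (int p) * (real p * h i0) \<in> \<int>" using t by (simp add: mult_ac)
      ultimately show False using int_coprime_cancel i(2) by blast
    qed
  qed
  have epos: "i < N \<Longrightarrow> 0 \<le> e m i" for m i using hpos by (simp add: e_def)
  have tight: "height (e m) = real (m * k)" "i < N \<Longrightarrow> e m i < 1" if "m < p^2" for m i
    by (rule tight_sequence[of "p^2" e m]; (assumption | rule eL order_refl epos esum dist that)+)+
  have all: "\<exists>m<p^2. r \<equiv>\<^sub>\<int> e m" if "r \<in> L" for r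
    using tight_sequence_exhausts[of e r] eL tight(1) that by metis
  have p2: "p^2 \<ge> 2" using p_sq_ge_4 by simp
  have hval: "h i = 1 / real (p^2)" if i: "i < N" for i
  proof -
    have "e (p^2 - 1) i < 1" using tight(2)[of "p^2-1" i] p2 i by simp
    then have "(real (p^2) - 1) * h i < 1" using p2 by (simp add: e_def of_nat_diff)
    then have "h i = 0 \<or> h i = 1 / real (p^2)"
      using small_multiple_Ints[of "h i" "p^2"] hpos[OF i] p2 L_torsion[OF hL i] by simp
    moreover have "h i \<noteq> 0"
    proof
      assume 0: "h i = 0"
      obtain r where r: "r \<in> L" "r i \<notin> \<int>" using nondegenerate[OF i] by auto
      from all[OF r(1)] obtain m where "r \<equiv>\<^sub>\<int> e m" by auto
      then show False using r(2) 0 i by (auto simp: cong_int_def e_def)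
    qed
    ultimately show ?thesis by simp
  qed
  have "real N / real (p^2) = real k" using h(2) hval by simp
  then have "real N = real (p^2 * k)" using p_ge_2 by (simp add: field_simps)
  then show "N = p^2 * k" using of_nat_eq_iff by blast
  have hh: "(\<lambda>i. of_int m * h i) \<equiv>\<^sub>\<int> (\<lambda>i. of_int m / real p ^ 2)" for m :: int
    using hval by (simp add: cong_int_def)
  show "r \<in> L \<longleftrightarrow> (\<exists>m::int. r \<equiv>\<^sub>\<int> (\<lambda>i. of_int m / real p ^ 2))"
  proof
    assume "r \<in> L"
    then obtain m where "r \<equiv>\<^sub>\<int> e m" using all by auto
    then have "r \<equiv>\<^sub>\<int> (\<lambda>i. of_int (int m) * h i)" by (simp add: e_def)
    from cong_trans[OF this hh] show "\<exists>m::int. r \<equiv>\<^sub>\<int> (\<lambda>i. of_int m / real p ^ 2)" by blast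
  next
    assume "\<exists>m::int. r \<equiv>\<^sub>\<int> (\<lambda>i. of_int m / real p ^ 2)"
    then obtain m :: int where "r \<equiv>\<^sub>\<int> (\<lambda>i. of_int m / real p ^ 2)" by blast
    from L_cong[OF L_int_scale[OF hL] cong_trans[OF this cong_sym[OF hh]]] show "r \<in> L" .
  qed
qed

text \<open>
The multiples of \<open>h\<close> by \<open>0, \<dots>, p - 1\<close> form a tight sequence, so that \<open>h\<close> has entries \<open>0\<close> and \<open>1/p\<close>, with
support \<open>S\<close>. They use up the heights below \<open>p k\<close>; therefore the element \<open>g\<close> of height \<open>p k\<close> is not
congruent to a multiple of \<open>h\<close>, and the \<open>p\<^sup>2\<close> combinations \<open>a g + b h\<close> with \<open>a, b < p\<close> are pairwise
incongruent. Ordered by \<open>a p + b\<close> they are a tight sequence, the last member of which gives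
\<open>(p - 1)(g i + h i) < 1\<close>. Moreover \<open>p g\<close> is congruent to \<open>c h\<close> for some \<open>c < p\<close>. On \<open>S\<close> the bound leaves only
\<open>0\<close> and \<open>1\<close> for \<open>p\<^sup>2 g i\<close>, and this number is \<open>c\<close>; off \<open>S\<close> it leaves only \<open>g i = 1/p\<close>. If \<open>c = 1\<close>, then \<open>h\<close> is a
multiple of \<open>g\<close>, and if \<open>c = 0\<close>, then \<open>g\<close> and \<open>h\<close> have complementary supports. The height of \<open>g\<close> gives \<open>N\<close>.
\<close>

lemma least_height_of_order_p:
  assumes h: "h \<in> cell" "(\<Sum>i<N. h i) = real k" and ph: "\<And>i. i < N \<Longrightarrow> of_nat p * h i \<in> \<int>"
  obtains S where "S \<subseteq> {..<N}" "card S = p * k" "N = p^2 * k + (p - 1) * k"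
      "\<And>r. r \<in> L \<longleftrightarrow> (\<exists>m::int. r \<equiv>\<^sub>\<int> (\<lambda>i. of_int m * (if i \<in> S then 1 / real p ^ 2 else 1 / real p)))"
    | S where "S \<subseteq> {..<N}" "card S = p * k" "N = p^2 * k + p * k"
      "\<And>r. r \<in> L \<longleftrightarrow> (\<exists>a b::int. r \<equiv>\<^sub>\<int> (\<lambda>i. if i \<in> S then of_int a / real p else of_int b / real p))"
proof -
  have hL: "h \<in> L" and hpos: "\<And>i. i < N \<Longrightarrow> h i \<ge> 0" using h by (auto simp: cell_def)
  have p_int: "prime (int p)" using prime by simp
  have p0: "real p > 0" using p_ge_2 by simp
  have p_le: "p \<le> p^2" by (simp add: power2_eq_square)
  have h_height: "height h = real k" using height_cell h by simp
  have zero: "height (\<lambda>i. 0) = 0" by (simp add: height_def)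
  have zeroL: "(\<lambda>i. 0) \<in> L" by (rule L_int) auto
  \<comment> \<open>otherwise \<open>h\<close> would be integral, by coprimality, and so have height 0\<close>
  have h_free: "int p dvd j" if j: "\<And>i. i < N \<Longrightarrow> of_int j * h i \<in> \<int>" for j
  proof (rule ccontr)
    assume "\<not> int p dvd j"
    then have c: "coprime (int p) j" using p_int by (simp add: prime_imp_coprime)
    have "h i \<in> \<int>" if "i < N" for i
      using int_coprime_cancel[OF c, of "h i"] ph[OF that] j[OF that] by simp
    then have "h \<equiv>\<^sub>\<int> (\<lambda>i. 0)" by (simp add: cong_int_def)
    then have "height h = 0" using height_cong zero by simp
    then show False using h_height k_pos by simp
  qed
  define e where "e = (\<lambda>(m::nat) i. of_nat m * h i)"
  have eL: "e m \<in> L" for m unfolding e_def by (rule L_nat_scale[OF hL])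
  have esum: "(\<Sum>i<N. e m i) = real (m * k)" for m
    unfolding e_def by (simp add: sum_distrib_left[symmetric] h)
  have small_eq: "m = m'" if "m < p" "m' < p" "int p dvd int m - int m'" for m m'
  proof (rule ccontr)
    assume "m \<noteq> m'"
    then have "int p \<le> \<bar>int m - int m'\<bar>" using dvd_imp_le_int[OF _ that(3)] by simp
    then show False using that by linarith
  qed
  have edist: "m = m'" if mm: "m < p" "m' < p" "e m \<equiv>\<^sub>\<int> e m'" for m m'
  proof (rule small_eq[OF mm(1,2)], rule h_free)
    fix i assume "i < N" then show "of_int (int m - int m') * h i \<in> \<int>"
      using mm(3) by (simp add: cong_int_def e_def algebra_simps)
  qed
  have epos: "i < N \<Longrightarrow> 0 \<le> e m i" for m i using hpos by (simp add: e_def)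
  have etight: "height (e m) = real (m * k)" "i < N \<Longrightarrow> e m i < 1" if "m < p" for m i
    by (rule tight_sequence[of p e m]; (assumption | rule eL p_le epos esum edist that)+)+
  have hval: "h i = 0 \<or> h i = 1 / real p" if i: "i < N" for i
  proof -
    have "e (p - 1) i < 1" using etight(2)[of "p-1" i] p_ge_2 i by simp
    then have "(real p - 1) * h i < 1" using p_ge_2 by (simp add: e_def of_nat_diff)
    then show ?thesis
      using small_multiple_Ints[of "h i" p] hpos[OF i] p_ge_2 ph[OF i] by simp
  qed
  define S where "S = {i. i < N \<and> h i \<noteq> 0}"
  have S: "S \<subseteq> {..<N}" "finite S" by (auto simp: S_def)
  have hS: "h i = 1 / real p" if "i \<in> S" for i using hval that by (auto simp: S_def)
  have hnS: "h i = 0" if "i < N" "i \<notin> S" for i using that by (auto simp: S_def)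
  have split: "(\<Sum>i<N. f i) = (\<Sum>i\<in>S. f i) + (\<Sum>i\<in>{..<N} - S. f i)" for f :: "nat \<Rightarrow> real"
    using sum.subset_diff[OF S(1), of f] by simp
  have "real (card S) / real p = real k"
    using h(2) hS hnS unfolding split by simp
  then have "real (card S) = real (p * k)" using p0 by (simp add: field_simps)
  then have cardS: "card S = p * k" using of_nat_eq_iff by blast
  then have "S \<noteq> {}" using k_pos p_ge_2 by auto
  then obtain s where s: "s \<in> S" "s < N" using S by auto

  have "p < p^2" using p_ge_2 by (simp add: power2_eq_square)
  from obtain_height[OF this] obtain g where g: "g \<in> cell" "height g = real (p * k)" .
  have gL: "g \<in> L" and gpos: "\<And>i. i < N \<Longrightarrow> g i \<ge> 0" using g by (auto simp: cell_def)
  have gsum: "(\<Sum>i<N. g i) = real (p * k)" using height_cell g by simp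
  have g_not_mult: "\<not> g \<equiv>\<^sub>\<int> (\<lambda>i. of_int c * h i)" for c
  proof
    assume a: "g \<equiv>\<^sub>\<int> (\<lambda>i. of_int c * h i)"
    define c' where "c' = nat (c mod int p)"
    have c': "c' < p" using p_ge_2 by (simp add: c'_def nat_less_iff)
    have "(\<lambda>i. of_int c * h i) \<equiv>\<^sub>\<int> e c'"
      unfolding cong_int_def
    proof (intro allI impI)
      fix i assume i: "i < N"
      have "c = c div int p * int p + int c'" using p_ge_2 by (simp add: c'_def)
      then have "of_int c = of_int (c div int p) * real p + real c'"
        by (metis of_int_add of_int_mult of_int_of_nat_eq)
      then have "of_int c * h i - e c' i = of_int (c div int p) * (of_nat p * h i)"
        by (simp add: e_def algebra_simps)
      then show "of_int c * h i - e c' i \<in> \<int>" using ph[OF i] by (simp add: Ints_mult)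
    qed
    then have "height g = height (e c')" using a cong_trans height_cong by blast
    then have "real (p * k) = real (c' * k)" using g(2) etight(1)[OF c'] by simp
    then show False using c' k_pos by simp
  qed
  have g_free: "j = 0" if j: "\<bar>j\<bar> < int p" "(\<lambda>i. of_int j * g i) \<equiv>\<^sub>\<int> (\<lambda>i. of_int c * h i)" for j c
  proof (rule ccontr)
    assume "j \<noteq> 0"
    have "\<not> int p dvd j" using dvd_imp_le_int[OF \<open>j \<noteq> 0\<close>, of "int p"] j(1) by auto
    then have "coprime (int p) j" using p_int by (simp add: prime_imp_coprime)
    then have "coprime j (int (p^2))" by (simp add: coprime_commute)
    then obtain u w where uw: "u * j + w * int (p^2) = 1" using bezout_int[of j "int (p^2)"] by auto
    have "g \<equiv>\<^sub>\<int> (\<lambda>i. of_int (u * c) * h i)"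
      unfolding cong_int_def
    proof (intro allI impI)
      fix i assume i: "i < N"
      have "g i = of_int (u * j + w * int (p^2)) * g i" unfolding uw by simp
      then have "g i - of_int (u * c) * h i
          = of_int u * (of_int j * g i - of_int c * h i) + of_int w * (of_nat (p^2) * g i)"
        by (simp add: algebra_simps)
      then show "g i - of_int (u * c) * h i \<in> \<int>"
        using j(2) i L_torsion[OF gL i] by (simp add: cong_int_def)
    qed
    then show False using g_not_mult by blast
  qed

  \<comment> \<open>the combinations of \<open>g\<close> and \<open>h\<close>, with the base \<open>p\<close> digits of \<open>m\<close> as coefficients\<close>
  define f where "f = (\<lambda>m i. of_nat (m div p) * g i + of_nat (m mod p) * h i)"
  have fL: "f m \<in> L" for m unfolding f_def by (intro L_add L_nat_scale gL hL)
  have fpos: "i < N \<Longrightarrow> 0 \<le> f m i" for m i using hpos gpos by (simp add: f_def)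
  have fsum: "(\<Sum>i<N. f m i) = real (m * k)" for m
  proof -
    have "(\<Sum>i<N. f m i) = real (m div p) * real (p * k) + real (m mod p) * real k"
      unfolding f_def by (simp add: sum.distrib sum_distrib_left[symmetric] h gsum)
    also have "\<dots> = real ((m div p * p + m mod p) * k)" by (simp only: of_nat_add of_nat_mult ring_distribs mult_ac)
    finally show ?thesis by (simp only: div_mult_mod_eq)
  qed
  have fdist: "m = m'" if mm: "m < p^2" "m' < p^2" "f m \<equiv>\<^sub>\<int> f m'" for m m'
  proof -
    define a b where "a = int (m div p) - int (m' div p)" and "b = int (m' mod p) - int (m mod p)"
    have "m div p < p" "m' div p < p" using mm(1,2) by (auto simp: power2_eq_square less_mult_imp_div_less)
    then have "\<bar>a\<bar> < int p" unfolding a_def by linarith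
    moreover have ab: "(\<lambda>i. of_int a * g i) \<equiv>\<^sub>\<int> (\<lambda>i. of_int b * h i)"
      using mm(3) by (simp add: cong_int_def f_def a_def b_def algebra_simps)
    ultimately have "a = 0" by (rule g_free)
    then have "(\<lambda>i. of_int 0 * g i) \<equiv>\<^sub>\<int> (\<lambda>i. of_int b * h i)" using ab by simp
    then have "\<And>i. i < N \<Longrightarrow> of_int b * h i \<in> \<int>" by (simp add: cong_int_def)
    then have "int p dvd b" by (rule h_free)
    then have "m' mod p = m mod p" using p_ge_2 unfolding b_def by (intro small_eq) auto
    then show ?thesis using \<open>a = 0\<close> unfolding a_def by (metis eq_iff_diff_eq_0 of_nat_eq_iff div_mult_mod_eq)
  qed
  have ftight: "height (f m) = real (m * k)" "i < N \<Longrightarrow> f m i < 1" if "m < p^2" for m i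
    by (rule tight_sequence[of "p^2" f m]; (assumption | rule fL order_refl fpos fsum fdist that)+)+
  have all: "\<exists>m<p^2. r \<equiv>\<^sub>\<int> f m" if "r \<in> L" for r
    using tight_sequence_exhausts[of f r] fL ftight(1) that by metis
  have gh: "(real p - 1) * (g i + h i) < 1" if i: "i < N" for i
  proof -
    define m where "m = (p - 1) * p + (p - 1)"
    have "(p - 1) * p + (p - 1) = p^2 - 1"
      using p_ge_2 by (cases p) (auto simp: power2_eq_square algebra_simps)
    then have m: "m < p^2" using p_sq_ge_4 by (simp add: m_def)
    have *: "(q * p + q) div p = q" "(q * p + q) mod p = q" if "q < p" for q using that by auto
    have "p - 1 < p" using p_ge_2 by simp
    from *[OF this] have dm: "m div p = p - 1" "m mod p = p - 1" unfolding m_def by auto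
    show ?thesis using ftight(2)[OF m i] p_ge_2 by (simp add: f_def dm of_nat_diff algebra_simps)
  qed

  obtain c where c: "c < p" "(\<lambda>i. of_nat p * g i) \<equiv>\<^sub>\<int> (\<lambda>i. of_nat c * h i)"
  proof -
    obtain m where m: "m < p^2" "(\<lambda>i. of_nat p * g i) \<equiv>\<^sub>\<int> f m"
      using all[OF L_nat_scale[OF gL]] by blast
    have mp: "m div p < p" using m(1) by (auto simp: power2_eq_square less_mult_imp_div_less)
    have "m div p = 0"
    proof (rule ccontr)
      assume nz: "m div p \<noteq> 0"
      have "(\<lambda>i. of_int (int p - int (m div p)) * g i) \<equiv>\<^sub>\<int> (\<lambda>i. of_int (int (m mod p)) * h i)"
        using m(2) by (simp add: cong_int_def f_def algebra_simps)
      from g_free[OF _ this] have "int p - int (m div p) = 0" using nz mp by simp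
      then show False using mp by simp
    qed
    then have "(\<lambda>i. of_nat p * g i) \<equiv>\<^sub>\<int> (\<lambda>i. of_nat (m mod p) * h i)"
      using m(2) by (simp add: cong_int_def f_def)
    then show ?thesis using that[of "m mod p"] p_ge_2 by simp
  qed
  have gS: "c < 2 \<and> g i = real c / real (p^2)" if i: "i \<in> S" for i
  proof -
    have iN: "i < N" using i S by auto
    obtain t where t: "real (p^2) * g i = of_int t" using L_torsion[OF gL iN] Ints_cases by blast
    have "(real p - 1) * (real p * g i) < 1"
    proof -
      have "real p * ((real p - 1) * (g i + h i)) < real p * 1"
        using gh[OF iN] p0 by (intro mult_strict_left_mono) auto
      moreover have "real p * ((real p - 1) * (g i + h i)) = (real p - 1) * (real p * g i) + (real p - 1)"
        using hS[OF i] p0 by (simp add: field_simps)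
      ultimately show ?thesis by linarith
    qed
    moreover have "real p * g i \<ge> 0" using gpos[OF iN] by simp
    moreover have "real p * (real p * g i) \<in> \<int>" using t by (simp add: power2_eq_square mult.assoc)
    ultimately have "real p * g i = 0 \<or> real p * g i = 1 / real p"
      using small_multiple_Ints[of "real p * g i" p] p_ge_2 by simp
    then have "\<exists>t::nat. t < 2 \<and> real p * g i = real t / real p"
      by (elim disjE) (rule exI[of _ 0], simp, rule exI[of _ 1], simp)
    then obtain t :: nat where t: "t < 2" "real p * g i = real t / real p" by blast
    have "real p * g i - real c * h i \<in> \<int>" using c(2) iN by (simp add: cong_int_def)
    then have "(real t - real c) / real p \<in> \<int>" using t(2) hS[OF i] by (simp add: diff_divide_distrib)
    then obtain z where "(real t - real c) / real p = of_int z" using Ints_cases by blast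
    then have "real t - real c = real p * of_int z" using p0 by (simp add: field_simps)
    then have "of_int (int t - int c) = (of_int (int p * z) :: real)" by simp
    then have "int t - int c = int p * z" using of_int_eq_iff by blast
    then have "t = c" using small_eq[of t c] t(1) c(1) p_ge_2 by simp
    then show ?thesis using t p0 by (simp add: field_simps power2_eq_square)
  qed
  have gnS: "g i = 1 / real p" if i: "i < N" "i \<notin> S" for i
  proof -
    have "(real p - 1) * g i < 1" using gh[OF i(1)] hnS[OF i] by simp
    moreover have "real p * g i - real c * h i \<in> \<int>" using c(2) i(1) by (simp add: cong_int_def)
    then have "real p * g i \<in> \<int>" using hnS[OF i] by simp
    ultimately have "g i = 0 \<or> g i = 1 / real p"
      using small_multiple_Ints[of "g i" p] p_ge_2 gpos[OF i(1)] by simp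
    moreover have "g i \<noteq> 0"
    proof
      assume 0: "g i = 0"
      obtain r where r: "r \<in> L" "r i \<notin> \<int>" using nondegenerate[OF i(1)] by auto
      from all[OF r(1)] obtain m where "r \<equiv>\<^sub>\<int> f m" by auto
      then show False using r(2) 0 hnS[OF i] i(1) by (auto simp: cong_int_def f_def)
    qed
    ultimately show ?thesis by simp
  qed
  have card_diff: "card ({..<N} - S) = N - p * k" "p * k \<le> N"
    using S cardS card_mono[OF _ S(1)] by (simp_all add: card_Diff_subset)
  have "real (p * k) = (\<Sum>i\<in>S. real c / real (p^2)) + (\<Sum>i\<in>{..<N} - S. 1 / real p)"
    using gsum unfolding split using gS gnS by simp
  also have "\<dots> = real (p * k) * (real c / real (p^2)) + (real N - real (p * k)) / real p"
    using card_diff cardS by (simp add: of_nat_diff)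
  finally have "real p * real (p * k) = real (p * k) * (real c / real p) + (real N - real (p * k))"
    using p0 by (simp add: field_simps power2_eq_square)
  then have "real (p^2 * k + p * k) = real (c * k + N)"
    using p0 by (simp add: field_simps power2_eq_square)
  then have N: "p^2 * k + p * k = c * k + N" using of_nat_eq_iff by blast
  have "c = 0 \<or> c = 1" using gS[OF s(1)] by auto
  then show thesis
  proof
    assume c0: "c = 0"
    have fform: "(\<lambda>i. of_int a * g i + of_int b * h i) \<equiv>\<^sub>\<int>
       (\<lambda>i. if i \<in> S then of_int b / real p else of_int a / real p)" for a b :: int
      using gS gnS hS hnS c0 by (auto simp: cong_int_def)
    show thesis
    proof (rule that(2)[OF S(1) cardS])
      show "N = p^2 * k + p * k" using N c0 by simp
      fix r
      show "r \<in> L \<longleftrightarrow> (\<exists>a b::int. r \<equiv>\<^sub>\<int> (\<lambda>i. if i \<in> S then of_int a / real p else of_int b / real p))"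
      proof
        assume "r \<in> L"
        then obtain m where "r \<equiv>\<^sub>\<int> f m" using all by auto
        then have "r \<equiv>\<^sub>\<int> (\<lambda>i. of_int (int (m div p)) * g i + of_int (int (m mod p)) * h i)"
          by (simp add: f_def)
        from cong_trans[OF this fform]
        show "\<exists>a b::int. r \<equiv>\<^sub>\<int> (\<lambda>i. if i \<in> S then of_int a / real p else of_int b / real p)"
          by blast
      next
        assume "\<exists>a b::int. r \<equiv>\<^sub>\<int> (\<lambda>i. if i \<in> S then of_int a / real p else of_int b / real p)"
        then obtain a b :: int
          where "r \<equiv>\<^sub>\<int> (\<lambda>i. if i \<in> S then of_int a / real p else of_int b / real p)" by blast
        from L_cong[OF L_comb[OF gL hL] cong_trans[OF this cong_sym[OF fform]]] show "r \<in> L" .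
      qed
    qed
  next
    assume c1: "c = 1"
    have gform: "(\<lambda>i. of_int m * g i) \<equiv>\<^sub>\<int>
       (\<lambda>i. of_int m * (if i \<in> S then 1 / real p ^ 2 else 1 / real p))" for m :: int
      using gS gnS c1 by (auto simp: cong_int_def)
    have hg: "h i - real p * g i \<in> \<int>" if "i < N" for i
      using cong_sym[OF c(2)] c1 that by (simp add: cong_int_def)
    show thesis
    proof (rule that(1)[OF S(1) cardS])
      show "N = p^2 * k + (p - 1) * k" using N c1 p_ge_2 by (simp add: algebra_simps)
      fix r
      show "r \<in> L \<longleftrightarrow> (\<exists>m::int. r \<equiv>\<^sub>\<int> (\<lambda>i. of_int m * (if i \<in> S then 1 / real p ^ 2 else 1 / real p)))"
      proof
        assume "r \<in> L"
        then obtain m where m: "r \<equiv>\<^sub>\<int> f m" using all by auto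
        have "f m \<equiv>\<^sub>\<int> (\<lambda>i. of_int (int (m div p + m mod p * p)) * g i)"
          unfolding cong_int_def
        proof (intro allI impI)
          fix i assume "i < N"
          have "f m i - of_int (int (m div p + m mod p * p)) * g i = of_nat (m mod p) * (h i - real p * g i)"
            by (simp add: f_def algebra_simps)
          then show "f m i - of_int (int (m div p + m mod p * p)) * g i \<in> \<int>"
            using hg[OF \<open>i < N\<close>] by (simp add: Ints_mult)
        qed
        from cong_trans[OF cong_trans[OF m this] gform]
        show "\<exists>m::int. r \<equiv>\<^sub>\<int> (\<lambda>i. of_int m * (if i \<in> S then 1 / real p ^ 2 else 1 / real p))"
          by blast
      next
        assume "\<exists>m::int. r \<equiv>\<^sub>\<int> (\<lambda>i. of_int m * (if i \<in> S then 1 / real p ^ 2 else 1 / real p))"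
        then obtain m :: int
          where "r \<equiv>\<^sub>\<int> (\<lambda>i. of_int m * (if i \<in> S then 1 / real p ^ 2 else 1 / real p))" by blast
        from L_cong[OF L_int_scale[OF gL] cong_trans[OF this cong_sym[OF gform]]] show "r \<in> L" .
      qed
    qed
  qed
qed

end

section \<open>From the delta-polynomial to heights\<close>

lemma simplex_vertices_nth:
  fixes vs :: "(real ^ 'n::finite) list"
  assumes "distinct vs" "\<not> affine_dependent (set vs)" "length vs = CARD('n) + 1"
    "set vs \<subseteq> lattice_points"
  shows "simplex_vertices (length vs) ((!) vs)"
proof
  fix i assume "i < length vs" then show "vs ! i \<in> lattice_points" using assms(4) nth_mem by blast
next
  fix r i assume r: "(\<Sum>i<length vs. r i *\<^sub>R (vs ! i, 1 :: real)) = 0" and i: "i < length vs"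
  have bij: "bij_betw ((!) vs) {..<length vs} (set vs)"
    using assms(1) by (intro bij_betw_nth) auto
  define u where "u = (\<lambda>x. r (inv_into {..<length vs} ((!) vs) x))"
  have u: "u (vs ! i) = r i" if "i < length vs" for i
    using that bij by (simp add: u_def bij_betw_def)
  have "(\<Sum>i<length vs. r i) = 0" "(\<Sum>i<length vs. r i *\<^sub>R vs ! i) = 0"
    using r by (simp_all add: sum_prod scaleR_prod_def zero_prod_def)
  then have "sum u (set vs) = 0" "(\<Sum>x\<in>set vs. u x *\<^sub>R x) = 0"
    using u by (simp_all flip: sum.reindex_bij_betw[OF bij])
  then have "\<forall>x\<in>set vs. u x = 0"
    using assms(2) affine_dependent_explicit_finite[of "set vs"] by auto
  then show "r i = 0" using u[OF i] i nth_mem by metis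
qed (use assms in auto)

lemma bij_betw_if_card_fibres:
  assumes "finite A" "\<And>m. card {x \<in> A. f x = m} = (if m \<in> B then 1 else 0)"
  shows "bij_betw f A B"
  unfolding bij_betw_def
proof
  show "inj_on f A"
  proof (rule inj_onI)
    fix x y assume xy: "x \<in> A" "y \<in> A" "f x = f y"
    have "card {z \<in> A. f z = f x} \<le> 1" using assms(2)[of "f x"] by simp
    then show "x = y" using xy card_le_Suc0_iff_eq[of "{z \<in> A. f z = f x}"] assms(1) by auto
  qed
  have "m \<in> f ` A \<longleftrightarrow> m \<in> B" for m
  proof -
    have "m \<in> f ` A \<longleftrightarrow> {x \<in> A. f x = m} \<noteq> {}" by auto
    also have "\<dots> \<longleftrightarrow> card {x \<in> A. f x = m} \<noteq> 0" using assms(1) by simp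
    finally show ?thesis using assms(2)[of m] by auto
  qed
  then show "f ` A = B" by blast
qed

lemma coeff_sum_monom_multiples:
  assumes "k > 0"
  shows "coeff (\<Sum>j = 0..n. monom (1::int) (j * k)) m = (if m \<in> (\<lambda>j. j * k) ` {..n} then 1 else 0)"
proof (cases "m \<in> (\<lambda>j. j * k) ` {..n}")
  case True
  then obtain j0 where j0: "j0 \<le> n" "m = j0 * k" by auto
  have "coeff (\<Sum>j = 0..n. monom (1::int) (j * k)) m = (\<Sum>j = 0..n. if j = j0 then 1 else 0)"
    unfolding coeff_sum using assms j0 by (intro sum.cong) auto
  then show ?thesis using j0 True by simp
next
  case False
  then have "coeff (\<Sum>j = 0..n. monom (1::int) (j * k)) m = 0"
    unfolding coeff_sum by (intro sum.neutral) auto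
  then show ?thesis using False by simp
qed

text \<open>
Every coefficient of the \<open>\<delta>\<close>-polynomial counts the elements of the cell of that degree; as the coefficients
are 1 at the multiples \<open>j k\<close> with \<open>j < p\<^sup>2\<close> and 0 elsewhere, the degree is a bijection.
\<close>

lemma height_graded_lattice_of_delta_polynomial:
  fixes v :: "nat \<Rightarrow> real ^ 'n::{finite, linorder}"
  assumes p: "prime p" and k: "k > 0" and v: "simplex_vertices N v"
    and delta: "has_delta_polynomial (convex hull (v ` {..<N})) (\<Sum>j = 0..p^2 - 1. monom 1 (j * k))"
    and no_pyramid: "\<not> (\<exists>m < CARD('n). \<exists>P. lattice_pyramid_over m P (convex hull (v ` {..<N})))"
  shows "height_graded_lattice N p k (integral_relations N v)"
proof -
  interpret simplex_vertices N v by (rule v)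
  have p0: "p^2 > 0" using prime_gt_0_nat[OF p] by simp
  show ?thesis
  proof
    have "int (card {s \<in> cell. cell_degree s = m})
        = int (if m \<in> (\<lambda>j. j * k) ` {..<p^2} then 1 else 0)" for m
    proof -
      have "p^2 = Suc (p^2 - 1)" using p0 by simp
      then have "{..p^2 - 1} = {..<p^2}" by (metis lessThan_Suc_atMost)
      then show ?thesis
        using coeff_delta_polynomial[OF delta, of m] coeff_sum_monom_multiples[OF k, of "p^2 - 1" m] by simp
    qed
    then have "bij_betw cell_degree cell ((\<lambda>j. j * k) ` {..<p^2})"
      by (intro bij_betw_if_card_fibres finite_cell) (simp only: of_nat_eq_iff)
    moreover have "bij_betw real ((\<lambda>j. j * k) ` {..<p^2}) (real ` (\<lambda>j. j * k) ` {..<p^2})"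
      by (intro inj_on_imp_bij_betw) (simp add: inj_on_def)
    ultimately have "bij_betw (real \<circ> cell_degree) cell (real ` (\<lambda>j. j * k) ` {..<p^2})"
      by (rule bij_betw_trans)
    then have "bij_betw (\<lambda>r. \<Sum>i<N. r i) cell (real ` (\<lambda>j. j * k) ` {..<p^2})"
      by (rule bij_betw_cong[THEN iffD1, rotated]) (simp add: cell_degree)
    then show "bij_betw (\<lambda>r. \<Sum>i<N. r i) {r \<in> L. (\<forall>i<N. 0 \<le> r i \<and> r i < 1) \<and> (\<forall>i\<ge>N. r i = 0)}
        ((\<lambda>j. real (j * k)) ` {..<p^2})"
      by (simp add: cell_def image_image)
    show "\<exists>r\<in>L. r i \<notin> \<int>" if "i < N" for i
      using lattice_pyramid_if_integral_coordinate[OF v that] no_pyramid by blast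
  qed (use p k L_diff L_int in auto)
qed

section \<open>Generators of the group Lambda\<close>

lemma permutation_matching_subsets:
  assumes "S \<subseteq> {..<N}" "T \<subseteq> {..<N}" "card S = card T"
  obtains \<pi> where "\<pi> permutes {..<N::nat}" "\<And>i. i < N \<Longrightarrow> \<pi> i \<in> T \<longleftrightarrow> i \<in> S"
proof -
  have fin: "finite S" "finite T" using assms finite_subset by auto
  have "card ({..<N} - S) = card ({..<N} - T)" using assms fin by (simp add: card_Diff_subset)
  then obtain g where g: "bij_betw g ({..<N} - S) ({..<N} - T)"
    using finite_same_card_bij[of "{..<N} - S" "{..<N} - T"] by auto
  obtain f where f: "bij_betw f S T" using finite_same_card_bij fin assms(3) by blast
  define \<pi> where "\<pi> = (\<lambda>i. if i \<in> S then f i else if i < N then g i else i)"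
  have "bij_betw \<pi> S T" using f by (rule bij_betw_cong[THEN iffD1, rotated]) (simp add: \<pi>_def)
  moreover have "bij_betw \<pi> ({..<N} - S) ({..<N} - T)"
    using g by (rule bij_betw_cong[THEN iffD1, rotated]) (auto simp: \<pi>_def)
  ultimately have "bij_betw \<pi> (S \<union> ({..<N} - S)) (T \<union> ({..<N} - T))"
    by (rule bij_betw_combine) auto
  then have "bij_betw \<pi> {..<N} {..<N}" using assms(1,2) by (simp add: Un_absorb1)
  then have "\<pi> permutes {..<N}"
    by (rule bij_imp_permutes) (use assms(1) in \<open>auto simp: \<pi>_def\<close>)
  moreover have "\<pi> i \<in> T \<longleftrightarrow> i \<in> S" if "i < N" for i
    using f g that by (auto simp: \<pi>_def bij_betw_def)
  ultimately show ?thesis by (rule that)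
qed

lemma all_less_permutes:
  assumes "\<pi> permutes {..<N::nat}"
  shows "(\<forall>i<N. P (\<pi> i)) \<longleftrightarrow> (\<forall>i<N. P i)"
proof -
  have "(\<forall>i\<in>{..<N}. P (\<pi> i)) \<longleftrightarrow> (\<forall>i\<in>\<pi> ` {..<N}. P i)" by blast
  then show ?thesis unfolding permutes_image[OF assms] by (simp add: Ball_def)
qed

definition torus_point :: "nat \<Rightarrow> (nat \<Rightarrow> real) \<Rightarrow> real_mod_int list" where
  "torus_point N r = map (\<lambda>i. real_mod_int (r i)) [0..<N]"

lemma real_mod_int_eq_iff: "real_mod_int x = real_mod_int y \<longleftrightarrow> x - y \<in> \<int>"
  by (rule real_mod_int.abs_eq_iff)

lemma torus_point_eq_iff: "torus_point N r = torus_point N s \<longleftrightarrow> (\<forall>i<N. r i - s i \<in> \<int>)"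
  by (auto simp: torus_point_def real_mod_int_eq_iff)

lemma torus_point_in_carrier: "torus_point N r \<in> carrier (torus N)"
  by (simp add: torus_def torus_point_def)

lemma torus_point_mult:
  "torus_point N r \<otimes>\<^bsub>torus N\<^esub> torus_point N s = torus_point N (\<lambda>i. r i + s i)"
  by (auto simp: torus_def torus_point_def plus_real_mod_int.abs_eq intro!: nth_equalityI)

lemma torus_point_one: "\<one>\<^bsub>torus N\<^esub> = torus_point N (\<lambda>i. 0)"
  by (auto simp: torus_def torus_point_def zero_real_mod_int_def intro!: nth_equalityI)

lemma torus_point_inv: "inv\<^bsub>torus N\<^esub> (torus_point N r) = torus_point N (\<lambda>i. - r i)"
  by (rule group.inv_equality[OF group_torus])
    (simp_all add: torus_point_in_carrier torus_point_mult torus_point_one)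

lemma subgroup_torus_int_multiple:
  assumes "subgroup H (torus N)" "torus_point N r \<in> H"
  shows "torus_point N (\<lambda>i. of_int a * r i) \<in> H"
proof (induction a rule: int_induct[where k = 0])
  case base
  show ?case using subgroup.one_closed[OF assms(1)] by (simp add: torus_point_one)
next
  case (step1 a)
  have "torus_point N (\<lambda>i. of_int a * r i) \<otimes>\<^bsub>torus N\<^esub> torus_point N r \<in> H"
    using subgroup.m_closed[OF assms(1)] step1 assms(2) by blast
  then show ?case by (simp add: torus_point_mult algebra_simps)
next
  case (step2 a)
  have "torus_point N (\<lambda>i. of_int a * r i) \<otimes>\<^bsub>torus N\<^esub> inv\<^bsub>torus N\<^esub> (torus_point N r) \<in> H"
    using subgroup.m_closed[OF assms(1)] subgroup.m_inv_closed[OF assms(1)] step2 assms(2) by blast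
  then show ?case by (simp add: torus_point_mult torus_point_inv algebra_simps)
qed

text \<open>
Two points cover both kinds of matrices in the classification: a single row is the case of equal points.
\<close>

lemma generate_torus_two_points:
  "generate (torus N) {torus_point N g, torus_point N h} =
     {torus_point N (\<lambda>i. of_int a * g i + of_int b * h i) | a b :: int. True}"
  (is "?G = ?R")
proof (intro subset_antisym subsetI)
  fix x assume "x \<in> ?G"
  then show "x \<in> ?R"
  proof (induction rule: generate.induct)
    case one
    have "torus_point N (\<lambda>i. 0) = torus_point N (\<lambda>i. of_int 0 * g i + of_int 0 * h i)" by simp
    then show ?case unfolding torus_point_one by blast
  next
    case (incl x)
    have "torus_point N g = torus_point N (\<lambda>i. of_int 1 * g i + of_int 0 * h i)"
      "torus_point N h = torus_point N (\<lambda>i. of_int 0 * g i + of_int 1 * h i)" by simp_all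
    then show ?case using incl by blast
  next
    case (inv x)
    have "inv\<^bsub>torus N\<^esub> (torus_point N g) = torus_point N (\<lambda>i. of_int (-1) * g i + of_int 0 * h i)"
      "inv\<^bsub>torus N\<^esub> (torus_point N h) = torus_point N (\<lambda>i. of_int 0 * g i + of_int (-1) * h i)"
      by (simp_all add: torus_point_inv)
    then show ?case using inv by blast
  next
    case (eng x y)
    then obtain a b a' b' where
      "x = torus_point N (\<lambda>i. of_int a * g i + of_int b * h i)"
      "y = torus_point N (\<lambda>i. of_int a' * g i + of_int b' * h i)" by blast
    then have "x \<otimes>\<^bsub>torus N\<^esub> y = torus_point N (\<lambda>i. of_int (a + a') * g i + of_int (b + b') * h i)"
      by (simp add: torus_point_mult algebra_simps)
    then show ?case by blast
  qed
next
  fix x assume "x \<in> ?R"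
  then obtain a b :: int where x: "x = torus_point N (\<lambda>i. of_int a * g i + of_int b * h i)" by blast
  have H: "subgroup ?G (torus N)"
    by (rule group.generate_is_subgroup[OF group_torus]) (simp add: torus_point_in_carrier)
  have "torus_point N g \<in> ?G" "torus_point N h \<in> ?G" by (auto intro: generate.incl)
  then have "torus_point N (\<lambda>i. of_int a * g i) \<otimes>\<^bsub>torus N\<^esub> torus_point N (\<lambda>i. of_int b * h i) \<in> ?G"
    using subgroup.m_closed[OF H] subgroup_torus_int_multiple[OF H] by blast
  then show "x \<in> ?G" by (simp add: torus_point_mult x)
qed

lemma Lambda_eq_torus_points:
  "Lambda vs = torus_point (length vs) ` integral_relations (length vs) ((!) vs)"
proof (intro subset_antisym subsetI)
  fix x assume "x \<in> Lambda vs"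
  then obtain rs where rs: "x = map real_mod_int rs" "length rs = length vs"
    "(\<Sum>i<length vs. (rs ! i) *\<^sub>R (vs ! i, 1 :: real)) \<in> lattice_points \<times> \<int>"
    by (auto simp: Lambda_def)
  have "x = torus_point (length vs) ((!) rs)"
    using rs(1,2) by (auto simp: torus_point_def intro!: nth_equalityI)
  moreover have "(!) rs \<in> integral_relations (length vs) ((!) vs)"
    using rs(3) by (simp add: integral_relations_def)
  ultimately show "x \<in> torus_point (length vs) ` integral_relations (length vs) ((!) vs)" by blast
next
  fix x assume "x \<in> torus_point (length vs) ` integral_relations (length vs) ((!) vs)"
  then obtain r where r: "x = torus_point (length vs) r" "r \<in> integral_relations (length vs) ((!) vs)"
    by blast
  have "x = map real_mod_int (map r [0..<length vs])" by (simp add: r(1) torus_point_def)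
  moreover have "(\<Sum>i<length vs. (map r [0..<length vs] ! i) *\<^sub>R (vs ! i, 1 :: real)) \<in> lattice_points \<times> \<int>"
    using r(2) by (simp add: integral_relations_def)
  ultimately show "x \<in> Lambda vs"
    unfolding Lambda_def by (intro CollectI exI[of _ "map r [0..<length vs]"]) simp
qed

lemma permute_torus_point:
  assumes "\<sigma> permutes {..<N}"
  shows "permute_list \<sigma> (torus_point N r) = torus_point N (\<lambda>i. r (\<sigma> i))"
  using permutes_in_image[OF assms]
  by (auto simp: permute_list_def torus_point_def intro!: nth_equalityI)

lemma Lambda_generated_by_rowsI:
  assumes N: "length vs = N" and \<sigma>: "\<sigma> permutes {..<N}"
    and rows: "set M = {torus_point N g, torus_point N h}"
    and rel: "\<And>r. r \<in> integral_relations N ((!) vs) \<longleftrightarrow>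
      (\<exists>a b::int. \<forall>i<N. r i - (of_int a * g (\<sigma> i) + of_int b * h (\<sigma> i)) \<in> \<int>)"
  shows "Lambda_generated_by_rows vs M"
proof -
  have "generate (torus N) (permute_list \<sigma> ` set M)
      = {torus_point N (\<lambda>i. of_int a * g (\<sigma> i) + of_int b * h (\<sigma> i)) | a b :: int. True}"
    using generate_torus_two_points[of N "\<lambda>i. g (\<sigma> i)" "\<lambda>i. h (\<sigma> i)"]
    by (simp add: rows permute_torus_point[OF \<sigma>])
  also have "\<dots> = torus_point N ` integral_relations N ((!) vs)"
  proof (intro subset_antisym subsetI)
    fix x
    assume "x \<in> {torus_point N (\<lambda>i. of_int a * g (\<sigma> i) + of_int b * h (\<sigma> i)) | a b :: int. True}"
    then obtain a b :: int
      where x: "x = torus_point N (\<lambda>i. of_int a * g (\<sigma> i) + of_int b * h (\<sigma> i))" by blast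
    have "(\<lambda>i. of_int a * g (\<sigma> i) + of_int b * h (\<sigma> i)) \<in> integral_relations N ((!) vs)"
      unfolding rel by (rule exI[of _ a], rule exI[of _ b]) simp
    then show "x \<in> torus_point N ` integral_relations N ((!) vs)" using x by blast
  next
    fix x assume "x \<in> torus_point N ` integral_relations N ((!) vs)"
    then obtain r where "x = torus_point N r" "r \<in> integral_relations N ((!) vs)" by blast
    moreover from this obtain a b :: int
      where "\<forall>i<N. r i - (of_int a * g (\<sigma> i) + of_int b * h (\<sigma> i)) \<in> \<int>"
      unfolding rel by blast
    ultimately have "x = torus_point N (\<lambda>i. of_int a * g (\<sigma> i) + of_int b * h (\<sigma> i))"
      by (simp add: torus_point_eq_iff)
    then show "x \<in> {torus_point N (\<lambda>i. of_int a * g (\<sigma> i) + of_int b * h (\<sigma> i)) | a b :: int. True}"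
      by blast
  qed
  finally have "generate (torus N) (permute_list \<sigma> ` set M) = Lambda vs"
    by (simp add: Lambda_eq_torus_points N)
  moreover have "\<forall>row\<in>set M. length row = length vs" by (simp add: rows N torus_point_def)
  ultimately show ?thesis using \<sigma> N by (auto simp: Lambda_generated_by_rows_def)
qed

lemma Lambda_generated_by_single_rowI:
  assumes N: "length vs = N" and \<sigma>: "\<sigma> permutes {..<N}"
    and rel: "\<And>r. r \<in> integral_relations N ((!) vs) \<longleftrightarrow>
      (\<exists>m::int. \<forall>i<N. r i - of_int m * g (\<sigma> i) \<in> \<int>)"
  shows "Lambda_generated_by_rows vs [torus_point N g]"
proof (rule Lambda_generated_by_rowsI[OF N \<sigma>, where g = g and h = g])
  fix r
  have "(\<exists>m::int. \<forall>i<N. r i - of_int m * g (\<sigma> i) \<in> \<int>) \<longleftrightarrow>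
      (\<exists>a b::int. \<forall>i<N. r i - of_int (a + b) * g (\<sigma> i) \<in> \<int>)"
    by (metis add.right_neutral)
  then show "r \<in> integral_relations N ((!) vs) \<longleftrightarrow>
      (\<exists>a b::int. \<forall>i<N. r i - (of_int a * g (\<sigma> i) + of_int b * g (\<sigma> i)) \<in> \<int>)"
    unfolding rel by (simp add: distrib_right)
qed simp

lemma two_blocks_torus_point:
  "replicate a (real_mod_int x) @ replicate b (real_mod_int y)
     = torus_point (a + b) (\<lambda>i. if i < a then x else y)"
  by (auto simp: torus_point_def nth_append intro!: nth_equalityI)

section \<open>Recognising Delta(A) and Delta(B, C)\<close>

text \<open>
Bounds the denominators in a relation, as required for \<open>simplex_vertices_if_discrete\<close>.
\<close>

lemma torsion_if_cong:
  fixes x t :: real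
  assumes "x - t \<in> \<int>" "real m * t \<in> \<int>"
  shows "real m * x \<in> \<int>"
proof -
  have "real m * (x - t) + real m * t \<in> \<int>" by (intro Ints_add Ints_mult assms Ints_of_nat)
  then show ?thesis by (simp add: algebra_simps)
qed

text \<open>
The simplex does not depend on the order of its vertices, so the vertices \<open>w\<close> may be renumbered until the
relations agree.
\<close>

lemma unimodularly_equivalent_if_same_relations_permuted:
  fixes v w :: "nat \<Rightarrow> real ^ 'n::finite"
  assumes v: "simplex_vertices N v" and w: "\<And>i. w i \<in> lattice_points"
    and \<pi>: "\<pi> permutes {..<N}"
    and rel: "\<And>r. (\<lambda>i. r (\<pi> i)) \<in> integral_relations N v \<longleftrightarrow> r \<in> integral_relations N w"
    and m: "m \<noteq> 0" "\<And>r i. r \<in> integral_relations N w \<Longrightarrow> i < N \<Longrightarrow> real m * r i \<in> \<int>"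
  shows "unimodularly_equivalent (convex hull (v ` {..<N})) (convex hull (w ` {..<N}))"
proof -
  have N: "N = CARD('n) + 1" by (rule simplex_vertices.N[OF v])
  let ?w = "\<lambda>i. w (\<pi> i)"
  let ?\<rho> = "inv_into UNIV \<pi>"
  have eq: "integral_relations N v = integral_relations N ?w"
  proof (rule Set.set_eqI)
    fix r :: "nat \<Rightarrow> real"
    define s where "s = (\<lambda>i. r (?\<rho> i))"
    have s: "s (\<pi> i) = r i" for i
      using permutes_inj[OF \<pi>] by (simp add: s_def)
    have "r \<in> integral_relations N v \<longleftrightarrow> (\<lambda>i. s (\<pi> i)) \<in> integral_relations N v" by (simp add: s)
    also have "\<dots> \<longleftrightarrow> s \<in> integral_relations N w" by (rule rel)
    also have "\<dots> \<longleftrightarrow> r \<in> integral_relations N ?w"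
      unfolding integral_relations_def
      using sum.permute[OF \<pi>, of "\<lambda>i. s i *\<^sub>R (w i, 1 :: real)"] by (simp add: comp_def s)
    finally show "r \<in> integral_relations N v \<longleftrightarrow> r \<in> integral_relations N ?w" .
  qed
  have "simplex_vertices N w" 
    by (rule simplex_vertices_if_discrete[of N w m]; (assumption | rule N w m)+)
  then have "simplex_vertices N ?w"
  proof (intro simplex_vertices.intro N w)
    fix r i assume sw: "simplex_vertices N w" and r: "(\<Sum>i<N. r i *\<^sub>R (w (\<pi> i), 1 :: real)) = 0" "i < N"
    define s where "s = (\<lambda>i. r (?\<rho> i))"
    have s: "s (\<pi> i) = r i" for i
      using permutes_inj[OF \<pi>] by (simp add: s_def)
    have "(\<Sum>i<N. s i *\<^sub>R (w i, 1 :: real)) = 0"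
      using sum.permute[OF \<pi>, of "\<lambda>i. s i *\<^sub>R (w i, 1 :: real)"] r(1) by (simp add: comp_def s)
    then have "s (\<pi> i) = 0"
      using simplex_vertices.indep[OF sw] permutes_in_image[OF \<pi>, of i] r(2) by auto
    then show "r i = 0" by (simp add: s)
  qed
  from unimodularly_equivalent_if_same_relations[OF v this eq]
  have "unimodularly_equivalent (convex hull (v ` {..<N})) (convex hull (w ` \<pi> ` {..<N}))"
    by (simp add: image_image)
  then show ?thesis by (simp add: permutes_image[OF \<pi>])
qed

lemma sum_two_values:
  assumes "T \<subseteq> {..<N::nat}"
  shows "(\<Sum>i<N. if i \<in> T then x else y :: int) = int (card T) * x + int (N - card T) * y"
proof -
  have "finite T" using assms finite_subset by blast
  have "(\<Sum>i<N. if i \<in> T then x else y) = (\<Sum>i\<in>{..<N} \<inter> T. x) + (\<Sum>i\<in>{..<N} - T. y)"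
    by (simp add: sum.If_cases Diff_eq)
  moreover have "{..<N} \<inter> T = T" using assms by auto
  ultimately show ?thesis using \<open>finite T\<close> assms by (simp add: card_Diff_subset)
qed

lemma four_le_sq_times:
  assumes "(p::nat) \<ge> 2" "k > 0"
  shows "p^2 * k \<ge> 4"
proof -
  have "2 * 2 * 1 \<le> p * p * k" using assms by (intro mult_le_mono) auto
  then show ?thesis by (simp add: power2_eq_square)
qed

lemma equivalent_Delta_A:
  fixes v :: "nat \<Rightarrow> real ^ 'n::{finite, linorder}" and c :: "nat \<Rightarrow> int"
  assumes v: "simplex_vertices N v" and A: "length A = CARD('n)" and \<pi>: "\<pi> permutes {..<N}"
    and M: "M = A ! (length A - 1)" "M > 0"
    and c: "c (length A) = 1" "\<And>j. 1 \<le> j \<Longrightarrow> j < length A \<Longrightarrow> c j = A ! (j - 1)" "M dvd (\<Sum>i<N. c i)"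
    and rel: "\<And>r. r \<in> integral_relations N v \<longleftrightarrow>
      (\<exists>m::int. \<forall>i<N. r i - of_int m * of_int (c (\<pi> i)) / of_int M \<in> \<int>)"
  shows "unimodularly_equivalent (convex hull (v ` {..<N})) (Delta_A A)"
proof -
  have N: "N = length A + 1" using simplex_vertices.N[OF v] A by simp
  let ?w = "Delta_A_vertex A :: nat \<Rightarrow> (real, 'n) vec"
  have relw: "r \<in> integral_relations N ?w \<longleftrightarrow>
      (\<exists>m::int. \<forall>i<N. r i - of_int m * of_int (c i) / of_int M \<in> \<int>)" for r
    using M(2) by (intro integral_relations_Delta_A[OF A N M(1) _ c]) simp
  have "unimodularly_equivalent (convex hull (v ` {..<N})) (convex hull (?w ` {..<N}))"
  proof (rule unimodularly_equivalent_if_same_relations_permuted[OF v _ \<pi>, where m = "nat M"])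
    show "?w i \<in> lattice_points" for i by (rule Delta_A_vertex_lattice[OF A])
    show "(\<lambda>i. r (\<pi> i)) \<in> integral_relations N v \<longleftrightarrow> r \<in> integral_relations N ?w" for r
    proof -
      have "(\<forall>i<N. r (\<pi> i) - of_int m * of_int (c (\<pi> i)) / of_int M \<in> \<int>) \<longleftrightarrow>
          (\<forall>i<N. r i - of_int m * of_int (c i) / of_int M \<in> \<int>)" for m :: int
        by (rule all_less_permutes[OF \<pi>])
      then show ?thesis unfolding rel relw by simp
    qed
    show "real (nat M) * r i \<in> \<int>" if r: "r \<in> integral_relations N ?w" and "i < N" for r i
    proof -
      obtain m :: int where "r i - of_int m * of_int (c i) / of_int M \<in> \<int>"
        using r \<open>i < N\<close> unfolding relw by blast
      then show ?thesis by (rule torsion_if_cong) (use M(2) in simp)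
    qed
  qed (use M(2) in simp)
  moreover have "length A \<ge> 1" using A by (simp add: Suc_leI)
  then have "Delta_A A = convex hull (?w ` {..<N})" unfolding N by (rule Delta_A_eq)
  ultimately show ?thesis by simp
qed

lemma equivalent_Delta_BC:
  fixes v :: "nat \<Rightarrow> real ^ 'n::{finite, linorder}"
  assumes p: "p \<ge> 2" and k: "k > 0" and v: "simplex_vertices N v" and N: "N = p^2 * k + p * k"
    and B: "B = replicate (p * k - 1) 1 @ [int p]"
    and C: "C = replicate (p * k) (int p) @ replicate (p^2 * k - 2) 1 @ [int p]"
    and \<pi>: "\<pi> permutes {..<N}"
    and rel: "\<And>r. r \<in> integral_relations N v \<longleftrightarrow>
      (\<exists>a b::int. \<forall>i<N. r i - (if \<pi> i \<in> {1..p * k} then of_int a / real p else of_int b / real p) \<in> \<int>)"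
  shows "unimodularly_equivalent (convex hull (v ` {..<N})) (Delta_BC B C)" and "length C = CARD('n)"
proof -
  have card: "CARD('n) = p^2 * k + p * k - 1" using simplex_vertices.N[OF v] N by simp
  have pk: "p * k \<ge> 1" using p k by (simp add: Suc_leI)
  note p2k = four_le_sq_times[OF p k]
  have len: "length B = p * k" "length C = p^2 * k + p * k - 1" using pk p2k by (auto simp: B C)
  show lenC: "length C = CARD('n)" using len card by simp
  have lenB: "length B \<ge> 1" "length B < length C" using len pk p2k by auto
  let ?w = "Delta_BC_vertex B C :: nat \<Rightarrow> (real, 'n) vec"
  have relw: "r \<in> integral_relations N ?w \<longleftrightarrow>
      (\<exists>a b::int. \<forall>i<N. r i - (if i \<in> {1..p * k} then of_int a / real p else of_int b / real p) \<in> \<int>)" for r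
    using p by (intro integral_relations_Delta_BC[OF _ k card N B C]) auto
  have "unimodularly_equivalent (convex hull (v ` {..<N})) (convex hull (?w ` {..<N}))"
  proof (rule unimodularly_equivalent_if_same_relations_permuted[OF v _ \<pi>, where m = p])
    show "?w i \<in> lattice_points" for i by (rule Delta_BC_vertex_lattice[OF lenB lenC])
    show "(\<lambda>i. r (\<pi> i)) \<in> integral_relations N v \<longleftrightarrow> r \<in> integral_relations N ?w" for r
    proof -
      have "(\<forall>i<N. r (\<pi> i) - (if \<pi> i \<in> {1..p * k} then of_int a / real p else of_int b / real p) \<in> \<int>) \<longleftrightarrow>
          (\<forall>i<N. r i - (if i \<in> {1..p * k} then of_int a / real p else of_int b / real p) \<in> \<int>)" for a b :: int
        by (rule all_less_permutes[OF \<pi>])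
      then show ?thesis unfolding rel relw by simp
    qed
    show "real p * r i \<in> \<int>" if r: "r \<in> integral_relations N ?w" and "i < N" for r i
    proof -
      obtain a b :: int
        where "r i - (if i \<in> {1..p * k} then of_int a / real p else of_int b / real p) \<in> \<int>"
        using r \<open>i < N\<close> unfolding relw by blast
      then show ?thesis by (rule torsion_if_cong) (use p in simp)
    qed
  qed (use p in simp)
  moreover have "N = length C + 1" using len N p2k by simp
  then have "Delta_BC B C = convex hull (?w ` {..<N})" using Delta_BC_eq[OF lenB] by simp
  ultimately show "unimodularly_equivalent (convex hull (v ` {..<N})) (Delta_BC B C)" by simp
qed

lemma simplex_of_constant_relations:
  fixes vs :: "(real ^ 'n::{finite, linorder}) list"
  assumes p: "p \<ge> 2" and k: "k > 0" and len: "length vs = N"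
    and v: "simplex_vertices N ((!) vs)" and N: "N = p^2 * k"
    and rel: "\<And>r. r \<in> integral_relations N ((!) vs) \<longleftrightarrow>
        (\<exists>m::int. \<forall>i<N. r i - of_int m / real p ^ 2 \<in> \<int>)"
    and A: "A = replicate (p^2 * k - 2) 1 @ [int p ^ 2]"
  shows "Lambda_generated_by_rows vs [replicate (p^2 * k) (real_mod_int (1 / real p ^ 2))]"
    and "unimodularly_equivalent (convex hull ((!) vs ` {..<N})) (Delta_A A)"
    and "length A = CARD('n)"
proof -
  note p2k = four_le_sq_times[OF p k]
  have lenA: "length A = p^2 * k - 1" using p2k by (simp add: A)
  then show cardA: "length A = CARD('n)" using simplex_vertices.N[OF v] N by simp
  have id: "(\<lambda>i. i) permutes {..<N}" using permutes_id by (simp add: id_def)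
  have "replicate (p^2 * k) (real_mod_int (1 / real p ^ 2)) = torus_point N (\<lambda>i. 1 / real p ^ 2)"
    by (auto simp: N torus_point_def intro!: nth_equalityI)
  moreover have "Lambda_generated_by_rows vs [torus_point N (\<lambda>i. 1 / real p ^ 2)]"
    using rel by (intro Lambda_generated_by_single_rowI[OF len id]) simp
  ultimately show "Lambda_generated_by_rows vs [replicate (p^2 * k) (real_mod_int (1 / real p ^ 2))]"
    by simp
  show "unimodularly_equivalent (convex hull ((!) vs ` {..<N})) (Delta_A A)"
  proof (rule equivalent_Delta_A[OF v cardA id, where M = "int p ^ 2" and c = "\<lambda>i. 1"])
    show "int p ^ 2 = A ! (length A - 1)" 
    proof -
      have "A ! (p^2 * k - 2) = int p ^ 2" by (simp add: A nth_append)
      moreover have "length A - 1 = p^2 * k - 2" by (simp add: lenA)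
      ultimately show ?thesis by simp
    qed
    show "1 = A ! (j - 1)" if "1 \<le> j" "j < length A" for j
      using that by (simp add: lenA) (simp add: A nth_append)
  qed (use p rel in \<open>auto simp: N\<close>)
qed

text \<open>
Over the denominator \<open>p\<^sup>2\<close> the generator has numerator 1 on \<open>S\<close> and \<open>p\<close> elsewhere. In \<open>\<Delta>(A)\<close> the numerator at
index \<open>j\<close> is the \<open>j\<close>-th entry of \<open>A\<close>, except that it is 1 at the last vertex and \<open>p\<close> at the origin.
\<close>

lemma simplex_of_mixed_relations:
  fixes vs :: "(real ^ 'n::{finite, linorder}) list"
  assumes p: "p \<ge> 2" and k: "k > 0" and len: "length vs = N"
    and v: "simplex_vertices N ((!) vs)" and N: "N = p^2 * k + (p - 1) * k"
    and S: "S \<subseteq> {..<N}" "card S = p * k"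
    and rel: "\<And>r. r \<in> integral_relations N ((!) vs) \<longleftrightarrow>
        (\<exists>m::int. \<forall>i<N. r i - of_int m * (if i \<in> S then 1 / real p ^ 2 else 1 / real p) \<in> \<int>)"
    and A: "A = replicate (p * k - 1) 1 @ replicate ((p^2 - 1) * k - 1) (int p) @ [int p ^ 2]"
  shows "Lambda_generated_by_rows vs
      [replicate ((p^2 - 1) * k) (real_mod_int (1 / real p)) @
       replicate (p * k) (real_mod_int (1 / real p ^ 2))]"
    and "unimodularly_equivalent (convex hull ((!) vs ` {..<N})) (Delta_A A)"
    and "length A = CARD('n)"
proof -
  note p2k = four_le_sq_times[OF p k]
  have pk: "p * k \<ge> 1" using p k by (simp add: Suc_leI)
  have N_split: "N = (p^2 - 1) * k + p * k"
    using p p2k pk by (simp add: N diff_mult_distrib)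
  have rest: "(p^2 - 1) * k \<ge> 1"
  proof -
    have "p^2 \<ge> 4" using four_le_sq_times[OF p, of 1] by simp
    then have "1 * 1 \<le> (p^2 - 1) * k" using k by (intro mult_le_mono) auto
    then show ?thesis by simp
  qed
  have lenA: "length A = N - 1" using pk rest by (simp add: A N_split)
  show cardA: "length A = CARD('n)" using simplex_vertices.N[OF v] lenA by simp
  show "Lambda_generated_by_rows vs
      [replicate ((p^2 - 1) * k) (real_mod_int (1 / real p)) @
       replicate (p * k) (real_mod_int (1 / real p ^ 2))]"
  proof -
    let ?g = "\<lambda>i. if i < (p^2 - 1) * k then 1 / real p else 1 / real p ^ 2"
    have "card S = card {(p^2 - 1) * k..<N}" by (simp add: S N_split)
    then obtain \<sigma> where \<sigma>: "\<sigma> permutes {..<N}"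
      "\<And>i. i < N \<Longrightarrow> \<sigma> i \<in> {(p^2 - 1) * k..<N} \<longleftrightarrow> i \<in> S"
      using permutation_matching_subsets[OF S(1), of "{(p^2 - 1) * k..<N}"]
      by (metis atLeastLessThan_iff lessThan_iff subsetI)
    have g: "?g (\<sigma> i) = (if i \<in> S then 1 / real p ^ 2 else 1 / real p)" if "i < N" for i
      using \<sigma>(2)[OF that] permutes_in_image[OF \<sigma>(1), of i] that by auto
    have "Lambda_generated_by_rows vs [torus_point N ?g]"
      unfolding N_split[symmetric]
      by (intro Lambda_generated_by_single_rowI[OF len \<sigma>(1)]) (simp only: rel g cong: conj_cong imp_cong)
    then show ?thesis by (simp only: two_blocks_torus_point N_split)
  qed
  \<comment> \<open>the indices of the vertices of \<open>\<Delta>(A)\<close> with numerator 1: the last vertex and the first \<open>p k - 1\<close> unit vectors\<close>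
  define T where "T = insert (N - 1) {1..<p * k}"
  have T: "T \<subseteq> {..<N}" using pk rest by (auto simp: T_def N_split)
  have "p * k \<le> N - 1" using rest unfolding N_split by linarith
  then have "N - 1 \<notin> {1..<p * k}" by simp
  then have cardT: "card T = p * k" using pk by (simp add: T_def)
  obtain \<pi> where \<pi>: "\<pi> permutes {..<N}" "\<And>i. i < N \<Longrightarrow> \<pi> i \<in> T \<longleftrightarrow> i \<in> S"
    using permutation_matching_subsets[OF S(1) T] S(2) cardT by auto
  define c :: "nat \<Rightarrow> int" where "c = (\<lambda>i. if i \<in> T then 1 else int p)"
  show "unimodularly_equivalent (convex hull ((!) vs ` {..<N})) (Delta_A A)"
  proof (rule equivalent_Delta_A[OF v cardA \<pi>(1), where M = "int p ^ 2" and c = c])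
    show "int p ^ 2 = A ! (length A - 1)"
    proof -
      have "length A - 1 = (p * k - 1) + ((p^2 - 1) * k - 1)" using pk rest by (simp add: A)
      then show ?thesis by (simp add: A nth_append)
    qed
    show "c (length A) = 1" by (simp add: c_def T_def lenA)
    show "c j = A ! (j - 1)" if j: "1 \<le> j" "j < length A" for j
    proof (cases "j < p * k")
      case True
      then have "j \<in> T" using j by (simp add: T_def)
      then show ?thesis using True j by (simp add: c_def A nth_append)
    next
      case False
      have "j - 1 - (p * k - 1) < (p^2 - 1) * k - 1" using j False pk rest by (simp add: lenA N_split)
      moreover have "\<not> j - 1 < p * k - 1" using False pk j by simp
      moreover have "j \<noteq> N - 1" using j lenA by simp
      ultimately show ?thesis using False by (simp add: c_def T_def A nth_append)
    qed
    have "(\<Sum>i<N. c i) = int (p * k) + int ((p^2 - 1) * k) * int p"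
      unfolding c_def sum_two_values[OF T] cardT by (simp add: N_split)
    also have "\<dots> = int (p * k + (p^2 - 1) * k * p)" by simp
    also have "p * k + (p^2 - 1) * k * p = p^2 * (p * k)"
    proof -
      obtain q where "p^2 = Suc q" using p by (metis not0_implies_Suc not_numeral_le_zero power_eq_0_iff)
      then show ?thesis by (simp add: algebra_simps)
    qed
    finally show "int p ^ 2 dvd (\<Sum>i<N. c i)" by simp
    show "r \<in> integral_relations N ((!) vs) \<longleftrightarrow>
        (\<exists>m::int. \<forall>i<N. r i - of_int m * of_int (c (\<pi> i)) / of_int (int p ^ 2) \<in> \<int>)" for r
    proof -
      have "of_int m * of_int (c (\<pi> i)) / of_int (int p ^ 2)
          = of_int m * (if i \<in> S then 1 / real p ^ 2 else 1 / real p)" if "i < N" for i and m :: int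
        using \<pi>(2)[OF that] p by (simp add: c_def power2_eq_square)
      then show ?thesis unfolding rel by (simp cong: imp_cong)
    qed
  qed (use p in simp)
qed

lemma simplex_of_block_relations:
  fixes vs :: "(real ^ 'n::{finite, linorder}) list"
  assumes p: "p \<ge> 2" and k: "k > 0" and len: "length vs = N"
    and v: "simplex_vertices N ((!) vs)" and N: "N = p^2 * k + p * k"
    and S: "S \<subseteq> {..<N}" "card S = p * k"
    and rel: "\<And>r. r \<in> integral_relations N ((!) vs) \<longleftrightarrow>
        (\<exists>a b::int. \<forall>i<N. r i - (if i \<in> S then of_int a / real p else of_int b / real p) \<in> \<int>)"
    and B: "B = replicate (p * k - 1) 1 @ [int p]"
    and C: "C = replicate (p * k) (int p) @ replicate (p^2 * k - 2) 1 @ [int p]"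
  shows "Lambda_generated_by_rows vs
      [replicate (p * k) (real_mod_int (1 / real p)) @ replicate (p^2 * k) 0,
       replicate (p * k) 0 @ replicate (p^2 * k) (real_mod_int (1 / real p))]"
    and "unimodularly_equivalent (convex hull ((!) vs ` {..<N})) (Delta_BC B C)"
    and "length C = CARD('n)"
proof -
  have N': "p * k + p^2 * k = N" by (simp add: N)
  show "Lambda_generated_by_rows vs
      [replicate (p * k) (real_mod_int (1 / real p)) @ replicate (p^2 * k) 0,
       replicate (p * k) 0 @ replicate (p^2 * k) (real_mod_int (1 / real p))]"
  proof -
    let ?g = "\<lambda>i. if i < p * k then 1 / real p else 0"
    let ?h = "\<lambda>i. if i < p * k then 0 else 1 / real p"
    obtain \<sigma> where \<sigma>: "\<sigma> permutes {..<N}" "\<And>i. i < N \<Longrightarrow> \<sigma> i \<in> {..<p * k} \<longleftrightarrow> i \<in> S"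
      using permutation_matching_subsets[OF S(1), of "{..<p * k}"] S(2) by (auto simp: N)
    have gh: "of_int a * ?g (\<sigma> i) + of_int b * ?h (\<sigma> i)
        = (if i \<in> S then of_int a / real p else of_int b / real p)" if "i < N" for i and a b :: int
      using \<sigma>(2)[OF that] by auto
    have zero: "(0 :: real_mod_int) = real_mod_int 0" by (simp add: zero_real_mod_int_def)
    show ?thesis
    proof (rule Lambda_generated_by_rowsI[OF len \<sigma>(1), where g = ?g and h = ?h])
      show "set [replicate (p * k) (real_mod_int (1 / real p)) @ replicate (p^2 * k) 0,
          replicate (p * k) 0 @ replicate (p^2 * k) (real_mod_int (1 / real p))]
          = {torus_point N ?g, torus_point N ?h}"
        unfolding zero two_blocks_torus_point N' by simp
      show "r \<in> integral_relations N ((!) vs) \<longleftrightarrow>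
          (\<exists>a b::int. \<forall>i<N. r i - (of_int a * ?g (\<sigma> i) + of_int b * ?h (\<sigma> i)) \<in> \<int>)" for r
        unfolding rel by (simp only: gh cong: imp_cong)
    qed
  qed
  have "{1..p * k} \<subseteq> {..<N}" using four_le_sq_times[OF p k] by (auto simp: N)
  then obtain \<pi> where \<pi>: "\<pi> permutes {..<N}" "\<And>i. i < N \<Longrightarrow> \<pi> i \<in> {1..p * k} \<longleftrightarrow> i \<in> S"
    using permutation_matching_subsets[OF S(1), of "{1..p * k}"] S(2) by auto
  have "r \<in> integral_relations N ((!) vs) \<longleftrightarrow>
      (\<exists>a b::int. \<forall>i<N. r i - (if \<pi> i \<in> {1..p * k} then of_int a / real p else of_int b / real p) \<in> \<int>)" for r
    unfolding rel by (simp only: \<pi>(2) cong: imp_cong)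
  from equivalent_Delta_BC[OF p k v N B C \<pi>(1) this]
  show "unimodularly_equivalent (convex hull ((!) vs ` {..<N})) (Delta_BC B C)" "length C = CARD('n)"
    by auto
qed

section \<open>The classification\<close>

theorem theorem3p7:
  fixes p k :: nat
    and \<Delta> :: "(real ^ 'n::{finite, linorder}) set"
    and vs :: "(real ^ 'n::{finite, linorder}) list"
  assumes "prime p" and "k > 0"
    and "lattice_simplex CARD('n) \<Delta>"
    and "gorenstein \<Delta>"
    and "has_delta_polynomial \<Delta> (\<Sum>j = 0..p^2 - 1. monom 1 (j * k))"
    and "\<not> (\<exists>m < CARD('n). \<exists>\<Delta>'. lattice_pyramid_over m \<Delta>' \<Delta>)"
    and "distinct vs" and "set vs = {v. v extreme_point_of \<Delta>}"
  shows
    "(CARD('n) = p^2 * k - 1 \<or>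
      CARD('n) = p^2 * k + (p - 1) * k - 1 \<or>
      CARD('n) = p^2 * k + p * k - 1) \<and>
     (CARD('n) = p^2 * k - 1 \<longrightarrow>
        Lambda_generated_by_rows vs
          [replicate (p^2 * k) (real_mod_int (1 / real p ^ 2))]) \<and>
     (CARD('n) = p^2 * k + (p - 1) * k - 1 \<longrightarrow>
        Lambda_generated_by_rows vs
          [replicate ((p^2 - 1) * k) (real_mod_int (1 / real p)) @
           replicate (p * k) (real_mod_int (1 / real p ^ 2))]) \<and>
     (CARD('n) = p^2 * k + p * k - 1 \<longrightarrow>
        Lambda_generated_by_rows vs
          [replicate (p * k) (real_mod_int (1 / real p)) @ replicate (p^2 * k) 0,
           replicate (p * k) 0 @ replicate (p^2 * k) (real_mod_int (1 / real p))]) \<and>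
     (let A\<^sub>1 = replicate (p^2 * k - 2) 1 @ [int p ^ 2];
          A\<^sub>2 = replicate (p * k - 1) 1 @ replicate ((p^2 - 1) * k - 1) (int p) @ [int p ^ 2];
          B = replicate (p * k - 1) 1 @ [int p];
          C = replicate (p * k) (int p) @ replicate (p^2 * k - 2) 1 @ [int p]
      in (CARD('n) = length A\<^sub>1 \<and> unimodularly_equivalent \<Delta> (Delta_A A\<^sub>1)) \<or>
         (CARD('n) = length A\<^sub>2 \<and> unimodularly_equivalent \<Delta> (Delta_A A\<^sub>2)) \<or>
         (CARD('n) = length C \<and> unimodularly_equivalent \<Delta> (Delta_BC B C)))"
proof -
  have p: "p \<ge> 2" using assms(1) by (rule prime_ge_2_nat)
  define N where "N = length vs"
  obtain C where C: "\<not> affine_dependent C" "int (card C) = int CARD('n) + 1" "\<Delta> = convex hull C"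
    using assms(3) by (auto simp: lattice_simplex_def simplex_def)
  have set_vs: "set vs = C"
    unfolding assms(8) C(3) extreme_point_of_convex_hull_affine_independent[OF C(1)] by simp
  have "length vs = CARD('n) + 1" using distinct_card[OF assms(7)] C(2) by (simp add: set_vs)
  moreover have "set vs \<subseteq> lattice_points"
    using assms(3,8) by (simp add: lattice_simplex_def lattice_polytope_def)
  ultimately have v: "simplex_vertices N ((!) vs)"
    unfolding N_def using simplex_vertices_nth[OF assms(7)] C(1) set_vs by simp
  have "(!) vs ` {..<N} = C" by (auto simp: N_def set_vs[symmetric] set_conv_nth)
  then have hull: "convex hull ((!) vs ` {..<N}) = \<Delta>" using C(3) by simp
  have card_N: "CARD('n) = N - 1" using simplex_vertices.N[OF v] by simp
  interpret graded: height_graded_lattice N p k "integral_relations N ((!) vs)"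
    by (rule height_graded_lattice_of_delta_polynomial[OF assms(1,2) v, unfolded hull, OF assms(5,6)])
  have p2k: "p^2 * k \<ge> 4" by (rule four_le_sq_times[OF p assms(2)])
  have pk: "(p - 1) * k > 0" "(p - 1) * k < p * k" using p assms(2) by auto
  obtain h where h: "h \<in> graded.cell" "(\<Sum>i<N. h i) = real k" by (rule graded.first_height)
  show ?thesis
  proof (cases "\<forall>i<N. real p * h i \<in> \<int>")
    case False
    then obtain i0 where i0: "i0 < N" "real p * h i0 \<notin> \<int>" by blast
    have N: "N = p^2 * k" by (rule graded.least_height_of_order_p_square(1)[OF h i0])
    have "r \<in> integral_relations N ((!) vs) \<longleftrightarrow>
        (\<exists>m::int. \<forall>i<N. r i - of_int m / real p ^ 2 \<in> \<int>)" for r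
      using graded.least_height_of_order_p_square(2)[OF h i0] by (simp add: graded.cong_int_def)
    note * = simplex_of_constant_relations[OF p assms(2) N_def[symmetric] v N this refl, unfolded hull]
    have dim: "CARD('n) = p^2 * k - 1" using card_N N by simp
    then have "CARD('n) \<noteq> p^2 * k + (p - 1) * k - 1" "CARD('n) \<noteq> p^2 * k + p * k - 1"
      using pk p2k by linarith+
    then show ?thesis unfolding Let_def using dim *(1,2) *(3)[symmetric] by blast
  next
    case True
    then have ph: "\<And>i. i < N \<Longrightarrow> real p * h i \<in> \<int>" by blast
    show ?thesis
    proof (rule graded.least_height_of_order_p[OF h ph])
      fix S
      assume S: "S \<subseteq> {..<N}" "card S = p * k" and N: "N = p^2 * k + (p - 1) * k"
        and rel: "\<And>r. r \<in> integral_relations N ((!) vs) \<longleftrightarrow>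
          (\<exists>m::int. graded.cong_int r (\<lambda>i. of_int m * (if i \<in> S then 1 / real p ^ 2 else 1 / real p)))"
      note * = simplex_of_mixed_relations[OF p assms(2) N_def[symmetric] v N S
          rel[unfolded graded.cong_int_def] refl, unfolded hull]
      have dim: "CARD('n) = p^2 * k + (p - 1) * k - 1" using card_N N by simp
      then have "CARD('n) \<noteq> p^2 * k - 1" "CARD('n) \<noteq> p^2 * k + p * k - 1"
        using pk p2k by linarith+
      then show ?thesis unfolding Let_def using dim *(1,2) *(3)[symmetric] by blast
    next
      fix S
      assume S: "S \<subseteq> {..<N}" "card S = p * k" and N: "N = p^2 * k + p * k"
        and rel: "\<And>r. r \<in> integral_relations N ((!) vs) \<longleftrightarrow>
          (\<exists>a b::int. graded.cong_int r (\<lambda>i. if i \<in> S then of_int a / real p else of_int b / real p))"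
      note * = simplex_of_block_relations[OF p assms(2) N_def[symmetric] v N S
          rel[unfolded graded.cong_int_def] refl refl, unfolded hull]
      have dim: "CARD('n) = p^2 * k + p * k - 1" using card_N N by simp
      then have "CARD('n) \<noteq> p^2 * k - 1" "CARD('n) \<noteq> p^2 * k + (p - 1) * k - 1"
        using pk p2k by linarith+
      then show ?thesis unfolding Let_def using dim *(1,2) *(3)[symmetric] by blast
    qed
  qed
qed

end
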